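(* Let $d\ge1$, $1\le p<\tfrac{2(d+1)}{d}$ and set $q:=\tfrac{d+2}{d}p'$. Then $$S_{p\to q}\ \ge\ \alpha_{p,q}\,P_{p\to q}.$$
   Context: $\mathbb{S}^d\subseteq\mathbb{R}^{d+1}$ is the unit sphere with $d$-dimensional Hausdorff measure $\sigma$. The spherical and parabolic extension operators are $$\mathcal{E}f(x)=\int_{\mathbb{S}^d}e^{ix\cdot\omega}f(\omega)\,d\sigma(\omega),\qquad \mathcal{E}_{\mathbb{P}}f(x)=\int_{\mathbb{R}^d}e^{ix\cdot(\frac12|\xi|^2,\xi)}f(\xi)\,d\xi,\qquad x\in\mathbb{R}^{d+1}.$$ Their operator norms, in $(0,\infty]$, are $S_{p\to q}=\sup_{\|f\|_{L^p(\mathbb{S}^d;d\sigma)}=1}\|\mathcal{E}f\|_{L^q(\mathbb{R}^{d+1})}$ and $P_{p\to q}=\sup_{\|f\|_{L^p(\mathbb{R}^d)}=1}\|\mathcal{E}_{\mathbb{P}}f\|_{L^q(\mathbb{R}^{d+1})}$, the suprema being over smooth, compactly supported functions. $p'$ is the conjugate exponent of $p$. For $1\le p<q=\tfrac{d+2}{d}p'$, $$\alpha_{p,q}:=\max_{t\in[0,1]}\frac{\|1+te^{i\theta}\|_{L^q([0,2\pi],d\theta/2\pi)}}{(1+t^p)^{1/p}}.$$ *)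

theory Defs
  imports "HOL-Analysis.Analysis" "HOL-Probability.Essential_Supremum"
begin

definition hausdorff_pre :: "nat \<Rightarrow> real \<Rightarrow> 'a::metric_space set \<Rightarrow> ennreal" where
  "hausdorff_pre d \<delta> A =
     (INF U \<in> {U :: nat \<Rightarrow> 'a set. (\<forall>i. bounded (U i) \<and> diameter (U i) \<le> \<delta>) \<and> A \<subseteq> (\<Union>i. U i)}.
        \<Sum>i. ennreal (unit_ball_vol (real d) * (diameter (U i) / 2) ^ d))"

(* The factor unit_ball_vol d / 2^d is the normalization for which the d-dimensional
   Hausdorff measure on R^d is Lebesgue measure. Only d >= 1 is used: for d = 0 the empty
   set would contribute 0 ^ 0 = 1 to a cover. *)
definition hausdorff_outer :: "nat \<Rightarrow> 'a::metric_space set \<Rightarrow> ennreal" where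
  "hausdorff_outer d A = (SUP \<delta>\<in>{0<..}. hausdorff_pre d \<delta> A)"

definition hausdorff_measure :: "nat \<Rightarrow> 'a::metric_space measure" where
  "hausdorff_measure d = measure_of UNIV (sets borel) (hausdorff_outer d)"

(* With d = CARD('n), R^d is real^'n and R^(d+1) is real \<times> (real^'n), with product norm
   equal to the Euclidean one. *)
definition sphere_measure :: "(real \<times> (real^'n::finite)) measure" where
  "sphere_measure = restrict_space (hausdorff_measure CARD('n)) (sphere 0 1)"

(* Exponents range over [1, \<infinity>]. *)
definition Lp_norm :: "ennreal \<Rightarrow> 'a measure \<Rightarrow> ('a \<Rightarrow> complex) \<Rightarrow> ennreal" where
  "Lp_norm p M f =
     (if p = \<infinity> then esssup M (\<lambda>x. ennreal (norm (f x)))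
      else let I = (\<integral>\<^sup>+ x. ennreal (norm (f x) powr enn2real p) \<partial>M)
           in if I = \<infinity> then \<infinity> else ennreal (enn2real I powr (1 / enn2real p)))"

definition conj_exponent :: "real \<Rightarrow> ennreal" where
  "conj_exponent p = (if p = 1 then \<infinity> else ennreal (p / (p - 1)))"

(* f is k times continuously differentiable on the open set S. *)
fun Ck_on :: "nat \<Rightarrow> 'a::euclidean_space set \<Rightarrow> ('a \<Rightarrow> complex) \<Rightarrow> bool" where
  "Ck_on 0 S f \<longleftrightarrow> continuous_on S f"
| "Ck_on (Suc k) S f \<longleftrightarrow>
     (\<forall>x\<in>S. f differentiable (at x)) \<and> (\<forall>v. Ck_on k S (\<lambda>x. frechet_derivative f (at x) v))"

(* Smoothness on an arbitrary subset A of Euclidean space: f agrees locally on A with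
   smooth functions on open sets. For A = UNIV, and for embedded submanifolds such as the
   sphere, this is smoothness in the usual sense. *)
definition smooth_on :: "'a::euclidean_space set \<Rightarrow> ('a \<Rightarrow> complex) \<Rightarrow> bool" where
  "smooth_on A f \<longleftrightarrow>
     (\<forall>x\<in>A. \<exists>U g. open U \<and> x \<in> U \<and> (\<forall>k. Ck_on k U g) \<and> (\<forall>y\<in>A \<inter> U. f y = g y))"

definition sphere_extension ::
  "(real \<times> (real^'n) \<Rightarrow> complex) \<Rightarrow> real \<times> (real^'n) \<Rightarrow> complex" where
  "sphere_extension f x = (\<integral>\<omega>. exp (\<i> * of_real (x \<bullet> \<omega>)) * f \<omega> \<partial>sphere_measure)"

definition parabola_extension ::
  "(real^'n \<Rightarrow> complex) \<Rightarrow> real \<times> (real^'n) \<Rightarrow> complex" where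
  "parabola_extension f x =
     (\<integral>\<xi>. exp (\<i> * of_real (x \<bullet> ((norm \<xi>)\<^sup>2 / 2, \<xi>))) * f \<xi> \<partial>lborel)"

definition sphere_opnorm :: "'n::finite itself \<Rightarrow> ennreal \<Rightarrow> ennreal \<Rightarrow> ennreal" where
  "sphere_opnorm _ p q =
     (SUP f \<in> {f :: real \<times> (real^'n) \<Rightarrow> complex.
                smooth_on (sphere 0 1) f \<and> Lp_norm p sphere_measure f = 1}.
        Lp_norm q lborel (sphere_extension f))"

definition parabola_opnorm :: "'n::finite itself \<Rightarrow> ennreal \<Rightarrow> ennreal \<Rightarrow> ennreal" where
  "parabola_opnorm _ p q =
     (SUP f \<in> {f :: real^'n \<Rightarrow> complex.
                smooth_on UNIV f \<and> compact (closure {\<xi>. f \<xi> \<noteq> 0}) \<and> Lp_norm p lborel f = 1}.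
        Lp_norm q lborel (parabola_extension f))"

(* The supremum is a maximum, since the quotient is continuous in t on [0,1]. *)
definition alpha :: "real \<Rightarrow> ennreal \<Rightarrow> ennreal" where
  "alpha p q =
     (SUP t\<in>{0..1}.
        Lp_norm q (uniform_measure lborel {0..2 * pi}) (\<lambda>\<theta>. 1 + of_real t * exp (\<i> * of_real \<theta>))
        / ennreal ((1 + t powr p) powr (1 / p)))"

end

theory Submission
  imports Defs
begin

text \<open>
Why the bound holds. Take a function on \<open>R^d\<close> that is nearly extremal for the parabolic operator, shrink it by a
small factor \<open>s\<close> and lift it to a cap about the pole of the sphere. There the sphere is a paraboloid up to
errors of higher order, so that in parabolically rescaled variables the modulus of the spherical extension
converges to that of the parabolic extension (\<open>sphere_extension_cap_fun_tendsto\<close>); the relation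
\<open>q = (d + 2) / d * p'\<close> makes all powers of \<open>s\<close> cancel. This alone gives the inequality without the factor
\<open>alpha\<close>.

The factor comes from using the antipodal cap as well. If \<open>z\<close> is the extension of \<open>F\<close>, then the extension of
\<open>F + t * exp (\<i> * \<theta>) * cnj (F (- \<omega>))\<close> is \<open>z + t * exp (\<i> * \<theta>) * cnj z\<close>, while the \<open>p\<close>-th power of the norm of the
function is that of \<open>F\<close> times \<open>1 + t powr p\<close>, for every phase \<open>\<theta>\<close>. Averaged over \<open>\<theta>\<close>, the \<open>q\<close>-th power of
\<open>|z + t * exp (\<i> * \<theta>) * cnj z|\<close> is \<open>|z| powr q\<close> times the mean of \<open>|1 + t * exp (\<i> * \<theta>)| powr q\<close>. The bound by
the operator norm thus gains exactly the quotient in the definition of \<open>alpha\<close>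
(\<open>antipodal_pair_bound\<close>). With Fatou's lemma in the limit \<open>s \<longlonglongrightarrow> 0\<close> this settles \<open>p > 1\<close>
(\<open>circle_mean_parabola_extension_le\<close>). For \<open>p = 1\<close>, \<open>q = \<infinity>\<close>, the factor is at most 1 and a pointwise limit suffices
(\<open>norm_parabola_extension_le_sphere_opnorm\<close>).

What remains is to know the Hausdorff measure of the sphere near its pole. The normalization matters: if the
surface measure were multiplied by \<open>c\<close>, the spherical operator norm would be multiplied by \<open>c powr (1 / p')\<close>. A
small cap is nearly isometric to a subset of \<open>R^d\<close> (\<open>emeasure_cap\<close>), so the question is whether Hausdorff
measure on \<open>R^d\<close> is Lebesgue measure (\<open>hausdorff_outer_eq_lborel\<close>). One half is Vitali's covering theorem, the
other is the isodiametric inequality (\<open>isodiametric_inequality\<close>), which follows from the Prekopa-Leindler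
inequality applied to a set and its reflection.
\<close>

section \<open>Hausdorff measure as a Borel measure\<close>

text \<open>
Caratheodory's criterion. To split a set \<open>X\<close> along a closed set \<open>C\<close>, let \<open>D n\<close> be the points of \<open>X\<close> at
distance at least \<open>1 / (n + 1)\<close> from \<open>C\<close>, and \<open>R n\<close> the layer between \<open>D n\<close> and \<open>D (n + 1)\<close>. Separation
makes \<open>f\<close> additive on \<open>X \<inter> C\<close> and \<open>D n\<close>, so the loss is what lies in the layers from \<open>n\<close> on. The layers of
even index are mutually separated, and so are those of odd index; hence the sum of \<open>f\<close> over all layers is
at most \<open>2 * f X\<close>, and its tails tend to 0.
\<close>

lemma borel_subset_lambda_system:
  fixes f :: "'a::metric_space set \<Rightarrow> ennreal"
  assumes oms: "outer_measure_space (Pow UNIV) f"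
    and sep: "\<And>A B \<eta>. 0 < \<eta> \<Longrightarrow> (\<And>x y. x \<in> A \<Longrightarrow> y \<in> B \<Longrightarrow> \<eta> \<le> dist x y) \<Longrightarrow> f A + f B \<le> f (A \<union> B)"
  shows "sets borel \<subseteq> lambda_system UNIV (Pow UNIV) f"
proof -
  have pos: "f {} = 0"
    using oms by (simp add: outer_measure_space_def positive_def)
  have mono: "f A \<le> f B" if "A \<subseteq> B" for A B
    using oms that by (simp add: outer_measure_space_def increasing_def)
  have csub: "f (\<Union>i. A i) \<le> (\<Sum>i. f (A i))" if "disjoint_family A" for A :: "nat \<Rightarrow> 'a set"
    using oms that by (simp add: outer_measure_space_def countably_subadditive_def)
  have sub: "f (A \<union> B) \<le> f A + f B" if "A \<inter> B = {}" for A B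
  proof -
    have "disjoint_family (binaryset A B)"
      using that by (auto simp: disjoint_family_on_def binaryset_def)
    from csub[OF this] show ?thesis
      using suminf_binaryset_eq[of f A B] pos by (simp add: UN_binaryset_eq)
  qed
  have lam: "C \<in> lambda_system UNIV (Pow UNIV) f" if C: "closed C" for C :: "'a set"
  proof (cases "C = {}")
    case True
    then show ?thesis by (simp add: lambda_system_def pos)
  next
    case False
    have main: "f (C \<inter> X) + f (X - C) \<le> f X" for X
    proof (cases "f X = top")
      case fin: False
      define D where "D n = {x\<in>X - C. 1 / (real n + 1) \<le> infdist x C}" for n :: nat
      define R where "R n = {x\<in>X - C. 1 / (real n + 2) \<le> infdist x C \<and> infdist x C < 1 / (real n + 1)}" for n :: nat
      have D1: "f (C \<inter> X) + f (D n) \<le> f X" for n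
      proof -
        have "f (C \<inter> X) + f (D n) \<le> f ((C \<inter> X) \<union> D n)"
        proof (rule sep[of "1 / (real n + 1)"])
          fix x y assume "x \<in> C \<inter> X" "y \<in> D n"
          then show "1 / (real n + 1) \<le> dist x y"
            using infdist_le[of x C y] by (auto simp: D_def dist_commute)
        qed simp
        also have "\<dots> \<le> f X" by (rule mono) (auto simp: D_def)
        finally show ?thesis .
      qed
      have R1: "(\<Sum>k<N. f (R (2 * k + c))) \<le> f (\<Union>k<N. R (2 * k + c))" for N c
      proof (induction N)
        case (Suc N)
        show ?case
        proof (cases "N = 0")
          case N: False
          define m where "m = 2 * N + c"
          have m: "m > 0" using N by (simp add: m_def)
          have "f (\<Union>k<N. R (2 * k + c)) + f (R (2 * N + c)) \<le> f ((\<Union>k<N. R (2 * k + c)) \<union> R (2 * N + c))"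
          proof (rule sep[of "1 / real m - 1 / (real m + 1)"])
            show "0 < 1 / real m - 1 / (real m + 1)"
              using m by (simp add: field_simps add_pos_nonneg)
          next
            fix x y assume "x \<in> (\<Union>k<N. R (2 * k + c))" and y: "y \<in> R (2 * N + c)"
            then obtain k where k: "k < N" "x \<in> R (2 * k + c)" by auto
            have "1 / real m \<le> 1 / (real (2 * k + c) + 2)"
              using k(1) by (intro divide_left_mono) (auto simp: m_def)
            also have "\<dots> \<le> infdist x C" using k by (simp add: R_def)
            also have "\<dots> \<le> infdist y C + dist x y" by (rule infdist_triangle)
            finally show "1 / real m - 1 / (real m + 1) \<le> dist x y"
              using y by (simp add: R_def m_def)
          qed
          also have "((\<Union>k<N. R (2 * k + c)) \<union> R (2 * N + c)) = (\<Union>k<Suc N. R (2 * k + c))"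
            by (auto simp: less_Suc_eq)
          finally have "f (\<Union>k<N. R (2 * k + c)) + f (R (2 * N + c)) \<le> f (\<Union>k<Suc N. R (2 * k + c))" .
          with Suc show ?thesis
            unfolding sum.lessThan_Suc by (rule order_trans[OF add_right_mono])
        qed (simp add: lessThan_Suc)
      qed (simp add: pos)
      have R2: "(\<Sum>k. f (R (2 * k + c))) \<le> f X" for c
      proof (rule suminf_le_const[OF summableI])
        fix N show "(\<Sum>k<N. f (R (2 * k + c))) \<le> f X"
          using R1[where N=N and c=c] by (rule order_trans) (auto intro!: mono simp: R_def)
      qed
      have R3: "(\<Sum>k. f (R k)) \<le> f X + f X"
      proof (rule suminf_le_const[OF summableI])
        fix N
        have "(\<Sum>k<N. f (R k)) \<le> (\<Sum>k<2 * N. f (R k))"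
          by (rule sum_mono2) auto
        also have "(\<Sum>k<2 * N. f (R k)) = (\<Sum>k<N. f (R (2 * k + 0))) + (\<Sum>k<N. f (R (2 * k + 1)))"
          by (induction N) (simp_all add: add_ac)
        also have "\<dots> \<le> f X + f X"
          by (intro add_mono order_trans[OF sum_le_suminf R2] summableI) auto
        finally show "(\<Sum>k<N. f (R k)) \<le> f X + f X" .
      qed
      define r where "r k = enn2real (f (R k))" for k
      have fr: "f (R k) = ennreal (r k)" for k
      proof -
        have "f (R k) \<le> f X" by (rule mono) (auto simp: R_def)
        then show ?thesis using fin unfolding r_def by (simp add: less_top top.not_eq_extremum)
      qed
      have sum_r: "summable r"
      proof (rule summable_suminf_not_top)
        show "(\<Sum>i. ennreal (r i)) \<noteq> top"
          using R3 fin unfolding fr[symmetric] by (metis ennreal_add_eq_top top.extremum_uniqueI)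
      qed (simp add: r_def)
      have tail: "f (X - C) \<le> f (D n) + ennreal (\<Sum>k. r (k + n))" for n
      proof -
        have disj: "disjoint_family (\<lambda>k. R (k + n))"
          unfolding disjoint_family_on_def
        proof (intro ballI impI)
          have *: "R a \<inter> R b = {}" if "a < b" for a b
          proof -
            have "1 / (real b + 1) \<le> 1 / (real a + 2)"
              using that by (intro divide_left_mono) auto
            then show ?thesis by (auto simp: R_def)
          qed
          fix a b :: nat assume "a \<noteq> b"
          then show "R (a + n) \<inter> R (b + n) = {}"
            using *[of "a + n" "b + n"] *[of "b + n" "a + n"] by (cases "a < b") auto
        qed
        have "X - C \<subseteq> D n \<union> (\<Union>k. R (k + n))"
        proof
          fix x assume x: "x \<in> X - C"
          then have "infdist x C > 0"
            using C False by (metis DiffD2 closure_closed in_closure_iff_infdist_zero infdist_nonneg less_eq_real_def)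
          then obtain m where m: "inverse (real (Suc m)) < infdist x C" using reals_Archimedean by blast
          show "x \<in> D n \<union> (\<Union>k. R (k + n))"
          proof (cases "x \<in> D n")
            case nD: False
            define P where "P k = (1 / (real k + 2) \<le> infdist x C)" for k
            have "P m"
            proof -
              have "1 / (real m + 2) \<le> inverse (real (Suc m))" by (simp add: field_simps)
              with m show ?thesis unfolding P_def by simp
            qed
            define k where "k = (LEAST k. P k)"
            have Pk: "P k" unfolding k_def by (rule LeastI) fact
            have lt: "infdist x C < 1 / (real k + 1)"
            proof (cases k)
              case 0
              have "infdist x C < 1 / (real n + 1)" using nD x by (auto simp: D_def)
              also have "\<dots> \<le> 1" by simp
              finally show ?thesis using 0 by simp
            next
              case (Suc k')
              then have "\<not> P k'" using not_less_Least[of k' P] by (simp add: k_def)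
              then show ?thesis using Suc by (simp add: P_def add.commute)
            qed
            have "k \<ge> n"
            proof (rule ccontr)
              assume "\<not> n \<le> k"
              then have "1 / (real n + 1) \<le> 1 / (real k + 2)"
                by (intro divide_left_mono) auto
              then show False using Pk nD x by (auto simp: P_def D_def)
            qed
            moreover have "x \<in> R k" using x Pk lt by (simp add: R_def P_def)
            ultimately show ?thesis by (metis UNIV_I UN_I UnI2 le_add_diff_inverse2)
          qed simp
        qed
        then have "f (X - C) \<le> f (D n \<union> ((\<Union>k. R (k + n)) - D n))" by (intro mono) auto
        also have "\<dots> \<le> f (D n) + f ((\<Union>k. R (k + n)) - D n)" by (rule sub) auto
        also have "\<dots> \<le> f (D n) + f (\<Union>k. R (k + n))" by (intro add_left_mono mono) auto
        also have "\<dots> \<le> f (D n) + (\<Sum>k. f (R (k + n)))" using csub[OF disj] by (rule add_left_mono)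
        also have "(\<Sum>k. f (R (k + n))) = ennreal (\<Sum>k. r (k + n))"
          unfolding fr
          by (intro suminf_ennreal2 summable_ignore_initial_segment) (simp add: r_def, rule sum_r)
        finally show ?thesis .
      qed
      show ?thesis
      proof (rule ennreal_le_epsilon)
        fix e :: real assume "0 < e"
        then obtain n where "norm (\<Sum>k. r (k + n)) < e"
          using suminf_exist_split[OF _ sum_r, of e] by blast
        then have e: "ennreal (\<Sum>k. r (k + n)) \<le> ennreal e"
          unfolding real_norm_def by (meson abs_ge_self ennreal_leI le_less_trans less_imp_le)
        have "f (C \<inter> X) + f (X - C) \<le> f (C \<inter> X) + (f (D n) + ennreal (\<Sum>k. r (k + n)))"
          by (rule add_left_mono[OF tail])
        also have "\<dots> = (f (C \<inter> X) + f (D n)) + ennreal (\<Sum>k. r (k + n))"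
          by (rule add.assoc[symmetric])
        also have "\<dots> \<le> f X + ennreal e"
          by (rule add_mono[OF D1 e])
        finally show "f (C \<inter> X) + f (X - C) \<le> f X + ennreal e" .
      qed
    qed simp
    have "f (C \<inter> X) + f ((UNIV - C) \<inter> X) = f X" for X
    proof (rule antisym)
      have eq: "(UNIV - C) \<inter> X = X - C" by blast
      show "f (C \<inter> X) + f ((UNIV - C) \<inter> X) \<le> f X"
        unfolding eq by (rule main)
      have "(C \<inter> X) \<inter> (X - C) = {}" by blast
      note sub[OF this]
      moreover have "(C \<inter> X) \<union> (X - C) = X" by blast
      ultimately show "f X \<le> f (C \<inter> X) + f ((UNIV - C) \<inter> X)"
        unfolding eq by metis
    qed
    then show ?thesis by (simp add: lambda_system_def)
  qed
  have "sigma_sets UNIV {C :: 'a set. closed C} \<subseteq> lambda_system UNIV (Pow UNIV) f"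
    using sigma_algebra.caratheodory_lemma[OF sigma_algebra_Pow oms] lam
    by (intro sigma_algebra.sigma_sets_subset) (auto simp: measure_space_def)
  then show ?thesis
    by (simp add: borel_eq_closed)
qed

abbreviation ball_cost :: "nat \<Rightarrow> 'a::metric_space set \<Rightarrow> ennreal" where
  "ball_cost d U \<equiv> ennreal (unit_ball_vol (real d) * (diameter U / 2) ^ d)"

context
  fixes d :: nat
  assumes d: "1 \<le> d"
begin

lemma hausdorff_pre_mono: "A \<subseteq> B \<Longrightarrow> hausdorff_pre d \<delta> A \<le> hausdorff_pre d \<delta> B"
  unfolding hausdorff_pre_def by (intro INF_superset_mono) auto

lemma hausdorff_pre_le:
  assumes "\<And>i::nat. bounded (U i)" "\<And>i. diameter (U i) \<le> \<delta>" "A \<subseteq> (\<Union>i. U i)"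
  shows "hausdorff_pre d \<delta> A \<le> (\<Sum>i. ball_cost d (U i))"
  unfolding hausdorff_pre_def using assms by (intro INF_lower) auto

lemma hausdorff_pre_antimono:
  assumes "\<delta> \<le> \<delta>'" shows "hausdorff_pre d \<delta>' A \<le> hausdorff_pre d \<delta> A"
  unfolding hausdorff_pre_def using assms by (intro INF_superset_mono) (auto intro: order_trans)

lemma hausdorff_pre_empty: "0 \<le> \<delta> \<Longrightarrow> hausdorff_pre d \<delta> {} = 0"
  using hausdorff_pre_le[of "\<lambda>_. {}" \<delta> "{}"] d by (simp add: power_0_left)

lemma hausdorff_pre_countably_subadditive:
  fixes A :: "nat \<Rightarrow> 'a::metric_space set"
  shows "hausdorff_pre d \<delta> (\<Union>n. A n) \<le> (\<Sum>n. hausdorff_pre d \<delta> (A n))"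
proof (cases "\<forall>n. hausdorff_pre d \<delta> (A n) < top")
  case False
  then obtain n where "hausdorff_pre d \<delta> (A n) = top" by (force simp: less_top)
  then have "(\<Sum>n. hausdorff_pre d \<delta> (A n)) = top"
    using sum_le_suminf[of "\<lambda>n. hausdorff_pre d \<delta> (A n)" "{n}"] by (simp add: top_unique)
  then show ?thesis by simp
next
  case fin: True
  define w where "w (V :: 'a set) = ball_cost d V" for V
  show ?thesis
  proof (rule ennreal_le_epsilon)
    fix e :: real assume e: "0 < e"
    have "\<exists>U. (\<forall>i::nat. bounded (U i) \<and> diameter (U i) \<le> \<delta>) \<and> A n \<subseteq> (\<Union>i. U i) \<and>
            (\<Sum>i. w (U i)) < hausdorff_pre d \<delta> (A n) + ennreal (e * (1 / 2) ^ Suc n)" for n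
    proof -
      have "hausdorff_pre d \<delta> (A n) < hausdorff_pre d \<delta> (A n) + ennreal (e * (1 / 2) ^ Suc n)"
        using fin e ennreal_add_left_cancel_less[of "hausdorff_pre d \<delta> (A n)" 0 "ennreal (e * (1 / 2) ^ Suc n)"]
        by (auto simp: ennreal_zero_less_mult_iff less_top)
      then show ?thesis
        unfolding w_def by (subst (asm) (1) hausdorff_pre_def) (auto simp: INF_less_iff)
    qed
    then obtain U where U: "\<And>n i. bounded (U n i)" "\<And>n i. diameter (U n i) \<le> \<delta>" "\<And>n. A n \<subseteq> (\<Union>i::nat. U n i)"
      "\<And>n. (\<Sum>i. w (U n i)) < hausdorff_pre d \<delta> (A n) + ennreal (e * (1 / 2) ^ Suc n)"
      by metis
    define V where "V k = case_prod U (prod_decode k)" for k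
    have "hausdorff_pre d \<delta> (\<Union>n. A n) \<le> (\<Sum>k. w (V k))"
      unfolding w_def
    proof (rule hausdorff_pre_le)
      show "(\<Union>n. A n) \<subseteq> (\<Union>k. V k)"
      proof
        fix x assume "x \<in> (\<Union>n. A n)"
        then obtain n i where "x \<in> U n i" using U(3) by blast
        then have "x \<in> V (prod_encode (n, i))" by (simp add: V_def)
        then show "x \<in> (\<Union>k. V k)" by blast
      qed
    qed (auto simp: V_def U split: prod.split)
    also have "\<dots> = (\<Sum>n. \<Sum>i. w (U n i))"
      using suminf_ennreal_2dimen[of "\<lambda>n. \<Sum>i. w (U n i)" "\<lambda>(n, i). w (U n i)"]
      by (simp add: V_def case_prod_unfold)
    also have "\<dots> \<le> (\<Sum>n. hausdorff_pre d \<delta> (A n) + ennreal (e * (1 / 2) ^ Suc n))"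
      using U(4) by (intro suminf_le summableI) (auto intro: less_imp_le)
    also have "\<dots> = (\<Sum>n. hausdorff_pre d \<delta> (A n)) + (\<Sum>n. ennreal (e * (1 / 2) ^ Suc n))"
      by (rule suminf_add[symmetric]) (rule summableI)+
    also have "(\<Sum>n. ennreal (e * (1 / 2) ^ Suc n)) = ennreal e"
      using sums_mult[OF power_half_series, of e] e by (intro suminf_ennreal_eq) auto
    finally show "hausdorff_pre d \<delta> (\<Union>n. A n) \<le> (\<Sum>n. hausdorff_pre d \<delta> (A n)) + ennreal e" .
  qed
qed

lemma hausdorff_pre_le_outer: "0 < \<delta> \<Longrightarrow> hausdorff_pre d \<delta> A \<le> hausdorff_outer d A"
  unfolding hausdorff_outer_def by (intro SUP_upper) auto

lemma hausdorff_outer_mono: "A \<subseteq> B \<Longrightarrow> hausdorff_outer d A \<le> hausdorff_outer d B"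
  unfolding hausdorff_outer_def by (intro SUP_mono') (rule hausdorff_pre_mono)

lemma outer_measure_space_hausdorff:
  "outer_measure_space (Pow UNIV) (hausdorff_outer d :: 'a::metric_space set \<Rightarrow> ennreal)"
  unfolding outer_measure_space_def
proof (intro conjI)
  show "positive (Pow UNIV) (hausdorff_outer d :: 'a set \<Rightarrow> ennreal)"
    by (auto simp: positive_def hausdorff_outer_def hausdorff_pre_empty)
  show "increasing (Pow UNIV) (hausdorff_outer d :: 'a set \<Rightarrow> ennreal)"
    by (auto simp: increasing_def intro: hausdorff_outer_mono)
  have "hausdorff_outer d (\<Union>n. A n) \<le> (\<Sum>n. hausdorff_outer d (A n))" for A :: "nat \<Rightarrow> 'a set"
    unfolding hausdorff_outer_def[of d "\<Union>n. A n"]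
  proof (rule SUP_least)
    fix \<delta> :: real assume "\<delta> \<in> {0<..}"
    then show "hausdorff_pre d \<delta> (\<Union>n. A n) \<le> (\<Sum>n. hausdorff_outer d (A n))"
      by (intro order_trans[OF hausdorff_pre_countably_subadditive] suminf_le summableI hausdorff_pre_le_outer) auto
  qed
  then show "countably_subadditive (Pow UNIV) (hausdorff_outer d :: 'a set \<Rightarrow> ennreal)"
    by (auto simp: countably_subadditive_def)
qed

text \<open>
A set of diameter at most \<open>\<delta>\<close> cannot meet both \<open>A\<close> and \<open>B\<close>, so every cover of the union splits into a cover
of \<open>A\<close> and one of \<open>B\<close>. The members that are dropped from a cover become empty; they cost nothing because
\<open>0 ^ d = 0\<close> for \<open>d \<ge> 1\<close>.
\<close>

lemma hausdorff_pre_separated: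
  fixes A B :: "'a::metric_space set"
  assumes dist: "\<And>x y. x \<in> A \<Longrightarrow> y \<in> B \<Longrightarrow> \<delta> < dist x y" and \<delta>: "0 \<le> \<delta>"
  shows "hausdorff_pre d \<delta> A + hausdorff_pre d \<delta> B \<le> hausdorff_pre d \<delta> (A \<union> B)"
  unfolding hausdorff_pre_def[of d \<delta> "A \<union> B"]
proof (rule INF_greatest)
  fix U :: "nat \<Rightarrow> 'a set"
  assume "U \<in> {U. (\<forall>i. bounded (U i) \<and> diameter (U i) \<le> \<delta>) \<and> A \<union> B \<subseteq> (\<Union>i. U i)}"
  then have U: "\<And>i. bounded (U i)" "\<And>i. diameter (U i) \<le> \<delta>" "A \<union> B \<subseteq> (\<Union>i. U i)" by auto
  define w where "w (V :: 'a set) = ball_cost d V" for V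
  have w0: "w {} = 0" using d by (simp add: w_def power_0_left)
  define UA where "UA i = (if U i \<inter> A = {} then {} else U i)" for i
  define UB where "UB i = (if U i \<inter> A = {} then U i else {})" for i
  have cA: "A \<subseteq> (\<Union>i. UA i)" using U(3) by (fastforce simp: UA_def)
  have cB: "B \<subseteq> (\<Union>i. UB i)"
  proof
    fix y assume y: "y \<in> B"
    then obtain i where i: "y \<in> U i" using U(3) by blast
    have "U i \<inter> A = {}"
    proof (rule ccontr)
      assume "U i \<inter> A \<noteq> {}"
      then obtain x where "x \<in> U i" "x \<in> A" by blast
      then show False
        using diameter_bounded_bound[OF U(1), of x i y] U(2)[of i] dist[of x y] i y by simp
    qed
    then show "y \<in> (\<Union>i. UB i)" using i by (auto simp: UB_def)
  qed
  have "hausdorff_pre d \<delta> A \<le> (\<Sum>i. w (UA i))"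
    unfolding w_def using U cA \<delta> by (intro hausdorff_pre_le) (auto simp: UA_def)
  moreover have "hausdorff_pre d \<delta> B \<le> (\<Sum>i. w (UB i))"
    unfolding w_def using U cB \<delta> by (intro hausdorff_pre_le) (auto simp: UB_def)
  ultimately have "hausdorff_pre d \<delta> A + hausdorff_pre d \<delta> B \<le> (\<Sum>i. w (UA i)) + (\<Sum>i. w (UB i))"
    by (rule add_mono)
  also have "\<dots> = (\<Sum>i. w (UA i) + w (UB i))"
    by (rule suminf_add) (rule summableI)+
  also have "\<dots> = (\<Sum>i. w (U i))"
    by (rule suminf_cong) (simp add: UA_def UB_def w0)
  finally show "hausdorff_pre d \<delta> A + hausdorff_pre d \<delta> B \<le> (\<Sum>i. ball_cost d (U i))"
    by (simp only: w_def)
qed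

lemma hausdorff_outer_separated:
  fixes A B :: "'a::metric_space set"
  assumes \<eta>: "0 < \<eta>" and dist: "\<And>x y. x \<in> A \<Longrightarrow> y \<in> B \<Longrightarrow> \<eta> \<le> dist x y"
  shows "hausdorff_outer d A + hausdorff_outer d B \<le> hausdorff_outer d (A \<union> B)"
proof -
  have *: "hausdorff_pre d \<delta> A + hausdorff_pre d \<delta>' B \<le> hausdorff_outer d (A \<union> B)" if "0 < \<delta>" "0 < \<delta>'" for \<delta> \<delta>'
  proof -
    \<comment> \<open>Below \<open>\<eta>\<close> for the separation, and below both scales for monotonicity.\<close>
    define r where "r = min (\<eta> / 2) (min \<delta> \<delta>')"
    have r: "0 < r" "r < \<eta>" "r \<le> \<delta>" "r \<le> \<delta>'" using that \<eta> by (auto simp: r_def)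
    have "hausdorff_pre d \<delta> A + hausdorff_pre d \<delta>' B \<le> hausdorff_pre d r A + hausdorff_pre d r B"
      using r by (intro add_mono hausdorff_pre_antimono)
    also have "\<dots> \<le> hausdorff_pre d r (A \<union> B)"
      using r dist by (intro hausdorff_pre_separated) force+
    also have "\<dots> \<le> hausdorff_outer d (A \<union> B)" using r(1) by (rule hausdorff_pre_le_outer)
    finally show ?thesis .
  qed
  have "hausdorff_outer d A + hausdorff_pre d \<delta>' B \<le> hausdorff_outer d (A \<union> B)" if "0 < \<delta>'" for \<delta>'
    unfolding hausdorff_outer_def[of d A]
    by (subst ennreal_SUP_add_left[symmetric]) (auto intro!: SUP_least * that)
  then show ?thesis
    unfolding hausdorff_outer_def[of d B]
    by (subst ennreal_SUP_add_right) (auto intro!: SUP_least)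
qed

lemma emeasure_hausdorff_measure:
  fixes A :: "'a::metric_space set"
  assumes "A \<in> sets borel"
  shows "emeasure (hausdorff_measure d) A = hausdorff_outer d A"
  unfolding hausdorff_measure_def
proof (rule emeasure_measure_of_sigma)
  have sub: "sets borel \<subseteq> lambda_system UNIV (Pow UNIV) (hausdorff_outer d :: 'a set \<Rightarrow> ennreal)"
    by (rule borel_subset_lambda_system[OF outer_measure_space_hausdorff hausdorff_outer_separated])
  have ms: "measure_space UNIV (lambda_system UNIV (Pow UNIV) (hausdorff_outer d :: 'a set \<Rightarrow> ennreal)) (hausdorff_outer d)"
    using sigma_algebra.caratheodory_lemma[OF sigma_algebra_Pow outer_measure_space_hausdorff] .
  show "sigma_algebra UNIV (sets (borel :: 'a measure))"
    using sets.sigma_algebra_axioms[of "borel :: 'a measure"] by simp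
  show "positive (sets borel) (hausdorff_outer d :: 'a set \<Rightarrow> ennreal)"
    using ms by (simp add: measure_space_def positive_def)
  show "countably_additive (sets borel) (hausdorff_outer d :: 'a set \<Rightarrow> ennreal)"
    using ms sub unfolding measure_space_def countably_additive_def by blast
  show "A \<in> sets borel" by fact
qed

lemma sets_hausdorff_measure [measurable_cong]: "sets (hausdorff_measure d) = sets borel"
  unfolding hausdorff_measure_def by (simp add: sets_measure_of_conv) (metis sets.sigma_sets_eq space_borel)

lemma hausdorff_outer_lipschitz_image:
  fixes f :: "'a::metric_space \<Rightarrow> 'b::metric_space"
  assumes C: "0 < C" and lip: "\<And>x y. x \<in> A \<Longrightarrow> y \<in> A \<Longrightarrow> dist (f x) (f y) \<le> C * dist x y"
  shows "hausdorff_outer d (f ` A) \<le> ennreal (C ^ d) * hausdorff_outer d A"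
  unfolding hausdorff_outer_def[of d "f ` A"]
proof (rule SUP_least)
  fix \<delta> :: real assume "\<delta> \<in> {0<..}"
  then have \<delta>: "0 < \<delta>" by simp
  have "hausdorff_pre d \<delta> (f ` A) \<le> ennreal (C ^ d) * hausdorff_pre d (\<delta> / C) A"
  proof -
    have "hausdorff_pre d \<delta> (f ` A) / ennreal (C ^ d) \<le> hausdorff_pre d (\<delta> / C) A"
      unfolding hausdorff_pre_def[of d "\<delta> / C" A]
    proof (rule INF_greatest)
      fix U :: "nat \<Rightarrow> 'a set"
      assume "U \<in> {U. (\<forall>i. bounded (U i) \<and> diameter (U i) \<le> \<delta> / C) \<and> A \<subseteq> (\<Union>i. U i)}"
      then have U: "\<And>i. bounded (U i)" "\<And>i. diameter (U i) \<le> \<delta> / C" "A \<subseteq> (\<Union>i. U i)" by auto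
      define V where "V i = f ` (U i \<inter> A)" for i
      have dV: "dist x y \<le> C * diameter (U i)" if xy: "x \<in> V i" "y \<in> V i" for x y i
      proof -
        obtain a b where ab: "a \<in> U i \<inter> A" "b \<in> U i \<inter> A" "x = f a" "y = f b"
          using xy unfolding V_def by blast
        have "dist x y \<le> C * dist a b" using ab lip by auto
        also have "\<dots> \<le> C * diameter (U i)"
          using ab C diameter_bounded_bound[OF U(1)] by (intro mult_left_mono) auto
        finally show ?thesis .
      qed
      have bV: "bounded (V i)" for i
        unfolding bounded_two_points using dV by blast
      have diamV: "diameter (V i) \<le> C * diameter (U i)" for i
      proof (cases "V i = {}")
        case True
        then show ?thesis using C diameter_ge_0[OF U(1)] by simp
      next
        case False
        then have "diameter (V i) = (SUP (x, y)\<in>V i \<times> V i. dist x y)" by (simp add: diameter_def)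
        also have "\<dots> \<le> C * diameter (U i)" using dV False by (intro cSUP_least) auto
        finally show ?thesis .
      qed
      have "hausdorff_pre d \<delta> (f ` A) \<le> (\<Sum>i. ball_cost d (V i))"
      proof (rule hausdorff_pre_le)
        fix i
        have "C * diameter (U i) \<le> \<delta>" using U(2)[of i] C by (simp add: field_simps)
        then show "diameter (V i) \<le> \<delta>" using diamV[of i] by simp
      next
        show "f ` A \<subseteq> (\<Union>i. V i)" using U(3) unfolding V_def by blast
      qed (rule bV)
      also have "\<dots> \<le> (\<Sum>i. ennreal (C ^ d) * ball_cost d (U i))"
      proof (intro suminf_le summableI)
        fix i
        have "(diameter (V i) / 2) ^ d \<le> (C * diameter (U i) / 2) ^ d"
          using diamV[of i] diameter_ge_0[OF bV, of i] by (intro power_mono) auto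
        then have "unit_ball_vol (real d) * (diameter (V i) / 2) ^ d \<le> unit_ball_vol (real d) * (C * diameter (U i) / 2) ^ d"
          by (intro mult_left_mono) auto
        also have "\<dots> = C ^ d * (unit_ball_vol (real d) * (diameter (U i) / 2) ^ d)"
          by (simp add: power_mult_distrib power_divide)
        finally show "ball_cost d (V i)
            \<le> ennreal (C ^ d) * ball_cost d (U i)"
          using C diameter_ge_0[OF U(1), of i] by (subst ennreal_mult[symmetric]) (auto intro: ennreal_leI)
      qed
      also have "\<dots> = ennreal (C ^ d) * (\<Sum>i. ball_cost d (U i))"
        by (rule ennreal_suminf_cmult)
      finally show "hausdorff_pre d \<delta> (f ` A) / ennreal (C ^ d) \<le> (\<Sum>i. ball_cost d (U i))"
        using C by (intro divide_le_posI_ennreal) (auto simp: mult.commute)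
    qed
    then have "ennreal (C ^ d) * (hausdorff_pre d \<delta> (f ` A) / ennreal (C ^ d)) \<le> ennreal (C ^ d) * hausdorff_pre d (\<delta> / C) A"
      by (intro mult_left_mono) auto
    then show ?thesis
      using C by (simp add: ennreal_times_divide mult_divide_eq_ennreal
          mult.commute[of "ennreal (C ^ d)" "hausdorff_pre d \<delta> (f ` A)"])
  qed
  also have "\<dots> \<le> ennreal (C ^ d) * hausdorff_outer d A"
    using \<delta> C by (intro mult_left_mono hausdorff_pre_le_outer) auto
  finally show "hausdorff_pre d \<delta> (f ` A) \<le> \<dots>" .
qed

end

section \<open>The isodiametric inequality\<close>

text \<open>
The supremum is taken over points of \<open>A\<close> itself, which matters below: only the points of \<open>A\<close> may be added
to the points of a second set.
\<close>

lemma emeasure_eq_SUP_Int_atMost: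
  fixes A :: "real set"
  assumes A: "A \<in> sets borel" "A \<noteq> {}"
  shows "emeasure lborel A \<le> (SUP a\<in>A. emeasure lborel (A \<inter> {..a}))"
proof (cases "\<exists>s\<in>A. \<forall>x\<in>A. x \<le> s")
  case True
  then obtain s where s: "s \<in> A" "\<And>x. x \<in> A \<Longrightarrow> x \<le> s" by auto
  then have "A \<inter> {..s} = A" by auto
  then show ?thesis using SUP_upper[OF s(1), of "\<lambda>a. emeasure lborel (A \<inter> {..a})"] by simp
next
  case nomax: False
  obtain u :: "nat \<Rightarrow> real" where u: "incseq u" "\<And>n. \<exists>a\<in>A. u n \<le> a" "A \<subseteq> (\<Union>n. {..u n})"
  proof (cases "bdd_above A")
    case True
    define s where "s = Sup A"
    have le: "x < s" if "x \<in> A" for x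
      using that cSup_upper[OF that True] nomax cSup_upper[OF _ True] unfolding s_def by fastforce
    show thesis
    proof (rule that[of "\<lambda>n. s - 1 / real (Suc n)"])
      show "incseq (\<lambda>n. s - 1 / real (Suc n))"
        by (auto simp: incseq_def intro!: divide_left_mono)
      show "\<exists>a\<in>A. s - 1 / real (Suc n) \<le> a" for n
        using less_cSup_iff[OF A(2) True, of "s - 1 / real (Suc n)"] unfolding s_def by (auto intro: less_imp_le)
      show "A \<subseteq> (\<Union>n. {..s - 1 / real (Suc n)})"
      proof
        fix x assume "x \<in> A"
        with le have "0 < s - x" by simp
        then obtain n where "inverse (real (Suc n)) < s - x" using reals_Archimedean by blast
        then show "x \<in> (\<Union>n. {..s - 1 / real (Suc n)})" by (auto simp: inverse_eq_divide intro!: exI[of _ n])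
      qed
    qed
  next
    case False
    show thesis
    proof (rule that[of real])
      show "\<exists>a\<in>A. real n \<le> a" for n
        using False unfolding bdd_above_def by (meson linorder_linear)
      show "A \<subseteq> (\<Union>n. {..real n})" using real_arch_simple by auto
    qed (simp add: incseq_def)
  qed
  have "emeasure lborel A = emeasure lborel (\<Union>n. A \<inter> {..u n})"
    using u(3) by (intro arg_cong[where f="emeasure lborel"]) blast
  also have "\<dots> = (SUP n. emeasure lborel (A \<inter> {..u n}))"
    using A u(1) by (intro SUP_emeasure_incseq[symmetric]) (auto simp: incseq_def intro: order_trans)
  also have "\<dots> \<le> (SUP a\<in>A. emeasure lborel (A \<inter> {..a}))"
  proof (rule SUP_least)
    fix n
    obtain a where "a \<in> A" "u n \<le> a" using u(2) by blast
    then show "emeasure lborel (A \<inter> {..u n}) \<le> (SUP a\<in>A. emeasure lborel (A \<inter> {..a}))"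
      using A by (intro SUP_upper2[of a] emeasure_mono) auto
  qed
  finally show ?thesis .
qed

lemma emeasure_lborel_affine_vimage:
  fixes B :: "real set"
  assumes "B \<in> sets borel" "c \<noteq> 0"
  shows "emeasure lborel B = ennreal \<bar>c\<bar> * emeasure lborel ((\<lambda>x. t + c * x) -` B)"
proof -
  have "(\<lambda>x. t + c * x) -` B \<in> sets borel"
    using measurable_sets[of "\<lambda>x. t + c * x" borel borel B] assms by simp
  then have "(\<integral>\<^sup>+x. indicator B (t + c * x) \<partial>lborel) = emeasure lborel ((\<lambda>x. t + c * x) -` B)"
    using nn_integral_indicator[of "(\<lambda>x. t + c * x) -` B" lborel] by (simp add: indicator_def vimage_def)
  then show ?thesis
    using nn_integral_real_affine[of "indicator B" c t] assms by simp
qed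

text \<open>
For \<open>a \<in> A\<close> and \<open>- b \<in> B\<close>, the midpoints of \<open>- b\<close> with the part of \<open>A\<close> below \<open>a\<close>, and those of \<open>a\<close> with the
part of \<open>B\<close> above \<open>- b\<close>, lie on different sides of \<open>(a - b) / 2\<close> and all belong to \<open>C\<close>. This already gives
the bound for the two parts; letting \<open>a\<close> and \<open>b\<close> exhaust the sets gives it in full. Reflecting \<open>B\<close> turns
the part above into a part below.
\<close>

lemma brunn_minkowski_real:
  fixes A B C :: "real set"
  assumes A: "A \<in> sets borel" "A \<noteq> {}" and B: "B \<in> sets borel" "B \<noteq> {}" and C: "C \<in> sets borel"
    and mid: "\<And>a b. a \<in> A \<Longrightarrow> b \<in> B \<Longrightarrow> (a + b) / 2 \<in> C"
  shows "emeasure lborel A + emeasure lborel B \<le> 2 * emeasure lborel C"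
proof -
  have key: "emeasure lborel (A \<inter> {..a}) + emeasure lborel (uminus -` B \<inter> {..b}) \<le> 2 * emeasure lborel C"
    if a: "a \<in> A" and b: "b \<in> uminus -` B" for a b
  proof -
    have mB: "uminus -` B \<in> sets borel" using measurable_sets[of uminus borel borel B] B by simp
    \<comment> \<open>The midpoints with \<open>- b\<close> and with \<open>a\<close>; dropping the endpoint \<open>a\<close> makes the two sets disjoint.\<close>
    define P where "P = (\<lambda>x. b + 2 * x) -` (A \<inter> {..<a})"
    define Q where "Q = (\<lambda>x. a + (- 2) * x) -` (uminus -` B \<inter> {..b})"
    have mP: "P \<in> sets borel" unfolding P_def
      using measurable_sets[of "\<lambda>x. b + 2 * x" borel borel "A \<inter> {..<a}"] A by simp
    have mQ: "Q \<in> sets borel" unfolding Q_def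
      using measurable_sets[of "\<lambda>x. a + (-2) * x" borel borel "uminus -` B \<inter> {..b}"] mB by simp
    have disj: "P \<inter> Q = {}" by (auto simp: P_def Q_def)
    have sub: "P \<union> Q \<subseteq> C"
    proof
      fix x assume "x \<in> P \<union> Q"
      then show "x \<in> C"
      proof
        assume "x \<in> P" then show ?thesis using mid[of "b + 2 * x" "- b"] b by (simp add: P_def)
      next
        assume "x \<in> Q" then show ?thesis using mid[of a "2 * x - a"] a by (simp add: Q_def)
      qed
    qed
    have "emeasure lborel (A \<inter> {..a}) \<le> emeasure lborel (A \<inter> {..<a} \<union> {a})"
      using A by (intro emeasure_mono) auto
    also have "\<dots> \<le> emeasure lborel (A \<inter> {..<a}) + emeasure lborel {a}"
      using A by (intro emeasure_subadditive) auto
    also have "\<dots> = 2 * emeasure lborel P"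
      using emeasure_lborel_affine_vimage[of "A \<inter> {..<a}" 2 b] A by (simp add: P_def)
    finally have 1: "emeasure lborel (A \<inter> {..a}) \<le> 2 * emeasure lborel P" .
    have 2: "emeasure lborel (uminus -` B \<inter> {..b}) = 2 * emeasure lborel Q"
      using emeasure_lborel_affine_vimage[of "uminus -` B \<inter> {..b}" "-2" a] mB by (simp add: Q_def)
    have "emeasure lborel P + emeasure lborel Q = emeasure lborel (P \<union> Q)"
      using mP mQ disj by (intro plus_emeasure) auto
    also have "\<dots> \<le> emeasure lborel C" using sub C by (intro emeasure_mono) auto
    finally have "2 * (emeasure lborel P + emeasure lborel Q) \<le> 2 * emeasure lborel C"
      by (intro mult_left_mono) auto
    then show ?thesis
      using add_right_mono[OF 1, of "2 * emeasure lborel Q"] unfolding 2 distrib_left by (rule order_trans[rotated])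
  qed
  have mB: "uminus -` B \<in> sets borel" using measurable_sets[of uminus borel borel B] B by simp
  have neB: "uminus -` B \<noteq> {}" using B(2) by (metis ex_in_conv vimageI add.inverse_inverse)
  have "emeasure lborel B = emeasure lborel (uminus -` B)"
    using emeasure_lborel_affine_vimage[of B "-1" 0] B by simp
  also have "\<dots> \<le> (SUP b\<in>uminus -` B. emeasure lborel (uminus -` B \<inter> {..b}))"
    by (rule emeasure_eq_SUP_Int_atMost) fact+
  finally have "emeasure lborel A + emeasure lborel B
      \<le> (SUP a\<in>A. emeasure lborel (A \<inter> {..a})) + (SUP b\<in>uminus -` B. emeasure lborel (uminus -` B \<inter> {..b}))"
    by (intro add_mono emeasure_eq_SUP_Int_atMost A)
  also have "\<dots> = (SUP b\<in>uminus -` B. (SUP a\<in>A. emeasure lborel (A \<inter> {..a}) + emeasure lborel (uminus -` B \<inter> {..b})))"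
    using A(2) neB by (simp add: ennreal_SUP_add_right ennreal_SUP_add_left)
  also have "\<dots> \<le> 2 * emeasure lborel C"
    by (intro SUP_least key)
  finally show ?thesis .
qed

lemma layer_cake_unit:
  fixes f :: "real \<Rightarrow> ennreal"
  assumes [measurable]: "f \<in> borel_measurable borel"
  shows "(\<integral>\<^sup>+x. min 1 (f x) \<partial>lborel) = (\<integral>\<^sup>+t. emeasure lborel {x. ennreal t < f x} * indicator {0<..<1} t \<partial>lborel)"
proof -
  have pt: "min 1 (f x) = (\<integral>\<^sup>+t. indicator {x. ennreal t < f x} x * indicator {0<..<1} t \<partial>lborel)" for x
  proof -
    have "(\<integral>\<^sup>+t. indicator {x. ennreal t < f x} x * indicator {0<..<1} t \<partial>lborel)
        = (\<integral>\<^sup>+t. indicator {0<..<enn2real (min 1 (f x))} t \<partial>lborel)"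
    proof (rule nn_integral_cong)
      fix t :: real
      have "ennreal t < f x \<longleftrightarrow> t < enn2real (min 1 (f x))" if "0 < t" "t < 1"
      proof (cases "f x \<le> 1")
        case True
        then have "f x < top" using le_less_trans by fastforce
        then have eq: "f x = ennreal (enn2real (f x))" by simp
        show ?thesis using True that by (subst eq) (simp add: min_absorb2 ennreal_less_iff)
      next
        case False
        then have "ennreal t < f x"
          using that by (metis ennreal_1 ennreal_less_iff less_imp_le linorder_not_less order.strict_trans1 zero_le_one)
        then show ?thesis using False that by (simp add: min_absorb1)
      qed
      moreover have "enn2real (min 1 (f x)) \<le> 1"
        by (metis enn2real_leI ennreal_1 min.cobounded1 zero_le_one)
      ultimately show "indicator {x. ennreal t < f x} x * indicator {0<..<1} t
          = (indicator {0<..<enn2real (min 1 (f x))} t :: ennreal)"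
        by (auto simp: indicator_def)
    qed
    also have "\<dots> = ennreal (enn2real (min 1 (f x)))" by simp
    also have "\<dots> = min 1 (f x)"
      by (metis ennreal_enn2real_if ennreal_one_less_top min.strict_coboundedI1 top.not_eq_extremum)
    finally show ?thesis by simp
  qed
  have "(\<integral>\<^sup>+x. min 1 (f x) \<partial>lborel)
      = (\<integral>\<^sup>+x. \<integral>\<^sup>+t. indicator {x. ennreal t < f x} x * indicator {0<..<1} t \<partial>lborel \<partial>lborel)"
    by (intro nn_integral_cong pt)
  also have "\<dots> = (\<integral>\<^sup>+t. \<integral>\<^sup>+x. indicator {x. ennreal t < f x} x * indicator {0<..<1} t \<partial>lborel \<partial>lborel)"
    by (rule lborel_pair.Fubini') measurable
  also have "\<dots> = (\<integral>\<^sup>+t. emeasure lborel {x. ennreal t < f x} * indicator {0<..<1} t \<partial>lborel)"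
    by (intro nn_integral_cong) (simp add: nn_integral_multc)
  finally show ?thesis .
qed

text \<open>
For functions with supremum 1, the superlevel sets of \<open>f\<close> and \<open>g\<close> at every height below 1 are nonempty and
have their midpoints in the superlevel set of \<open>h\<close>. Integrating the one-dimensional Brunn-Minkowski
inequality over the height gives the claim.
\<close>

lemma prekopa_leindler_real_normalized:
  fixes f g h :: "real \<Rightarrow> ennreal"
  assumes [measurable]: "f \<in> borel_measurable borel" "g \<in> borel_measurable borel" "h \<in> borel_measurable borel"
    and f: "\<And>x. f x \<le> 1" "(SUP x. f x) = 1" and g: "\<And>x. g x \<le> 1" "(SUP x. g x) = 1"
    and fgh: "\<And>x y. f x * g y \<le> (h ((x + y) / 2))\<^sup>2"
  shows "(\<integral>\<^sup>+x. f x \<partial>lborel) + (\<integral>\<^sup>+x. g x \<partial>lborel) \<le> 2 * (\<integral>\<^sup>+x. h x \<partial>lborel)"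
proof -
  have [measurable]: "(\<lambda>t. emeasure lborel {x. ennreal t < k x}) \<in> borel_measurable borel"
    if [measurable]: "k \<in> borel_measurable borel" for k :: "real \<Rightarrow> ennreal"
  proof -
    have "{p \<in> space (lborel \<Otimes>\<^sub>M lborel). ennreal (fst p) < k (snd p)} \<in> sets (lborel \<Otimes>\<^sub>M lborel)"
      by measurable
    from lborel.measurable_emeasure_Pair[OF this] show ?thesis
      by (simp add: vimage_def space_pair_measure)
  qed
  have "(\<integral>\<^sup>+x. f x \<partial>lborel) + (\<integral>\<^sup>+x. g x \<partial>lborel) = (\<integral>\<^sup>+x. min 1 (f x) \<partial>lborel) + (\<integral>\<^sup>+x. min 1 (g x) \<partial>lborel)"
    using f g by (simp add: min_absorb2)
  also have "\<dots> = (\<integral>\<^sup>+t. emeasure lborel {x. ennreal t < f x} * indicator {0<..<1} t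
      + emeasure lborel {x. ennreal t < g x} * indicator {0<..<1} t \<partial>lborel)"
    by (subst nn_integral_add) (auto simp: layer_cake_unit)
  also have "\<dots> \<le> (\<integral>\<^sup>+t. 2 * (emeasure lborel {x. ennreal t < h x} * indicator {0<..<1} t) \<partial>lborel)"
  proof (rule nn_integral_mono)
    fix t :: real
    show "emeasure lborel {x. ennreal t < f x} * indicator {0<..<1} t + emeasure lborel {x. ennreal t < g x} * indicator {0<..<1} t
        \<le> 2 * (emeasure lborel {x. ennreal t < h x} * indicator {0<..<1} t)"
    proof (cases "0 < t \<and> t < 1")
      case True
      have "emeasure lborel {x. ennreal t < f x} + emeasure lborel {x. ennreal t < g x} \<le> 2 * emeasure lborel {x. ennreal t < h x}"
      proof (rule brunn_minkowski_real)
        have t1: "ennreal t < 1" using True by (metis ennreal_1 ennreal_less_iff less_imp_le)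
        have "ennreal t < (SUP x. f x)" using t1 f(2) by simp
        then show "{x. ennreal t < f x} \<noteq> {}" unfolding less_SUP_iff by auto
        have "ennreal t < (SUP x. g x)" using t1 g(2) by simp
        then show "{x. ennreal t < g x} \<noteq> {}" unfolding less_SUP_iff by auto
        fix a b assume "a \<in> {x. ennreal t < f x}" "b \<in> {x. ennreal t < g x}"
        then have ab: "ennreal t < f a" "ennreal t < g b" by auto
        have "(ennreal t)\<^sup>2 < f a * g b"
        proof -
          have fin: "f a < top" "g b < top" using f(1)[of a] g(1)[of b] le_less_trans by fastforce+
          then obtain u v where uv: "f a = ennreal u" "0 \<le> u" "g b = ennreal v" "0 \<le> v"
            by (metis ennreal_cases less_irrefl)
          then show ?thesis
            using ab True by (simp add: power2_eq_square ennreal_mult[symmetric] ennreal_less_iff mult_strict_mono')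
        qed
        also have "\<dots> \<le> (h ((a + b) / 2))\<^sup>2" by (rule fgh)
        finally show "(a + b) / 2 \<in> {x. ennreal t < h x}"
          by (metis (mono_tags, lifting) mem_Collect_eq not_le power_mono zero_le)
      qed auto
      then show ?thesis using True by simp
    qed auto
  qed
  also have "\<dots> = 2 * (\<integral>\<^sup>+x. min 1 (h x) \<partial>lborel)"
    by (subst nn_integral_cmult) (auto simp: layer_cake_unit)
  also have "\<dots> \<le> 2 * (\<integral>\<^sup>+x. h x \<partial>lborel)"
    by (intro mult_left_mono nn_integral_mono) auto
  finally show ?thesis .
qed

text \<open>
Dividing \<open>f\<close>, \<open>g\<close>, \<open>h\<close> by \<open>a\<close>, \<open>b\<close>, \<open>sqrt (a * b)\<close>, where \<open>a\<close> and \<open>b\<close> are the suprema of \<open>f\<close> and \<open>g\<close>, reduces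
to the normalized case. The resulting bound on a sum becomes one on a product by the inequality between
the arithmetic and the geometric mean.
\<close>

lemma prekopa_leindler_real_bounded:
  fixes f g h :: "real \<Rightarrow> ennreal"
  assumes [measurable]: "f \<in> borel_measurable borel" "g \<in> borel_measurable borel" "h \<in> borel_measurable borel"
    and f: "(SUP x. f x) < top" and g: "(SUP x. g x) < top"
    and fgh: "\<And>x y. f x * g y \<le> (h ((x + y) / 2))\<^sup>2"
  shows "(\<integral>\<^sup>+x. f x \<partial>lborel) * (\<integral>\<^sup>+x. g x \<partial>lborel) \<le> (\<integral>\<^sup>+x. h x \<partial>lborel)\<^sup>2"
proof -
  obtain a where a: "(SUP x. f x) = ennreal a" "0 \<le> a" using f by (metis ennreal_cases less_irrefl)
  obtain b where b: "(SUP x. g x) = ennreal b" "0 \<le> b" using g by (metis ennreal_cases less_irrefl)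
  have fa: "f x \<le> ennreal a" for x unfolding a(1)[symmetric] by (rule SUP_upper) simp
  have gb: "g x \<le> ennreal b" for x unfolding b(1)[symmetric] by (rule SUP_upper) simp
  consider "a = 0" | "b = 0" | "a > 0" "b > 0" using a b by fastforce
  then show ?thesis
  proof cases
    case 1 then have "f x = 0" for x using fa[of x] by simp
    then show ?thesis by simp
  next
    case 2 then have "g x = 0" for x using gb[of x] by simp
    then show ?thesis by simp
  next
    case 3
    define c where "c = sqrt (a * b)"
    have c: "c > 0" "c\<^sup>2 = a * b" using 3 by (auto simp: c_def)
    have "(\<integral>\<^sup>+x. ennreal (1 / a) * f x \<partial>lborel) + (\<integral>\<^sup>+x. ennreal (1 / b) * g x \<partial>lborel)
        \<le> 2 * (\<integral>\<^sup>+x. ennreal (1 / c) * h x \<partial>lborel)"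
    proof (rule prekopa_leindler_real_normalized)
      show "(SUP x. ennreal (1 / a) * f x) = 1"
        using 3 by (subst SUP_mult_left_ennreal[symmetric]) (simp add: a(1) ennreal_mult[symmetric])
      show "(SUP x. ennreal (1 / b) * g x) = 1"
        using 3 by (subst SUP_mult_left_ennreal[symmetric]) (simp add: b(1) ennreal_mult[symmetric])
      show "ennreal (1 / a) * f x \<le> 1" for x
        using mult_left_mono[OF fa[of x], of "ennreal (1 / a)"] 3 by (simp add: ennreal_mult[symmetric])
      show "ennreal (1 / b) * g x \<le> 1" for x
        using mult_left_mono[OF gb[of x], of "ennreal (1 / b)"] 3 by (simp add: ennreal_mult[symmetric])
      fix x y
      have "ennreal (1 / a) * f x * (ennreal (1 / b) * g y) = ennreal (1 / (a * b)) * (f x * g y)"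
        using 3 by (simp add: ennreal_mult[symmetric] ac_simps)
      also have "\<dots> \<le> ennreal (1 / (a * b)) * (h ((x + y) / 2))\<^sup>2"
        by (intro mult_left_mono fgh) auto
      also have "ennreal (1 / (a * b)) = (ennreal (1 / c))\<^sup>2"
        using c by (simp add: ennreal_power power_divide)
      finally show "ennreal (1 / a) * f x * (ennreal (1 / b) * g y) \<le> (ennreal (1 / c) * h ((x + y) / 2))\<^sup>2"
        by (simp add: power_mult_distrib)
    qed auto
    then have main: "ennreal (1 / a) * (\<integral>\<^sup>+x. f x \<partial>lborel) + ennreal (1 / b) * (\<integral>\<^sup>+x. g x \<partial>lborel)
        \<le> 2 * (ennreal (1 / c) * (\<integral>\<^sup>+x. h x \<partial>lborel))"
      by (simp add: nn_integral_cmult)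
    show ?thesis
    proof (cases "(\<integral>\<^sup>+x. h x \<partial>lborel) = top")
      case False
      then obtain H where H: "(\<integral>\<^sup>+x. h x \<partial>lborel) = ennreal H" "0 \<le> H" by (metis ennreal_cases)
      have R: "2 * (ennreal (1 / c) * ennreal H) < top" by (simp add: ennreal_mult_less_top)
      have "ennreal (1 / a) * (\<integral>\<^sup>+x. f x \<partial>lborel) < top" "ennreal (1 / b) * (\<integral>\<^sup>+x. g x \<partial>lborel) < top"
        using le_less_trans[OF main[unfolded H] R] by (auto simp: ennreal_add_less_top)
      then have "(\<integral>\<^sup>+x. f x \<partial>lborel) < top" "(\<integral>\<^sup>+x. g x \<partial>lborel) < top"
        using 3 by (auto simp: ennreal_mult_less_top)
      then obtain u v where uv: "(\<integral>\<^sup>+x. f x \<partial>lborel) = ennreal u" "0 \<le> u" "(\<integral>\<^sup>+x. g x \<partial>lborel) = ennreal v" "0 \<le> v"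
        by (metis ennreal_cases less_irrefl)
      have "ennreal (u / a + v / b) \<le> ennreal (2 * (H / c))"
        using main 3 c uv H by (simp add: ennreal_mult ennreal_plus divide_inverse mult.commute ennreal_numeral[symmetric] del: ennreal_numeral)
      then have le: "u / a + v / b \<le> 2 * (H / c)" using H c by (subst (asm) ennreal_le_iff) auto
      have "4 * (p * q) \<le> (p + q)\<^sup>2" for p q :: real
        using zero_le_power2[of "p - q"] by (simp add: power2_eq_square algebra_simps)
      then have "4 * ((u / a) * (v / b)) \<le> (u / a + v / b)\<^sup>2" .
      also have "\<dots> \<le> (2 * (H / c))\<^sup>2"
        using le uv 3 by (intro power_mono) auto
      also have "\<dots> = 4 * (H\<^sup>2 / (a * b))" using c(2) by (simp add: power_mult_distrib power_divide)
      finally have "u * v \<le> H\<^sup>2" using 3 by (simp add: field_simps)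
      then show ?thesis using uv H by (simp add: ennreal_mult[symmetric] ennreal_power)
    qed (simp add: power2_eq_square)
  qed
qed

lemma prekopa_leindler_real:
  fixes f g h :: "real \<Rightarrow> ennreal"
  assumes [measurable]: "f \<in> borel_measurable borel" "g \<in> borel_measurable borel" "h \<in> borel_measurable borel"
    and fgh: "\<And>x y. f x * g y \<le> (h ((x + y) / 2))\<^sup>2"
  shows "(\<integral>\<^sup>+x. f x \<partial>lborel) * (\<integral>\<^sup>+x. g x \<partial>lborel) \<le> (\<integral>\<^sup>+x. h x \<partial>lborel)\<^sup>2"
proof -
  have tr: "(\<integral>\<^sup>+x. k x \<partial>lborel) = (SUP n::nat. \<integral>\<^sup>+x. min (of_nat n) (k x) \<partial>lborel)"
    if [measurable]: "k \<in> borel_measurable borel" for k :: "real \<Rightarrow> ennreal"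
  proof (subst nn_integral_monotone_convergence_SUP[symmetric])
    show "incseq (\<lambda>n x. min (of_nat n) (k x))"
      unfolding incseq_def le_fun_def by (intro allI impI min.mono of_nat_mono order_refl)
    have "(SUP n::nat. min (of_nat n) (k x)) = k x" for x
    proof (rule antisym)
      show "k x \<le> (SUP n::nat. min (of_nat n) (k x))"
      proof (cases "k x = top")
        case True
        then show ?thesis by (simp add: ennreal_SUP_of_nat_eq_top)
      next
        case False
        then obtain n :: nat where "k x < of_nat n"
          using ennreal_Ex_less_of_nat by (auto simp: less_top)
        then show ?thesis by (intro SUP_upper2[of n]) auto
      qed
    qed (auto intro: SUP_least)
    then show "(\<integral>\<^sup>+x. k x \<partial>lborel) = (\<integral>\<^sup>+x. (SUP n::nat. min (of_nat n) (k x)) \<partial>lborel)" by simp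
  qed auto
  have "(\<integral>\<^sup>+x. min (of_nat n) (f x) \<partial>lborel) * (\<integral>\<^sup>+x. min (of_nat m) (g x) \<partial>lborel) \<le> (\<integral>\<^sup>+x. h x \<partial>lborel)\<^sup>2" for n m :: nat
  proof (rule prekopa_leindler_real_bounded)
    show "(SUP x. min (of_nat n) (f x)) < top"
      by (rule le_less_trans[of _ "of_nat n"]) (auto intro: SUP_least simp: of_nat_less_top)
    show "(SUP x. min (of_nat m) (g x)) < top"
      by (rule le_less_trans[of _ "of_nat m"]) (auto intro: SUP_least simp: of_nat_less_top)
    show "min (of_nat n) (f x) * min (of_nat m) (g y) \<le> (h ((x + y) / 2))\<^sup>2" for x y
      by (rule order_trans[OF mult_mono fgh]) auto
  qed auto
  then show ?thesis
    unfolding tr[of f, simplified] tr[of g, simplified] SUP_mult_left_ennreal SUP_mult_right_ennreal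
    by (intro SUP_least)
qed

text \<open>
Tensorization: by the one-dimensional inequality, the partial integrals over one coordinate satisfy the
hypothesis in the remaining coordinates.
\<close>

lemma prekopa_leindler_PiM:
  fixes I :: "'i set"
  assumes "finite I"
    and "f \<in> borel_measurable (PiM I (\<lambda>_. lborel :: real measure))"
    and "g \<in> borel_measurable (PiM I (\<lambda>_. lborel :: real measure))"
    and "h \<in> borel_measurable (PiM I (\<lambda>_. lborel :: real measure))"
    and "\<And>x y. x \<in> extensional I \<Longrightarrow> y \<in> extensional I \<Longrightarrow> f x * g y \<le> (h (\<lambda>i\<in>I. (x i + y i) / 2))\<^sup>2"
  shows "integral\<^sup>N (PiM I (\<lambda>_. lborel)) f * integral\<^sup>N (PiM I (\<lambda>_. lborel)) g \<le> (integral\<^sup>N (PiM I (\<lambda>_. lborel)) h)\<^sup>2"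
  using assms
proof (induction I arbitrary: f g h rule: finite_induct)
  case empty
  interpret product_sigma_finite "\<lambda>_::'i. lborel :: real measure" ..
  show ?case using empty.prems(4)[of "\<lambda>_. undefined" "\<lambda>_. undefined"]
    by (simp add: nn_integral_empty restrict_def)
next
  case (insert i I)
  interpret product_sigma_finite "\<lambda>_::'i. lborel :: real measure" ..
  note [measurable] = insert.prems(1-3)
  have slice: "(\<lambda>s. k (x(i := s))) \<in> borel_measurable borel"
    if [measurable]: "k \<in> borel_measurable (PiM (insert i I) (\<lambda>_. lborel :: real measure))" and x: "x \<in> extensional I"
    for k :: "('i \<Rightarrow> real) \<Rightarrow> ennreal" and x
    using measurable_comp[OF measurable_component_update[of x I "\<lambda>_. lborel" i] that(1)] x insert.hyps(2)
    by (simp add: comp_def space_PiM PiE_UNIV_domain PiE_def)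
  have F: "(\<lambda>x. \<integral>\<^sup>+s. k (x(i := s)) \<partial>lborel) \<in> borel_measurable (PiM I (\<lambda>_. lborel))"
    if [measurable]: "k \<in> borel_measurable (PiM (insert i I) (\<lambda>_. lborel :: real measure))" for k :: "('i \<Rightarrow> real) \<Rightarrow> ennreal"
    using measurable_comp[OF measurable_add_dim that] 
    by (intro lborel.borel_measurable_nn_integral) (simp add: comp_def case_prod_unfold)
  have "(\<integral>\<^sup>+x. \<integral>\<^sup>+s. f (x(i := s)) \<partial>lborel \<partial>PiM I (\<lambda>_. lborel)) * (\<integral>\<^sup>+x. \<integral>\<^sup>+s. g (x(i := s)) \<partial>lborel \<partial>PiM I (\<lambda>_. lborel))
      \<le> (\<integral>\<^sup>+x. \<integral>\<^sup>+s. h (x(i := s)) \<partial>lborel \<partial>PiM I (\<lambda>_. lborel))\<^sup>2"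
  proof (rule insert.IH)
    fix x y :: "'i \<Rightarrow> real" assume xy: "x \<in> extensional I" "y \<in> extensional I"
    show "(\<integral>\<^sup>+s. f (x(i := s)) \<partial>lborel) * (\<integral>\<^sup>+s. g (y(i := s)) \<partial>lborel)
        \<le> (\<integral>\<^sup>+s. h ((\<lambda>i\<in>I. (x i + y i) / 2)(i := s)) \<partial>lborel)\<^sup>2"
    proof (rule prekopa_leindler_real)
      fix s t :: real
      have "(\<lambda>j\<in>insert i I. ((x(i := s)) j + (y(i := t)) j) / 2) = (\<lambda>i\<in>I. (x i + y i) / 2)(i := (s + t) / 2)"
        using insert.hyps(2) by (auto simp: restrict_def fun_eq_iff)
      moreover have "x(i := s) \<in> extensional (insert i I)" "y(i := t) \<in> extensional (insert i I)"
        using xy by (auto simp: extensional_def)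
      ultimately show "f (x(i := s)) * g (y(i := t)) \<le> (h ((\<lambda>i\<in>I. (x i + y i) / 2)(i := (s + t) / 2)))\<^sup>2"
        using insert.prems(4)[of "x(i := s)" "y(i := t)"] by metis
    qed (use xy in \<open>auto intro!: slice insert.prems(1-3)\<close>)
  qed (intro F insert.prems(1-3))+
  then show ?case
    using insert.hyps by (simp add: product_nn_integral_insert)
qed

theorem prekopa_leindler:
  fixes f g h :: "'a::euclidean_space \<Rightarrow> ennreal"
  assumes [measurable]: "f \<in> borel_measurable borel" "g \<in> borel_measurable borel" "h \<in> borel_measurable borel"
    and fgh: "\<And>x y. f x * g y \<le> (h ((1 / 2) *\<^sub>R (x + y)))\<^sup>2"
  shows "(\<integral>\<^sup>+x. f x \<partial>lborel) * (\<integral>\<^sup>+x. g x \<partial>lborel) \<le> (\<integral>\<^sup>+x. h x \<partial>lborel)\<^sup>2"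
proof -
  define T where "T = (\<lambda>x. \<Sum>b\<in>Basis. x b *\<^sub>R b :: 'a)"
  have [measurable]: "T \<in> measurable (PiM Basis (\<lambda>_. lborel)) borel" unfolding T_def by measurable
  have eq: "(\<integral>\<^sup>+x. k x \<partial>lborel) = (\<integral>\<^sup>+x. k (T x) \<partial>PiM Basis (\<lambda>_. lborel))"
    if [measurable]: "k \<in> borel_measurable borel" for k :: "'a \<Rightarrow> ennreal"
    by (subst lborel_eq) (simp add: nn_integral_distr T_def[symmetric])
  have "(\<integral>\<^sup>+x. f (T x) \<partial>PiM Basis (\<lambda>_. lborel)) * (\<integral>\<^sup>+x. g (T x) \<partial>PiM Basis (\<lambda>_. lborel))
      \<le> (\<integral>\<^sup>+x. h (T x) \<partial>PiM Basis (\<lambda>_. lborel))\<^sup>2"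
  proof (rule prekopa_leindler_PiM)
    fix x y :: "'a \<Rightarrow> real"
    have "T (\<lambda>i\<in>Basis. (x i + y i) / 2) = (1 / 2) *\<^sub>R (T x + T y)"
      unfolding T_def sum.distrib[symmetric] scaleR_sum_right
      by (rule sum.cong) (simp_all add: scaleR_add_right scaleR_left_distrib add_divide_distrib)
    then show "f (T x) * g (T y) \<le> (h (T (\<lambda>i\<in>Basis. (x i + y i) / 2)))\<^sup>2" using fgh by simp
  qed auto
  then show ?thesis
    unfolding eq[OF assms(1)] eq[OF assms(2)] eq[OF assms(3)] .
qed

text \<open>
The midpoints of \<open>S\<close> with \<open>- S\<close> are half differences of points of \<open>S\<close>, so they lie in the ball of radius
\<open>diameter S / 2\<close> about the origin. As \<open>S\<close> and \<open>- S\<close> have the same volume, the Prekopa-Leindler inequality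
for indicator functions bounds the square of the volume of \<open>S\<close> by that of the ball.
\<close>

theorem isodiametric_inequality:
  fixes S :: "'a::euclidean_space set"
  assumes S: "bounded S" "S \<in> sets borel"
  shows "emeasure lborel S \<le> ennreal (unit_ball_vol (DIM('a)) * (diameter S / 2) ^ DIM('a))"
proof -
  let ?B = "cball 0 (diameter S / 2) :: 'a set"
  have mS: "uminus -` S \<in> sets borel" using measurable_sets[of uminus borel borel S] S by simp
  have "(\<integral>\<^sup>+x. indicator S x \<partial>lborel) * (\<integral>\<^sup>+x. indicator (uminus -` S) x \<partial>lborel) \<le> (\<integral>\<^sup>+x. indicator ?B x \<partial>lborel)\<^sup>2"
  proof (rule prekopa_leindler)
    fix x y :: 'a
    have "norm (x + y) \<le> diameter S" if "x \<in> S" "- y \<in> S"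
      using diameter_bounded_bound[OF S(1) that] by (simp add: dist_norm)
    then show "indicator S x * indicator (uminus -` S) y \<le> (indicator ?B ((1 / 2) *\<^sub>R (x + y)) :: ennreal)\<^sup>2"
      by (auto simp: indicator_def)
  qed (use S mS in \<open>auto intro!: borel_measurable_indicator\<close>)
  moreover have "emeasure lborel (uminus -` S) = emeasure lborel S"
  proof -
    have "lborel = distr lborel borel (\<lambda>x. - x :: 'a)"
      using lborel_affine[of "-1" "0::'a"] by (simp add: density_1)
    then have "emeasure lborel S = emeasure (distr lborel borel (\<lambda>x. - x :: 'a)) S" by simp
    also have "\<dots> = emeasure lborel (uminus -` S)" using S by (subst emeasure_distr) auto
    finally show ?thesis by simp
  qed
  ultimately have "(emeasure lborel S)\<^sup>2 \<le> (emeasure lborel ?B)\<^sup>2"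
    using S mS by (simp add: power2_eq_square)
  moreover have fin: "emeasure lborel S \<noteq> top" "emeasure lborel ?B \<noteq> top"
    using emeasure_bounded_finite[OF S(1)] emeasure_bounded_finite[of ?B] by auto
  ultimately have "emeasure lborel S \<le> emeasure lborel ?B"
    unfolding emeasure_eq_ennreal_measure[OF fin(1)] emeasure_eq_ennreal_measure[OF fin(2)]
    by (simp add: ennreal_power)
  also have "\<dots> = ennreal (unit_ball_vol (DIM('a)) * (diameter S / 2) ^ DIM('a))"
    using diameter_ge_0[OF S(1)] by (intro emeasure_cball) simp
  finally show ?thesis .
qed

section \<open>Hausdorff measure and Lebesgue measure\<close>

text \<open>
Disjoint balls inside \<open>T\<close> have total volume at most that of \<open>T\<close>, and with the present normalization the
cost of a ball in a cover is its volume. The dilation \<open>k\<close> is 5 for the Vitali covering lemma, which covers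
everything, and 1 for the Vitali covering theorem, which covers almost everything.
\<close>

lemma hausdorff_pre_le_cballs:
  fixes a :: "'i \<Rightarrow> 'a::euclidean_space"
  assumes C: "countable C" "pairwise (\<lambda>i j. disjnt (cball (a i) (r i)) (cball (a j) (r j))) C"
    and r: "\<And>i. i \<in> C \<Longrightarrow> 0 < r i" "\<And>i. i \<in> C \<Longrightarrow> 2 * k * r i \<le> \<delta>"
    and sub: "\<And>i. i \<in> C \<Longrightarrow> cball (a i) (r i) \<subseteq> T" and T: "T \<in> sets borel"
    and A: "A \<subseteq> (\<Union>i\<in>C. cball (a i) (k * r i))" and k: "0 < k" and \<delta>: "0 \<le> \<delta>"
  shows "hausdorff_pre (DIM('a)) \<delta> A \<le> ennreal (k ^ DIM('a)) * emeasure lborel T"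
proof -
  \<comment> \<open>Enumerate the balls by natural numbers, with empty sets in the gaps.\<close>
  define e where "e = to_nat_on C"
  have inj: "inj_on e C" using C(1) by (simp add: e_def inj_on_to_nat_on)
  define g where "g = the_inv_into C e"
  have g: "g (e i) = i" if "i \<in> C" for i using that inj by (simp add: g_def the_inv_into_f_f)
  define U where "U n = (if n \<in> e ` C then cball (a (g n)) (k * r (g n)) else {})" for n
  define D where "D n = (if n \<in> e ` C then cball (a (g n)) (r (g n)) else {})" for n
  have "hausdorff_pre (DIM('a)) \<delta> A \<le> (\<Sum>n. ball_cost (DIM('a)) (U n))"
  proof (rule hausdorff_pre_le)
    show "diameter (U n) \<le> \<delta>" for n
      using r k \<delta> g by (fastforce simp: U_def mult.assoc)
    show "A \<subseteq> (\<Union>n. U n)"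
    proof
      fix x assume "x \<in> A"
      then obtain i where i: "i \<in> C" "x \<in> cball (a i) (k * r i)" using A by blast
      then have "x \<in> U (e i)" by (simp add: U_def g)
      then show "x \<in> (\<Union>n. U n)" by blast
    qed
  qed (auto simp: U_def)
  also have "\<dots> = (\<Sum>n. ennreal (k ^ DIM('a)) * emeasure lborel (D n))"
  proof (rule suminf_cong)
    fix n
    show "ball_cost (DIM('a)) (U n) = ennreal (k ^ DIM('a)) * emeasure lborel (D n)"
    proof (cases "n \<in> e ` C")
      case True
      then obtain i where i: "i \<in> C" "n = e i" by blast
      then have ri: "0 < r i" "0 < k * r i" using r k by (auto intro: mult_pos_pos)
      have "diameter (cball (a i) (k * r i)) = 2 * (k * r i)" using ri by simp
      then show ?thesis
        using i k ri by (simp add: U_def D_def g emeasure_cball ennreal_mult[symmetric] power_mult_distrib mult_ac del: diameter_cball)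
    qed (simp add: U_def D_def)
  qed
  also have "\<dots> = ennreal (k ^ DIM('a)) * (\<Sum>n. emeasure lborel (D n))" by simp
  also have "(\<Sum>n. emeasure lborel (D n)) = emeasure lborel (\<Union>n. D n)"
  proof (rule suminf_emeasure)
    show "disjoint_family D"
      unfolding disjoint_family_on_def
    proof (intro ballI impI)
      fix m n :: nat assume mn: "m \<noteq> n"
      show "D m \<inter> D n = {}"
      proof (cases "m \<in> e ` C \<and> n \<in> e ` C")
        case True
        then obtain i j where ij: "i \<in> C" "j \<in> C" "m = e i" "n = e j" by blast
        then have "i \<noteq> j" using mn by blast
        then show ?thesis using ij C(2) by (simp add: D_def g pairwise_def disjnt_def)
      qed (auto simp: D_def)
    qed
  qed (auto simp: D_def)
  also have "ennreal (k ^ DIM('a)) * emeasure lborel (\<Union>n. D n) \<le> ennreal (k ^ DIM('a)) * emeasure lborel T"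
    using sub T by (intro mult_left_mono emeasure_mono) (auto simp: D_def g split: if_splits)
  finally show ?thesis .
qed

lemma hausdorff_pre_le_5_power:
  fixes T :: "'a::euclidean_space set"
  assumes T: "open T" and \<delta>: "0 < \<delta>"
  shows "hausdorff_pre (DIM('a)) \<delta> T \<le> ennreal (5 ^ DIM('a)) * emeasure lborel T"
proof -
  have "\<exists>r. 0 < r \<and> r \<le> \<delta> / 10 \<and> cball x r \<subseteq> T" if x: "x \<in> T" for x
  proof -
    obtain e where e: "e > 0" "cball x e \<subseteq> T" using T x by (meson open_contains_cball)
    have "cball x (min e (\<delta> / 10)) \<subseteq> T" by (rule order_trans[OF subset_cball e(2)]) simp
    then show ?thesis using e(1) \<delta> by (intro exI[of _ "min e (\<delta> / 10)"]) simp
  qed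
  then obtain r where r: "\<And>x. x \<in> T \<Longrightarrow> 0 < r x \<and> r x \<le> \<delta> / 10 \<and> cball x (r x) \<subseteq> T" by metis
  have sub: "T \<subseteq> (\<Union>x\<in>T. cball x (r x))"
  proof
    fix x assume "x \<in> T"
    then show "x \<in> (\<Union>x\<in>T. cball x (r x))" using r[of x] by (intro UN_I[of x]) auto
  qed
  obtain C where C: "countable C" "C \<subseteq> T" "pairwise (\<lambda>i j. disjnt (cball i (r i)) (cball j (r j))) C"
     "T \<subseteq> (\<Union>i\<in>C. cball i (5 * r i))"
    by (rule Vitali_covering_lemma_cballs[OF sub, of "\<delta> / 10"]) (use r in auto)
  have rC: "0 < r i" "r i \<le> \<delta> / 10" "cball i (r i) \<subseteq> T" if "i \<in> C" for i
    using r[of i] C(2) that by auto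
  show ?thesis
  proof (rule hausdorff_pre_le_cballs[OF C(1,3)])
    show "2 * 5 * r i \<le> \<delta>" if "i \<in> C" for i using rC(2)[OF that] by simp
  qed (use rC C(4) T \<delta> in simp_all)
qed

text \<open>
An open neighbourhood of small volume exists by regularity; the factor \<open>5 ^ DIM('a)\<close> is absorbed by \<open>e\<close>.
\<close>

lemma hausdorff_pre_null:
  fixes N :: "'a::euclidean_space set"
  assumes N: "N \<in> sets borel" "emeasure lborel N = 0" and \<delta>: "0 < \<delta>"
  shows "hausdorff_pre (DIM('a)) \<delta> N = 0"
proof -
  have "hausdorff_pre (DIM('a)) \<delta> N \<le> 0 + ennreal e" if e: "0 < e" for e
  proof -
    obtain T where T: "open T" "N \<subseteq> T" "emeasure lborel (T - N) < ennreal (e / 5 ^ DIM('a))"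
      using outer_regular_lborel[OF N(1), of "e / 5 ^ DIM('a)"] e by auto
    have "emeasure lborel T \<le> emeasure lborel (T - N) + emeasure lborel N"
      using T N by (subst emeasure_subadditive[of "T - N" lborel N, THEN order_trans[rotated]]) 
        (auto intro!: emeasure_mono)
    then have le: "emeasure lborel T \<le> ennreal (e / 5 ^ DIM('a))" using T N by simp
    have "hausdorff_pre (DIM('a)) \<delta> N \<le> hausdorff_pre (DIM('a)) \<delta> T"
      using T by (intro hausdorff_pre_mono) auto
    also have "\<dots> \<le> ennreal (5 ^ DIM('a)) * emeasure lborel T" by (rule hausdorff_pre_le_5_power) fact+
    also have "\<dots> \<le> ennreal (5 ^ DIM('a)) * ennreal (e / 5 ^ DIM('a))"
      using le by (rule mult_left_mono) simp
    also have "\<dots> = ennreal e" using e by (simp add: ennreal_mult[symmetric])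
    finally show ?thesis by simp
  qed
  then have "hausdorff_pre (DIM('a)) \<delta> N \<le> 0" by (rule ennreal_le_epsilon)
  then show ?thesis by simp
qed

lemma hausdorff_pre_le_lborel_open:
  fixes T :: "'a::euclidean_space set"
  assumes T: "open T" and \<delta>: "0 < \<delta>"
  shows "hausdorff_pre (DIM('a)) \<delta> T \<le> emeasure lborel T"
proof -
  define K where "K = {(x, r). 0 < r \<and> r \<le> \<delta> / 2 \<and> cball x r \<subseteq> T}"
  obtain C where C: "countable C" "C \<subseteq> K"
     "pairwise (\<lambda>i j. disjnt (cball (fst i) (snd i)) (cball (fst j) (snd j))) C"
     "negligible (T - (\<Union>i\<in>C. cball (fst i) (snd i)))"
  proof (rule Vitali_covering_theorem_cballs[of K snd T fst])
    show "0 < snd i" if "i \<in> K" for i using that by (auto simp: K_def)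
    fix x d assume x: "x \<in> T" "0 < (d::real)"
    obtain e where e: "e > 0" "cball x e \<subseteq> T" using T x(1) by (meson open_contains_cball)
    have "cball x (min e (min (\<delta> / 2) (d / 2))) \<subseteq> T"
      by (rule order_trans[OF subset_cball e(2)]) simp
    then have "(x, min e (min (\<delta> / 2) (d / 2))) \<in> K" using \<delta> x e(1) by (simp add: K_def)
    then show "\<exists>i. i \<in> K \<and> x \<in> cball (fst i) (snd i) \<and> snd i < d"
      using x e(1) \<delta> by (intro exI[of _ "(x, min e (min (\<delta> / 2) (d / 2)))"]) auto
  qed blast
  define V where "V = (\<Union>i\<in>C. cball (fst i) (snd i))"
  have mV: "V \<in> sets borel" unfolding V_def using C(1) by (intro sets.countable_UN') auto
  have V: "hausdorff_pre (DIM('a)) \<delta> V \<le> ennreal (1 ^ DIM('a)) * emeasure lborel T"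
  proof (rule hausdorff_pre_le_cballs[OF C(1,3)])
    fix i assume "i \<in> C"
    then have "i \<in> K" using C(2) by blast
    then show "0 < snd i" "2 * 1 * snd i \<le> \<delta>" "cball (fst i) (snd i) \<subseteq> T"
      by (auto simp: K_def)
  qed (use T \<delta> in \<open>simp_all add: V_def\<close>)
  have "emeasure lborel (T - V) = 0"
    using C(4) mV T null_sets_completion_iff[of "T - V" lborel]
    unfolding V_def[symmetric] negligible_iff_null_sets by (auto simp: null_sets_def)
  then have N: "hausdorff_pre (DIM('a)) \<delta> (T - V) = 0"
    using mV T \<delta> by (intro hausdorff_pre_null) auto
  have "hausdorff_pre (DIM('a)) \<delta> T \<le> hausdorff_pre (DIM('a)) \<delta> (\<Union>n. binaryset V (T - V) n)"
    by (intro hausdorff_pre_mono) (auto simp: UN_binaryset_eq)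
  also have "\<dots> \<le> (\<Sum>n. hausdorff_pre (DIM('a)) \<delta> (binaryset V (T - V) n))"
    by (rule hausdorff_pre_countably_subadditive) simp
  also have "\<dots> = hausdorff_pre (DIM('a)) \<delta> V + hausdorff_pre (DIM('a)) \<delta> (T - V)"
    using \<delta> by (intro suminf_binaryset_eq hausdorff_pre_empty) auto
  finally show ?thesis using V N by simp
qed

text \<open>
The upper bound comes from efficient covers by balls. The lower bound says that no cover by sets of other
shapes is cheaper, which is the isodiametric inequality.
\<close>

theorem hausdorff_outer_eq_lborel:
  fixes B :: "'a::euclidean_space set"
  assumes B: "B \<in> sets borel"
  shows "hausdorff_outer (DIM('a)) B = emeasure lborel B"
proof (rule antisym)
  show "hausdorff_outer (DIM('a)) B \<le> emeasure lborel B"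
  proof (rule ennreal_le_epsilon)
    fix e :: real assume e: "0 < e"
    obtain T where T: "open T" "B \<subseteq> T" "emeasure lborel (T - B) < ennreal e"
      using outer_regular_lborel[OF B e] by auto
    have "T = B \<union> (T - B)" using T by auto
    then have "emeasure lborel T \<le> emeasure lborel B + emeasure lborel (T - B)"
      using emeasure_subadditive[of B lborel "T - B"] T B by simp
    also have "\<dots> \<le> emeasure lborel B + ennreal e" using T by (intro add_left_mono) simp
    finally have le: "emeasure lborel T \<le> emeasure lborel B + ennreal e" .
    show "hausdorff_outer (DIM('a)) B \<le> emeasure lborel B + ennreal e"
      unfolding hausdorff_outer_def
    proof (rule SUP_least)
      fix \<delta> :: real assume "\<delta> \<in> {0<..}"
      then have "hausdorff_pre (DIM('a)) \<delta> T \<le> emeasure lborel T"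
        using T by (intro hausdorff_pre_le_lborel_open) auto
      moreover have "hausdorff_pre (DIM('a)) \<delta> B \<le> hausdorff_pre (DIM('a)) \<delta> T"
        using T by (intro hausdorff_pre_mono) auto
      ultimately show "hausdorff_pre (DIM('a)) \<delta> B \<le> emeasure lborel B + ennreal e"
        using le by (blast intro: order_trans)
    qed
  qed
  have "emeasure lborel B \<le> hausdorff_pre (DIM('a)) 1 B"
    unfolding hausdorff_pre_def
  proof (rule INF_greatest)
    fix U :: "nat \<Rightarrow> 'a set"
    assume "U \<in> {U. (\<forall>i. bounded (U i) \<and> diameter (U i) \<le> 1) \<and> B \<subseteq> (\<Union>i. U i)}"
    then have U: "\<And>i. bounded (U i)" "B \<subseteq> (\<Union>i. U i)" by auto
    have "emeasure lborel B \<le> emeasure lborel (\<Union>i. closure (U i))"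
      by (intro emeasure_mono order_trans[OF U(2)] UN_mono closure_subset) auto
    also have "\<dots> \<le> (\<Sum>i. emeasure lborel (closure (U i)))"
      by (rule emeasure_subadditive_countably) auto
    also have "\<dots> \<le> (\<Sum>i. ball_cost (DIM('a)) (U i))"
    proof (intro suminf_le summableI)
      fix i
      show "emeasure lborel (closure (U i)) \<le> ball_cost (DIM('a)) (U i)"
        using isodiametric_inequality[of "closure (U i)"] U(1)[of i] by (simp add: diameter_closure bounded_closure)
    qed
    finally show "emeasure lborel B \<le> \<dots>" .
  qed
  also have "\<dots> \<le> hausdorff_outer (DIM('a)) B" by (rule hausdorff_pre_le_outer) simp_all
  finally show "emeasure lborel B \<le> hausdorff_outer (DIM('a)) B" .
qed

section \<open>Surface measure near the pole\<close>

lemma space_sphere_measure [simp]: "space (sphere_measure :: (real \<times> (real^'n::finite)) measure) = sphere 0 1"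
  by (simp add: sphere_measure_def space_restrict_space hausdorff_measure_def)

lemma sets_sphere_measure [measurable_cong]:
  "sets (sphere_measure :: (real \<times> (real^'n::finite)) measure) = sets (restrict_space borel (sphere 0 1))"
proof -
  have "1 \<le> CARD('n)" by (simp add: Suc_leI)
  then show ?thesis
    unfolding sphere_measure_def by (intro sets_restrict_space_cong sets_hausdorff_measure)
qed

lemma emeasure_sphere_measure:
  fixes A :: "(real \<times> (real^'n::finite)) set"
  assumes "A \<in> sets borel" "A \<subseteq> sphere 0 1"
  shows "emeasure sphere_measure A = hausdorff_outer CARD('n) A"
proof -
  have d: "1 \<le> CARD('n)" by (simp add: Suc_leI)
  have "emeasure sphere_measure A = emeasure (hausdorff_measure CARD('n)) A"
    unfolding sphere_measure_def using assms
    by (intro emeasure_restrict_space) (auto simp: sets_hausdorff_measure[OF d] hausdorff_measure_def)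
  then show ?thesis using emeasure_hausdorff_measure[OF d assms(1)] by simp
qed

text \<open>
The slope of the upper unit hemisphere over the ball of radius \<open>r\<close> is at most \<open>k = r / sqrt (1 - r\<^sup>2)\<close>,
and \<open>sqrt (1 + k\<^sup>2) = 1 / sqrt (1 - r\<^sup>2)\<close>.
\<close>

lemma graph_lipschitz:
  fixes x y :: "'a::real_normed_vector"
  assumes r: "0 \<le> r" "r < 1" and xy: "norm x \<le> r" "norm y \<le> r"
  shows "dist (sqrt (1 - (norm x)\<^sup>2), x) (sqrt (1 - (norm y)\<^sup>2), y) \<le> (1 / sqrt (1 - r\<^sup>2)) * dist x y"
proof -
  define m where "m = sqrt (1 - r\<^sup>2)"
  have r2: "r\<^sup>2 < 1" using r by (simp add: power_less_one_iff abs_square_less_1)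
  have m: "m > 0" "m\<^sup>2 = 1 - r\<^sup>2" using r2 by (auto simp: m_def)
  define s where "s = sqrt (1 - (norm x)\<^sup>2)"
  define u where "u = sqrt (1 - (norm y)\<^sup>2)"
  have nx: "(norm x)\<^sup>2 \<le> r\<^sup>2" "(norm y)\<^sup>2 \<le> r\<^sup>2" using xy by (auto intro: power_mono)
  have su: "m \<le> s" "m \<le> u" unfolding m_def s_def u_def using nx by auto
  have su2: "s\<^sup>2 = 1 - (norm x)\<^sup>2" "u\<^sup>2 = 1 - (norm y)\<^sup>2" using nx r2 by (auto simp: s_def u_def)
  have "(s - u) * (s + u) = (norm y - norm x) * (norm y + norm x)"
    using su2 by (simp add: power2_eq_square algebra_simps)
  then have "\<bar>(s - u) * (s + u)\<bar> = \<bar>(norm y - norm x) * (norm y + norm x)\<bar>" by (rule arg_cong)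
  moreover have "0 \<le> s + u" using su m(1) by linarith
  ultimately have eq: "\<bar>s - u\<bar> * (s + u) = \<bar>norm y - norm x\<bar> * (norm y + norm x)"
    by (simp only: abs_mult abs_of_nonneg add_nonneg_nonneg norm_ge_zero)
  have "\<bar>s - u\<bar> * (2 * m) \<le> \<bar>s - u\<bar> * (s + u)" using su by (intro mult_left_mono) auto
  also have "\<dots> \<le> dist x y * (2 * r)"
    unfolding eq using xy norm_triangle_ineq3[of y x] by (intro mult_mono) (auto simp: dist_norm norm_minus_commute)
  finally have "\<bar>s - u\<bar> * m \<le> dist x y * r" by simp
  then have "(\<bar>s - u\<bar> * m)\<^sup>2 \<le> (dist x y * r)\<^sup>2" using m by (intro power_mono) auto
  then have "(s - u)\<^sup>2 * m\<^sup>2 \<le> (dist x y)\<^sup>2 * r\<^sup>2" by (simp add: power_mult_distrib)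
  moreover have "(dist x y)\<^sup>2 * m\<^sup>2 = (dist x y)\<^sup>2 - (dist x y)\<^sup>2 * r\<^sup>2" unfolding m(2) by (simp add: algebra_simps)
  ultimately have "((s - u)\<^sup>2 + (dist x y)\<^sup>2) * m\<^sup>2 \<le> (dist x y)\<^sup>2" unfolding distrib_right by linarith
  then have "(s - u)\<^sup>2 + (dist x y)\<^sup>2 \<le> (dist x y / m)\<^sup>2"
    using m(1) by (simp add: pos_le_divide_eq power_divide)
  then have "sqrt ((s - u)\<^sup>2 + (dist x y)\<^sup>2) \<le> dist x y / m"
    using m(1) by (intro real_le_lsqrt) auto
  then show ?thesis by (simp add: dist_Pair_Pair dist_real_def m_def s_def u_def)
qed

lemma cap_measurable:
  fixes B :: "(real^'n::finite) set"
  assumes [measurable]: "B \<in> sets borel"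
  shows "{\<omega> \<in> sphere 0 1. 0 < fst \<omega> \<and> snd \<omega> \<in> B} \<in> sets (borel :: (real \<times> (real^'n)) measure)"
proof -
  have 1: "fst -` {0<..} \<inter> space borel \<in> sets (borel :: (real \<times> (real^'n)) measure)"
    by (rule measurable_sets[of _ _ borel]) (auto intro!: borel_measurable_continuous_onI continuous_intros)
  have 2: "snd -` B \<inter> space borel \<in> sets (borel :: (real \<times> (real^'n)) measure)"
    by (rule measurable_sets[of _ _ borel]) (auto intro!: borel_measurable_continuous_onI continuous_intros)
  have "sphere 0 1 \<in> sets (borel :: (real \<times> (real^'n)) measure)" by (rule borel_closed) simp
  from sets.Int[OF this sets.Int[OF 1 2]]
  have "sphere 0 1 \<inter> ((fst -` {0<..} \<inter> space borel) \<inter> (snd -` B \<inter> space borel)) \<in> sets (borel :: (real \<times> (real^'n)) measure)"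
    .
  also have "sphere 0 1 \<inter> ((fst -` {0<..} \<inter> space borel) \<inter> (snd -` B \<inter> space borel)) = {\<omega> :: real \<times> (real^'n). \<omega> \<in> sphere 0 1 \<and> 0 < fst \<omega> \<and> snd \<omega> \<in> B}"
    by auto
  finally show ?thesis .
qed

text \<open>
The vertical projection of the cap is 1-Lipschitz, and its inverse is Lipschitz with a constant close to 1
for small \<open>r\<close>. Lipschitz maps distort Hausdorff measure by at most the power of their constant, so near
the pole the surface measure is comparable to Lebesgue measure with constants that tend to 1.
\<close>

lemma emeasure_cap:
  fixes B :: "(real^'n::finite) set"
  assumes B: "B \<in> sets borel" "B \<subseteq> ball 0 r" and r: "0 \<le> r" "r < 1"
  defines "A \<equiv> {\<omega> \<in> sphere 0 1. 0 < fst \<omega> \<and> snd \<omega> \<in> B}"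
  shows "emeasure lborel B \<le> emeasure sphere_measure A"
    and "emeasure sphere_measure A \<le> ennreal ((1 / sqrt (1 - r\<^sup>2)) ^ CARD('n)) * emeasure lborel B"
proof -
  have d: "1 \<le> CARD('n)" by (simp add: Suc_leI)
  have A: "A \<in> sets borel" "A \<subseteq> sphere 0 1" unfolding A_def by (rule cap_measurable[OF B(1)]) blast
  have r2: "r\<^sup>2 < 1" using r by (simp add: power_less_one_iff abs_square_less_1)
  define \<Phi> where "\<Phi> = (\<lambda>\<xi>::real^'n. (sqrt (1 - (norm \<xi>)\<^sup>2), \<xi>))"
  have nB: "norm \<xi> < r" if "\<xi> \<in> B" for \<xi> using B(2) that by auto
  have n1: "(norm \<xi>)\<^sup>2 < 1" if "\<xi> \<in> B" for \<xi>
    using nB[OF that] r by (simp add: power_less_one_iff abs_square_less_1)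
  have A\<Phi>: "A = \<Phi> ` B"
  proof
    show "A \<subseteq> \<Phi> ` B"
    proof
      fix \<omega> assume w: "\<omega> \<in> A"
      then have "(fst \<omega>)\<^sup>2 + (norm (snd \<omega>))\<^sup>2 = 1"
        by (simp add: A_def dist_norm norm_prod_def)
      then have "fst \<omega> = sqrt (1 - (norm (snd \<omega>))\<^sup>2)"
        using w by (intro real_sqrt_unique[symmetric]) (auto simp: A_def)
      then have "\<omega> = \<Phi> (snd \<omega>)" by (simp add: \<Phi>_def prod_eq_iff)
      then show "\<omega> \<in> \<Phi> ` B" using w by (auto simp: A_def)
    qed
    show "\<Phi> ` B \<subseteq> A"
      using n1 by (auto simp: A_def \<Phi>_def norm_prod_def dist_norm less_imp_le)
  qed
  then have "B = snd ` A" by (auto simp: \<Phi>_def image_image)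
  then have "emeasure lborel B = hausdorff_outer CARD('n) (snd ` A)"
    using hausdorff_outer_eq_lborel[OF B(1)] by simp
  also have "\<dots> \<le> ennreal (1 ^ CARD('n)) * hausdorff_outer CARD('n) A"
    by (rule hausdorff_outer_lipschitz_image[OF d]) (auto simp: dist_snd_le)
  finally show "emeasure lborel B \<le> emeasure sphere_measure A"
    by (simp add: emeasure_sphere_measure[OF A])
  have "hausdorff_outer CARD('n) (\<Phi> ` B) \<le> ennreal ((1 / sqrt (1 - r\<^sup>2)) ^ CARD('n)) * hausdorff_outer CARD('n) B"
    unfolding \<Phi>_def using r r2 nB
    by (intro hausdorff_outer_lipschitz_image[OF d] graph_lipschitz) (auto intro: less_imp_le)
  then show "emeasure sphere_measure A \<le> ennreal ((1 / sqrt (1 - r\<^sup>2)) ^ CARD('n)) * emeasure lborel B"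
    unfolding emeasure_sphere_measure[OF A] unfolding A\<Phi> using hausdorff_outer_eq_lborel[OF B(1)] by simp
qed

lemma uminus_measurable_sphere_measure:
  "uminus \<in> measurable sphere_measure (sphere_measure :: (real \<times> (real^'n::finite)) measure)"
  by (simp add: measurable_cong_sets[OF sets_sphere_measure sets_sphere_measure])
     (rule measurable_restrict_space3, simp, simp only: Pi_iff mem_sphere_0 norm_minus_cancel, simp)

lemma distr_uminus_sphere_measure:
  "distr sphere_measure sphere_measure uminus = (sphere_measure :: (real \<times> (real^'n::finite)) measure)"
proof (rule measure_eqI)
  have d: "1 \<le> CARD('n)" by (simp add: Suc_leI)
  let ?M = "sphere_measure :: (real \<times> (real^'n)) measure"
  fix A assume "A \<in> sets (distr ?M ?M uminus)"
  then have "A \<in> sets ?M" by simp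
  then have A: "A \<in> sets borel" "A \<subseteq> sphere 0 1"
    by (auto simp: sets_sphere_measure sets_restrict_space_iff)
  have eq: "uminus ` A = uminus -` A"
  proof (intro set_eqI iffI)
    fix x assume "x \<in> uminus -` A"
    then have "- (- x) \<in> uminus ` A" by (intro imageI) simp
    then show "x \<in> uminus ` A" by simp
  qed auto
  have "uminus ` A \<subseteq> sphere 0 1"
    unfolding image_subset_iff mem_sphere_0 norm_minus_cancel using A(2) by (simp only: subset_iff mem_sphere_0) blast
  then have A': "uminus ` A \<in> sets borel" "uminus ` A \<subseteq> sphere 0 1"
    using measurable_sets[of uminus borel borel A] A by (simp_all add: eq)
  have le: "hausdorff_outer CARD('n) (uminus ` X) \<le> hausdorff_outer CARD('n) X" for X :: "(real \<times> (real^'n)) set"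
    using hausdorff_outer_lipschitz_image[OF d, of 1 X uminus] by (simp add: dist_minus)
  have "hausdorff_outer CARD('n) (uminus ` A) = hausdorff_outer CARD('n) A"
    using le[of A] le[of "uminus ` A"] by (simp add: image_image)
  moreover have "uminus -` A \<inter> space ?M = uminus ` A"
    using A'(2) unfolding eq space_sphere_measure by blast
  ultimately show "emeasure (distr ?M ?M uminus) A = emeasure ?M A"
    using \<open>A \<in> sets ?M\<close> by (simp add: emeasure_distr[OF uminus_measurable_sphere_measure] emeasure_sphere_measure[OF A] emeasure_sphere_measure[OF A'])
qed simp

section \<open>Smooth functions\<close>

lemma Ck_on_cong:
  assumes "open S" "\<And>x. x \<in> S \<Longrightarrow> f x = g x" "Ck_on k S f"
  shows "Ck_on k S g"
  using assms(2,3)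
proof (induction k arbitrary: f g)
  case 0
  then show ?case using continuous_on_cong[of S S f g] by simp
next
  case (Suc k)
  have der: "(g has_derivative frechet_derivative f (at x)) (at x)" if "x \<in> S" for x
    using has_derivative_transform_within_open[of f "frechet_derivative f (at x)" x UNIV S g]
      Suc.prems that assms(1) by (simp add: frechet_derivative_works[symmetric])
  have eq: "frechet_derivative f (at x) = frechet_derivative g (at x)" if "x \<in> S" for x
    using frechet_derivative_at[OF der[OF that]] .
  have "Ck_on k S (\<lambda>x. frechet_derivative g (at x) v)" for v
    by (rule Suc.IH[of "\<lambda>x. frechet_derivative f (at x) v"]) (use Suc.prems eq in auto)
  then show ?case using der by (auto simp: differentiable_def)
qed

lemma Ck_on_subset: "T \<subseteq> S \<Longrightarrow> Ck_on k S f \<Longrightarrow> Ck_on k T f"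
  by (induction k arbitrary: f) (auto intro: continuous_on_subset)

lemma Ck_on_const: "Ck_on k S (\<lambda>_. c)"
  by (induction k arbitrary: c) (auto simp: frechet_derivative_const)

lemma Ck_on_add:
  assumes "open S" "Ck_on k S f" "Ck_on k S g"
  shows "Ck_on k S (\<lambda>x. f x + g x)"
  using assms(2,3)
proof (induction k arbitrary: f g)
  case 0
  then show ?case by (auto intro: continuous_on_add)
next
  case (Suc k)
  have der: "((\<lambda>x. f x + g x) has_derivative (\<lambda>v. frechet_derivative f (at x) v + frechet_derivative g (at x) v)) (at x)"
    if "x \<in> S" for x
    using Suc.prems that by (intro has_derivative_add) (auto simp: frechet_derivative_works[symmetric])
  have "Ck_on k S (\<lambda>x. frechet_derivative (\<lambda>x. f x + g x) (at x) v)" for v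
  proof (rule Ck_on_cong[OF assms(1)])
    show "Ck_on k S (\<lambda>x. frechet_derivative f (at x) v + frechet_derivative g (at x) v)"
      using Suc.prems by (intro Suc.IH) auto
    show "frechet_derivative f (at x) v + frechet_derivative g (at x) v = frechet_derivative (\<lambda>x. f x + g x) (at x) v"
      if "x \<in> S" for x
      using frechet_derivative_at[OF der[OF that]] by metis
  qed
  then show ?case using der by (auto simp: differentiable_def)
qed

lemma Ck_on_compose_linear:
  fixes A :: "'a::euclidean_space \<Rightarrow> 'b::euclidean_space"
  assumes U: "open U" and A: "bounded_linear A" and L: "bounded_linear L" and g: "Ck_on k U g"
  shows "Ck_on k (A -` U) (\<lambda>x. L (g (A x)))"
  using g
proof (induction k arbitrary: g)
  case 0
  have "continuous_on (A -` U) (\<lambda>x. g (A x))"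
    by (rule continuous_on_compose2[of U g, OF _ linear_continuous_on[OF A]]) (use 0 in auto)
  then show ?case
    unfolding Ck_on.simps by (rule continuous_on_compose2[OF linear_continuous_on[OF L, of UNIV]]) simp
next
  case (Suc k)
  have op: "open (A -` U)"
    by (rule continuous_open_vimage[OF U linear_continuous_at[OF A]])
  have der: "((\<lambda>x. L (g (A x))) has_derivative (\<lambda>v. L (frechet_derivative g (at (A x)) (A v)))) (at x)"
    if x: "x \<in> A -` U" for x
  proof -
    have "(g has_derivative frechet_derivative g (at (A x))) (at (A x))"
      using Suc.prems x by (auto simp: frechet_derivative_works[symmetric])
    then have "((\<lambda>x. g (A x)) has_derivative (\<lambda>v. frechet_derivative g (at (A x)) (A v))) (at x)"
      by (rule has_derivative_compose[OF bounded_linear_imp_has_derivative[OF A]])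
    then show ?thesis by (rule bounded_linear.has_derivative[OF L])
  qed
  have "Ck_on k (A -` U) (\<lambda>x. frechet_derivative (\<lambda>x. L (g (A x))) (at x) v)" for v
  proof (rule Ck_on_cong[OF op])
    show "Ck_on k (A -` U) (\<lambda>x. L (frechet_derivative g (at (A x)) (A v)))"
      using Suc.prems by (intro Suc.IH[of "\<lambda>y. frechet_derivative g (at y) (A v)"]) auto
    show "L (frechet_derivative g (at (A x)) (A v)) = frechet_derivative (\<lambda>x. L (g (A x))) (at x) v"
      if "x \<in> A -` U" for x
      using frechet_derivative_at[OF der[OF that]] by metis
  qed
  then show ?case using der by (auto simp: differentiable_def)
qed

lemma smooth_onD:
  assumes "smooth_on S f" "x \<in> S"
  shows "\<exists>U g. open U \<and> x \<in> U \<and> (\<forall>k. Ck_on k U g) \<and> (\<forall>y\<in>S \<inter> U. f y = g y)"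
  using assms unfolding smooth_on_def by (rule bspec)

lemma smooth_on_compose_linear:
  fixes A :: "'a::euclidean_space \<Rightarrow> 'b::euclidean_space"
  assumes g: "smooth_on S g" and A: "bounded_linear A" "A ` T \<subseteq> S" and L: "bounded_linear L"
  shows "smooth_on T (\<lambda>x. L (g (A x)))"
  unfolding smooth_on_def
proof
  fix x assume "x \<in> T"
  then have Ax: "A x \<in> S" using A(2) by (rule image_subset_iff[THEN iffD1, rule_format, rotated])
  obtain U h where "open U \<and> A x \<in> U \<and> (\<forall>k. Ck_on k U h) \<and> (\<forall>y\<in>S \<inter> U. g y = h y)"
    using smooth_onD[OF g Ax] by (elim exE)
  then have U: "open U" "A x \<in> U" "\<And>k. Ck_on k U h" "\<And>y. y \<in> S \<inter> U \<Longrightarrow> g y = h y"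
    by simp_all
  have op: "open (A -` U)"
    by (rule continuous_open_vimage[OF U(1) linear_continuous_at[OF A(1)]])
  show "\<exists>V h. open V \<and> x \<in> V \<and> (\<forall>k. Ck_on k V h) \<and> (\<forall>y\<in>T \<inter> V. L (g (A y)) = h y)"
    using op U A Ck_on_compose_linear[OF U(1) A(1) L U(3)]
    by (intro exI[of _ "A -` U"] exI[of _ "\<lambda>x. L (h (A x))"]) auto
qed

lemma smooth_on_add:
  assumes f: "smooth_on S f" and g: "smooth_on S g"
  shows "smooth_on S (\<lambda>x. f x + g x)"
  unfolding smooth_on_def
proof
  fix x assume x: "x \<in> S"
  obtain U u where "open U \<and> x \<in> U \<and> (\<forall>k. Ck_on k U u) \<and> (\<forall>y\<in>S \<inter> U. f y = u y)"
    using smooth_onD[OF f x] by (elim exE)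
  then have U: "open U" "x \<in> U" "\<And>k. Ck_on k U u" "\<And>y. y \<in> S \<inter> U \<Longrightarrow> f y = u y"
    by simp_all
  obtain V v where "open V \<and> x \<in> V \<and> (\<forall>k. Ck_on k V v) \<and> (\<forall>y\<in>S \<inter> V. g y = v y)"
    using smooth_onD[OF g x] by (elim exE)
  then have V: "open V" "x \<in> V" "\<And>k. Ck_on k V v" "\<And>y. y \<in> S \<inter> V \<Longrightarrow> g y = v y"
    by simp_all
  have "Ck_on k (U \<inter> V) (\<lambda>x. u x + v x)" for k
    using U V by (intro Ck_on_add) (auto intro: Ck_on_subset[of "U \<inter> V"])
  then show "\<exists>W h. open W \<and> x \<in> W \<and> (\<forall>k. Ck_on k W h) \<and> (\<forall>y\<in>S \<inter> W. f y + g y = h y)"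
    using U V by (intro exI[of _ "U \<inter> V"] exI[of _ "\<lambda>x. u x + v x"]) auto
qed

lemma smooth_on_imp_continuous_on:
  assumes "smooth_on S f"
  shows "continuous_on S f"
  unfolding continuous_on_eq_continuous_within
proof
  fix x assume x: "x \<in> S"
  obtain U u where "open U \<and> x \<in> U \<and> (\<forall>k. Ck_on k U u) \<and> (\<forall>y\<in>S \<inter> U. f y = u y)"
    using smooth_onD[OF assms x] by (elim exE)
  then have U: "open U" "x \<in> U" "\<And>k. Ck_on k U u" "\<And>y. y \<in> S \<inter> U \<Longrightarrow> f y = u y"
    by simp_all
  have "continuous_on U u" using U(3)[of 0] by simp
  then have "isCont u x" using U(1,2) by (simp add: continuous_on_eq_continuous_at)
  then have c: "continuous (at x within S) u" by (rule continuous_at_imp_continuous_within)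
  obtain e where e: "0 < e" "ball x e \<subseteq> U" using U(1,2) openE by blast
  show "continuous (at x within S) f"
    by (rule continuous_transform_within[OF c e(1) x]) (use U(4) e(2) in \<open>auto simp: dist_commute subset_iff\<close>)
qed

text \<open>
A function on \<open>R^d\<close>, shrunk by the factor \<open>s\<close> and lifted vertically to the upper hemisphere.
\<close>

definition cap_fun :: "real \<Rightarrow> ('a::euclidean_space \<Rightarrow> complex) \<Rightarrow> real \<times> 'a \<Rightarrow> complex" where
  "cap_fun s f \<omega> = (if 0 < fst \<omega> then f ((1 / s) *\<^sub>R snd \<omega>) else 0)"

text \<open>
Near the equator and on the lower hemisphere the lifted function vanishes, because its support has been
shrunk into a ball of radius less than 1; on the open upper hemisphere it is a composition with a linear map.
\<close>

lemma smooth_on_cap_fun: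
  fixes f :: "'a::euclidean_space \<Rightarrow> complex"
  assumes f: "smooth_on UNIV f" and supp: "\<And>\<xi>. f \<xi> \<noteq> 0 \<Longrightarrow> norm \<xi> < R" and l: "0 < s" "s * R < 1"
  shows "smooth_on (sphere 0 1) (cap_fun s f)"
  unfolding smooth_on_def
proof
  fix \<omega> :: "real \<times> 'a" assume w: "\<omega> \<in> sphere 0 1"
  show "\<exists>U g. open U \<and> \<omega> \<in> U \<and> (\<forall>k. Ck_on k U g) \<and> (\<forall>y\<in>sphere 0 1 \<inter> U. cap_fun s f y = g y)"
  proof (cases "0 < fst \<omega>")
    case True
    have A: "bounded_linear (\<lambda>\<omega>. (1 / s) *\<^sub>R snd \<omega> :: 'a)"
      by (intro bounded_linear_scaleR_right[THEN bounded_linear_compose] bounded_linear_snd)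
    have "smooth_on UNIV (\<lambda>\<omega>::real \<times> 'a. f ((1 / s) *\<^sub>R snd \<omega>))"
      using smooth_on_compose_linear[OF f A, of UNIV "\<lambda>z. z"] by (simp add: bounded_linear_ident)
    from smooth_onD[OF this UNIV_I, of \<omega>]
    obtain U g where "open U \<and> \<omega> \<in> U \<and> (\<forall>k. Ck_on k U g) \<and> (\<forall>y\<in>UNIV \<inter> U. f ((1 / s) *\<^sub>R snd y) = g y)"
      by (elim exE)
    then have U: "open U" "\<omega> \<in> U" "\<And>k. Ck_on k U g" "\<And>y. y \<in> U \<Longrightarrow> f ((1 / s) *\<^sub>R snd y) = g y"
      by simp_all
    have op: "open {\<omega> :: real \<times> 'a. 0 < fst \<omega>}" by (intro open_Collect_less continuous_intros)
    have "Ck_on k (U \<inter> {\<omega>. 0 < fst \<omega>}) g" for k using Ck_on_subset[OF _ U(3)] by blast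
    then show ?thesis
      using U True op by (intro exI[of _ "U \<inter> {\<omega>. 0 < fst \<omega>}"] exI[of _ g]) (auto simp: cap_fun_def)
  next
    case False
    define U where "U = {\<omega> :: real \<times> 'a. fst \<omega> < 0} \<union> {\<omega>. s * R < norm (snd \<omega>)}"
    have "open U" unfolding U_def by (intro open_Un open_Collect_less continuous_intros)
    moreover have "\<omega> \<in> U"
    proof (cases "fst \<omega> = 0")
      case True
      then have "norm (snd \<omega>) = 1" using w by (simp add: norm_prod_def)
      then show ?thesis using l by (simp add: U_def)
    qed (use False in \<open>simp add: U_def\<close>)
    moreover have "cap_fun s f y = 0" if "y \<in> U" for y
    proof (cases "fst y < 0")
      case False
      then have "s * R < norm (snd y)" using that by (simp add: U_def)
      then have "R \<le> norm ((1 / s) *\<^sub>R snd y)" using l by (simp add: field_simps)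
      then show ?thesis using supp[of "(1 / s) *\<^sub>R snd y"] by (force simp: cap_fun_def)
    qed (simp add: cap_fun_def)
    ultimately show ?thesis
      by (intro exI[of _ U] exI[of _ "\<lambda>_. 0"]) (simp add: Ck_on_const)
  qed
qed

section \<open>Homogeneity of the norms\<close>

lemma Lp_norm_ennreal:
  assumes "0 < p"
  shows "Lp_norm (ennreal p) M f =
     (let I = (\<integral>\<^sup>+ x. ennreal (norm (f x) powr p) \<partial>M) in if I = \<infinity> then \<infinity> else ennreal (enn2real I powr (1 / p)))"
  using assms by (simp add: Lp_norm_def Let_def)

lemma Lp_norm_le_iff:
  assumes q: "0 < q" and a: "0 \<le> a"
  shows "Lp_norm (ennreal q) M f \<le> ennreal a \<longleftrightarrow> (\<integral>\<^sup>+ x. ennreal (norm (f x) powr q) \<partial>M) \<le> ennreal (a powr q)"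
proof (cases "(\<integral>\<^sup>+ x. ennreal (norm (f x) powr q) \<partial>M)")
  case (real I)
  have "I powr (1 / q) \<le> a \<longleftrightarrow> I \<le> a powr q"
  proof
    assume "I powr (1 / q) \<le> a"
    then have "(I powr (1 / q)) powr q \<le> a powr q" using q by (intro powr_mono2) auto
    then show "I \<le> a powr q" using q real by (simp add: powr_powr)
  next
    assume "I \<le> a powr q"
    then have "I powr (1 / q) \<le> (a powr q) powr (1 / q)" using q real by (intro powr_mono2) auto
    then show "I powr (1 / q) \<le> a" using q a by (simp add: powr_powr)
  qed
  then show ?thesis using real q a by (simp add: Lp_norm_ennreal Let_def)
next
  case top
  then show ?thesis using q by (simp add: Lp_norm_ennreal Let_def top_unique)
qed

lemma Lp_norm_cmult_le:
  fixes f :: "'a \<Rightarrow> complex"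
  assumes f: "f \<in> borel_measurable M" and c: "0 < c" and q: "q = \<infinity> \<or> (\<exists>q'>0. q = ennreal q')"
  shows "Lp_norm q M (\<lambda>x. of_real c * f x) \<le> ennreal c * Lp_norm q M f"
  using q
proof
  assume q: "q = \<infinity>"
  have "AE x in M. ennreal (norm (of_real c * f x)) \<le> ennreal c * esssup M (\<lambda>x. ennreal (norm (f x)))"
    using esssup_AE[of "\<lambda>x. ennreal (norm (f x))" M]
    by eventually_elim (use c in \<open>simp add: norm_mult ennreal_mult mult_left_mono\<close>)
  then show ?thesis using q f by (simp add: Lp_norm_def) (intro esssup_I, auto)
next
  assume "\<exists>q'>0. q = ennreal q'"
  then obtain q' where q': "0 < q'" "q = ennreal q'" by blast
  show ?thesis
  proof (cases "Lp_norm q M f")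
    case (real a)
    have "(\<integral>\<^sup>+ x. ennreal (norm (f x) powr q') \<partial>M) \<le> ennreal (a powr q')"
      using Lp_norm_le_iff[OF q'(1) real(1), of M f] real q' by simp
    then have "ennreal (c powr q') * (\<integral>\<^sup>+ x. ennreal (norm (f x) powr q') \<partial>M) \<le> ennreal (c powr q') * ennreal (a powr q')"
      by (rule mult_left_mono) simp
    also have "\<dots> = ennreal ((c * a) powr q')" using c real by (simp add: powr_mult ennreal_mult)
    also have "ennreal (c powr q') * (\<integral>\<^sup>+ x. ennreal (norm (f x) powr q') \<partial>M) = (\<integral>\<^sup>+ x. ennreal (norm (of_real c * f x) powr q') \<partial>M)"
      using f c by (subst nn_integral_cmult[symmetric]) (auto simp: norm_mult powr_mult ennreal_mult)
    finally have "Lp_norm q M (\<lambda>x. of_real c * f x) \<le> ennreal (c * a)"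
      unfolding q'(2) using c real(1) by (intro Lp_norm_le_iff[THEN iffD2] q'(1) mult_nonneg_nonneg) auto
    then show ?thesis using c real by (simp add: ennreal_mult)
  next
    case top
    then show ?thesis using c by (simp add: ennreal_mult_top)
  qed
qed

lemma Lp_norm_cmult:
  fixes f :: "'a \<Rightarrow> complex"
  assumes f: "f \<in> borel_measurable M" and c: "0 < c" and q: "q = \<infinity> \<or> (\<exists>q'>0. q = ennreal q')"
  shows "Lp_norm q M (\<lambda>x. of_real c * f x) = ennreal c * Lp_norm q M f"
proof (rule antisym)
  have "Lp_norm q M (\<lambda>x. of_real (1 / c) * (of_real c * f x)) \<le> ennreal (1 / c) * Lp_norm q M (\<lambda>x. of_real c * f x)"
    using f c by (intro Lp_norm_cmult_le q) auto
  moreover have "(\<lambda>x. of_real (1 / c) * (of_real c * f x)) = f" using c by (simp add: fun_eq_iff)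
  ultimately have "ennreal c * Lp_norm q M f \<le> ennreal c * (ennreal (1 / c) * Lp_norm q M (\<lambda>x. of_real c * f x))"
    by (intro mult_left_mono) auto
  also have "\<dots> = Lp_norm q M (\<lambda>x. of_real c * f x)"
    using c by (simp add: mult.assoc[symmetric] ennreal_mult[symmetric])
  finally show "ennreal c * Lp_norm q M f \<le> Lp_norm q M (\<lambda>x. of_real c * f x)" .
qed (rule Lp_norm_cmult_le[OF assms])

section \<open>Integrals against comparable measures\<close>

lemma nn_integral_le_if_emeasure_le:
  assumes "sets M = sets N" "\<And>A. A \<in> sets N \<Longrightarrow> emeasure N A \<le> emeasure M A"
  shows "integral\<^sup>N N f \<le> integral\<^sup>N M f"
  using assms by (intro nn_integral_mono_measure) (simp_all add: le_measure)

lemma nn_integral_le_if_emeasure_le_mult: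
  assumes "sets M = sets N" "\<And>A. A \<in> sets N \<Longrightarrow> emeasure M A \<le> c * emeasure N A" "f \<in> borel_measurable N"
  shows "integral\<^sup>N M f \<le> c * integral\<^sup>N N f"
proof -
  have "integral\<^sup>N M f \<le> integral\<^sup>N (scale_measure c N) f"
    using assms(1,2) by (intro nn_integral_le_if_emeasure_le) simp_all
  then show ?thesis using nn_integral_scale_measure[OF assms(3)] by simp
qed

lemma integrable_if_emeasure_le_mult:
  fixes f :: "'a \<Rightarrow> 'b::{banach, second_countable_topology}"
  assumes s: "sets M = sets N" and "\<And>A. A \<in> sets N \<Longrightarrow> emeasure M A \<le> ennreal b * emeasure N A" and f: "integrable N f"
  shows "integrable M f"
proof (rule integrableI_bounded)
  show "f \<in> borel_measurable M"
    using borel_measurable_integrable[OF f] by (simp add: measurable_cong_sets[OF s refl])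
  have "(\<integral>\<^sup>+x. ennreal (norm (f x)) \<partial>M) \<le> ennreal b * (\<integral>\<^sup>+x. ennreal (norm (f x)) \<partial>N)"
    using assms by (intro nn_integral_le_if_emeasure_le_mult) auto
  also have "\<dots> < \<infinity>" using f by (simp add: integrable_iff_bounded ennreal_mult_less_top)
  finally show "(\<integral>\<^sup>+x. ennreal (norm (f x)) \<partial>M) < \<infinity>" .
qed

lemma integral_between_measures:
  fixes f :: "'a \<Rightarrow> real"
  assumes s: "sets M = sets N" and le: "\<And>A. A \<in> sets N \<Longrightarrow> emeasure N A \<le> emeasure M A"
    and ge: "\<And>A. A \<in> sets N \<Longrightarrow> emeasure M A \<le> ennreal b * emeasure N A" and b: "0 \<le> b"
    and f: "integrable N f" "\<And>x. 0 \<le> f x"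
  shows "integral\<^sup>L N f \<le> integral\<^sup>L M f" "integral\<^sup>L M f \<le> b * integral\<^sup>L N f"
proof -
  have fM: "integrable M f" by (rule integrable_if_emeasure_le_mult[OF s ge f(1)])
  have N: "(\<integral>\<^sup>+x. ennreal (f x) \<partial>N) = ennreal (integral\<^sup>L N f)" using f by (intro nn_integral_eq_integral) auto
  have M: "(\<integral>\<^sup>+x. ennreal (f x) \<partial>M) = ennreal (integral\<^sup>L M f)" using fM f by (intro nn_integral_eq_integral) auto
  have pos: "0 \<le> integral\<^sup>L N f" "0 \<le> integral\<^sup>L M f" using f by (auto intro: integral_nonneg_AE)
  show "integral\<^sup>L N f \<le> integral\<^sup>L M f"
    using nn_integral_le_if_emeasure_le[OF s le, of "\<lambda>x. ennreal (f x)"] pos unfolding N M by simp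
  have "(\<integral>\<^sup>+x. ennreal (f x) \<partial>M) \<le> ennreal b * (\<integral>\<^sup>+x. ennreal (f x) \<partial>N)"
    using f by (intro nn_integral_le_if_emeasure_le_mult s ge) auto
  then show "integral\<^sup>L M f \<le> b * integral\<^sup>L N f"
    unfolding N M using pos b by (simp add: ennreal_mult[symmetric])
qed

lemma integral_diff_le_real:
  fixes f :: "'a \<Rightarrow> real"
  assumes s: "sets M = sets N" and le: "\<And>A. A \<in> sets N \<Longrightarrow> emeasure N A \<le> emeasure M A"
    and ge: "\<And>A. A \<in> sets N \<Longrightarrow> emeasure M A \<le> ennreal b * emeasure N A" and b: "1 \<le> b"
    and f: "integrable N f"
  shows "\<bar>integral\<^sup>L M f - integral\<^sup>L N f\<bar> \<le> (b - 1) * integral\<^sup>L N (\<lambda>x. \<bar>f x\<bar>)"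
proof -
  define p where "p x = max 0 (f x)" for x
  define m where "m x = max 0 (- f x)" for x
  have ip: "integrable N p" "integrable N m" using f unfolding p_def m_def by auto
  have iM: "integrable M p" "integrable M m" using ip by (auto intro!: integrable_if_emeasure_le_mult[OF s ge])
  have f_eq: "f = (\<lambda>x. p x - m x)" by (auto simp: p_def m_def)
  have a_eq: "(\<lambda>x. \<bar>f x\<bar>) = (\<lambda>x. p x + m x)" by (auto simp: p_def m_def)
  have P: "integral\<^sup>L N p \<le> integral\<^sup>L M p" "integral\<^sup>L M p \<le> b * integral\<^sup>L N p"
    by (rule integral_between_measures[OF s le ge _ ip(1)]; use b in \<open>simp add: p_def\<close>)+
  have Q: "integral\<^sup>L N m \<le> integral\<^sup>L M m" "integral\<^sup>L M m \<le> b * integral\<^sup>L N m"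
    by (rule integral_between_measures[OF s le ge _ ip(2)]; use b in \<open>simp add: m_def\<close>)+
  have "integral\<^sup>L M f - integral\<^sup>L N f = (integral\<^sup>L M p - integral\<^sup>L N p) - (integral\<^sup>L M m - integral\<^sup>L N m)"
    unfolding f_eq using ip iM by simp
  moreover have "(b - 1) * integral\<^sup>L N (\<lambda>x. \<bar>f x\<bar>) = (b * integral\<^sup>L N p - integral\<^sup>L N p) + (b * integral\<^sup>L N m - integral\<^sup>L N m)"
    unfolding a_eq using ip by (simp add: algebra_simps)
  ultimately show ?thesis using P Q by linarith
qed

text \<open>
If \<open>N \<le> M \<le> b * N\<close> with \<open>b\<close> close to 1, then integrals against \<open>M\<close> and \<open>N\<close> differ little, also for
oscillating integrands: the real and imaginary parts are split into positive and negative parts.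
\<close>

lemma integral_diff_le:
  fixes f :: "'a \<Rightarrow> complex"
  assumes s: "sets M = sets N" and le: "\<And>A. A \<in> sets N \<Longrightarrow> emeasure N A \<le> emeasure M A"
    and ge: "\<And>A. A \<in> sets N \<Longrightarrow> emeasure M A \<le> ennreal b * emeasure N A" and b: "1 \<le> b"
    and f: "integrable N f"
  shows "norm (integral\<^sup>L M f - integral\<^sup>L N f) \<le> 2 * (b - 1) * integral\<^sup>L N (\<lambda>x. norm (f x))"
proof -
  have fM: "integrable M f" by (rule integrable_if_emeasure_le_mult[OF s ge f])
  have part: "\<bar>L (integral\<^sup>L M f - integral\<^sup>L N f)\<bar> \<le> (b - 1) * integral\<^sup>L N (\<lambda>x. norm (f x))"
    if L: "bounded_linear L" "\<And>z. \<bar>L z\<bar> \<le> norm z" for L :: "complex \<Rightarrow> real"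
  proof -
    have Lf: "integrable N (\<lambda>x. L (f x))" by (rule integrable_bounded_linear[OF L(1) f])
    have "\<bar>integral\<^sup>L M (\<lambda>x. L (f x)) - integral\<^sup>L N (\<lambda>x. L (f x))\<bar> \<le> (b - 1) * integral\<^sup>L N (\<lambda>x. \<bar>L (f x)\<bar>)"
      by (intro integral_diff_le_real s le ge b Lf)
    also have "\<dots> \<le> (b - 1) * integral\<^sup>L N (\<lambda>x. norm (f x))"
      using f b Lf by (intro mult_left_mono integral_mono L(2)) auto
    finally show ?thesis
      by (simp add: integral_bounded_linear[OF L(1)] f fM linear_diff[OF bounded_linear.linear[OF L(1)]])
  qed
  show ?thesis
    using cmod_le[of "integral\<^sup>L M f - integral\<^sup>L N f"] part[OF bounded_linear_Re abs_Re_le_cmod]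
      part[OF bounded_linear_Im abs_Im_le_cmod] by linarith
qed

lemma nn_integral_lborel_scaleR:
  fixes f :: "'a::euclidean_space \<Rightarrow> ennreal"
  assumes [measurable]: "f \<in> borel_measurable borel" and c: "c \<noteq> 0"
  shows "(\<integral>\<^sup>+x. f x \<partial>lborel) = ennreal (\<bar>c\<bar> ^ DIM('a)) * (\<integral>\<^sup>+x. f (c *\<^sub>R x) \<partial>lborel)"
  by (subst lborel_affine[OF c, of 0])
     (simp add: nn_integral_density nn_integral_distr nn_integral_cmult)

lemma integral_lborel_scaleR:
  fixes f :: "'a::euclidean_space \<Rightarrow> 'b::{banach, second_countable_topology}"
  assumes [measurable]: "f \<in> borel_measurable borel" and c: "c \<noteq> 0"
  shows "(\<integral>x. f x \<partial>lborel) = (\<bar>c\<bar> ^ DIM('a)) *\<^sub>R (\<integral>x. f (c *\<^sub>R x) \<partial>lborel)"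
  by (subst lborel_affine[OF c, of 0])
     (simp add: integral_density integral_distr)

abbreviation upper_cap :: "real \<Rightarrow> (real \<times> 'a::real_normed_vector) set" where
  "upper_cap r \<equiv> {\<omega>. 0 < fst \<omega> \<and> snd \<omega> \<in> ball 0 r}"

section \<open>Rescaled extensions of caps\<close>

text \<open>
The surface measure of a cap about the pole, projected to the equatorial plane.
\<close>

definition cap_measure :: "real \<Rightarrow> (real^'n::finite) measure" where
  "cap_measure r = distr (density sphere_measure (indicator (upper_cap r))) borel snd"

lemma sets_cap_measure [simp, measurable_cong]: "sets (cap_measure r) = sets borel"
  by (simp add: cap_measure_def)

lemma borel_measurable_sphere_measure:
  "f \<in> measurable borel N \<Longrightarrow> f \<in> measurable (sphere_measure :: (real \<times> (real^'n::finite)) measure) N"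
  by (simp add: measurable_cong_sets[OF sets_sphere_measure refl] measurable_restrict_space1)

lemma snd_measurable_sphere_measure [measurable]:
  "snd \<in> measurable (sphere_measure :: (real \<times> (real^'n::finite)) measure) borel"
  by (intro borel_measurable_sphere_measure borel_measurable_continuous_onI continuous_intros)

lemma fst_measurable_sphere_measure [measurable]:
  "fst \<in> measurable (sphere_measure :: (real \<times> (real^'n::finite)) measure) borel"
  by (intro borel_measurable_sphere_measure borel_measurable_continuous_onI continuous_intros)

lemma indicator_cap_measurable [measurable]:
  "indicator (upper_cap r) \<in> borel_measurable (sphere_measure :: (real \<times> (real^'n::finite)) measure)"
  (is "indicator ?H \<in> _")
proof -
  have "open ?H"
    unfolding mem_ball by (intro open_Collect_conj open_Collect_less continuous_intros)
  then show ?thesis by (intro borel_measurable_sphere_measure borel_measurable_indicator) auto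
qed

lemma nn_integral_cap_measure:
  fixes f :: "real^'n::finite \<Rightarrow> ennreal"
  assumes [measurable]: "f \<in> borel_measurable borel"
  shows "(\<integral>\<^sup>+\<xi>. f \<xi> \<partial>cap_measure r)
    = (\<integral>\<^sup>+\<omega>. indicator (upper_cap r) \<omega> * f (snd \<omega>) \<partial>sphere_measure)"
  unfolding cap_measure_def by (simp add: nn_integral_distr nn_integral_density)

lemma integral_cap_measure:
  fixes f :: "real^'n::finite \<Rightarrow> complex"
  assumes [measurable]: "f \<in> borel_measurable borel"
  shows "(\<integral>\<xi>. f \<xi> \<partial>cap_measure r)
    = (\<integral>\<omega>. indicator (upper_cap r) \<omega> *\<^sub>R f (snd \<omega>) \<partial>sphere_measure)"
proof -
  have "density (sphere_measure :: (real \<times> (real^'n)) measure) (indicator (upper_cap r))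
      = density sphere_measure (\<lambda>\<omega>. ennreal (indicator (upper_cap r) \<omega>))"
    by (intro density_cong) (auto simp: indicator_def)
  then show ?thesis
    unfolding cap_measure_def by (simp add: integral_distr integral_density)
qed

text \<open>
An upper bound for the ratio of surface measure to Lebesgue measure on a cap, by the Lipschitz constant of
the graph.
\<close>

definition cap_distortion :: "'n::finite itself \<Rightarrow> real \<Rightarrow> real" where
  "cap_distortion _ r = (1 / sqrt (1 - r\<^sup>2)) ^ CARD('n)"

lemma cap_distortion_ge_1:
  assumes "0 \<le> r" "r < 1"
  shows "1 \<le> cap_distortion TYPE('n::finite) r"
proof -
  have "0 < 1 - r\<^sup>2" using assms by (simp add: power_less_one_iff abs_square_less_1)
  moreover have "sqrt (1 - r\<^sup>2) \<le> 1" by simp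
  ultimately have "1 \<le> 1 / sqrt (1 - r\<^sup>2)" by (simp add: le_divide_eq)
  then show ?thesis unfolding cap_distortion_def by (rule one_le_power)
qed

lemma emeasure_cap_measure:
  fixes B :: "(real^'n::finite) set"
  assumes B: "B \<in> sets borel" and r: "0 \<le> r" "r < 1"
  shows "emeasure (density lborel (indicator (ball 0 r))) B \<le> emeasure (cap_measure r) B"
    and "emeasure (cap_measure r) B \<le> ennreal (cap_distortion TYPE('n) r) * emeasure (density lborel (indicator (ball 0 r))) B"
proof -
  have Br: "B \<inter> ball 0 r \<in> sets borel" "B \<inter> ball 0 r \<subseteq> ball 0 r" using B by auto
  have m: "{\<omega> \<in> sphere 0 1. 0 < fst \<omega> \<and> snd \<omega> \<in> B \<inter> ball 0 r} \<in> sets (sphere_measure :: (real \<times> (real^'n)) measure)"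
    using cap_measurable[OF Br(1)] by (auto simp: sets_sphere_measure sets_restrict_space_iff)
  have "emeasure (cap_measure r) B = (\<integral>\<^sup>+\<xi>. indicator B \<xi> \<partial>cap_measure r)" using B by simp
  also have "\<dots> = (\<integral>\<^sup>+\<omega>. indicator (upper_cap r) \<omega> * indicator B (snd \<omega>) \<partial>sphere_measure)"
    using B by (intro nn_integral_cap_measure) auto
  also have "\<dots> = (\<integral>\<^sup>+\<omega>. indicator {\<omega> \<in> sphere 0 1. 0 < fst \<omega> \<and> snd \<omega> \<in> B \<inter> ball 0 r} \<omega> \<partial>(sphere_measure :: (real \<times> (real^'n)) measure))"
    by (intro nn_integral_cong) (auto simp: indicator_def)
  also have "\<dots> = emeasure sphere_measure {\<omega> \<in> sphere 0 1. 0 < fst \<omega> \<and> snd \<omega> \<in> B \<inter> ball 0 r}"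
    using m by (rule nn_integral_indicator)
  finally have 1: "emeasure (cap_measure r) B = emeasure sphere_measure {\<omega> \<in> sphere 0 1. 0 < fst \<omega> \<and> snd \<omega> \<in> B \<inter> ball 0 r}" .
  have "emeasure (density lborel (indicator (ball 0 r))) B = (\<integral>\<^sup>+\<xi>. indicator (B \<inter> ball 0 r) \<xi> \<partial>lborel)"
  proof (subst emeasure_density)
    show "indicator (ball 0 r) \<in> borel_measurable (lborel :: (real^'n) measure)"
      by (intro borel_measurable_indicator) simp
    show "B \<in> sets lborel" using B by simp
    show "(\<integral>\<^sup>+\<xi>. indicator (ball 0 r) \<xi> * indicator B \<xi> \<partial>lborel) = (\<integral>\<^sup>+\<xi>. indicator (B \<inter> ball 0 r) \<xi> \<partial>lborel)"
      by (intro nn_integral_cong) (auto simp: indicator_def)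
  qed
  also have "\<dots> = emeasure lborel (B \<inter> ball 0 r)" using Br by simp
  finally have 2: "emeasure (density lborel (indicator (ball 0 r))) B = emeasure lborel (B \<inter> ball 0 r)" .
  show "emeasure (density lborel (indicator (ball 0 r))) B \<le> emeasure (cap_measure r) B"
    unfolding 1 2 by (rule emeasure_cap(1)[OF Br r])
  show "emeasure (cap_measure r) B \<le> ennreal (cap_distortion TYPE('n) r) * emeasure (density lborel (indicator (ball 0 r))) B"
    unfolding 1 2 cap_distortion_def by (rule emeasure_cap(2)[OF Br r])
qed

lemma cap_fun_eq_indicator:
  fixes f :: "'a::euclidean_space \<Rightarrow> complex"
  assumes "\<And>\<xi>. f \<xi> \<noteq> 0 \<Longrightarrow> norm \<xi> < R" "0 < s"
  shows "cap_fun s f \<omega> = indicator (upper_cap (s * R)) \<omega> *\<^sub>R f ((1 / s) *\<^sub>R snd \<omega>)"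
proof (cases "f ((1 / s) *\<^sub>R snd \<omega>) = 0")
  case False
  from assms(1)[OF this] have "norm (snd \<omega>) < s * R" using assms(2) by (simp add: field_simps)
  then show ?thesis by (simp add: cap_fun_def indicator_def)
qed (simp add: cap_fun_def)

lemma nn_integral_cap_fun:
  fixes f :: "real^'n::finite \<Rightarrow> complex" and g :: "complex \<Rightarrow> ennreal"
  assumes [measurable]: "f \<in> borel_measurable borel" and supp: "\<And>\<xi>. f \<xi> \<noteq> 0 \<Longrightarrow> norm \<xi> < R"
    and R: "0 \<le> R" and s: "0 < s" "s * R < 1"
    and g[measurable]: "g \<in> borel_measurable borel" and g0: "g 0 = 0"
  shows "ennreal (s ^ CARD('n)) * (\<integral>\<^sup>+\<xi>. g (f \<xi>) \<partial>lborel) \<le> (\<integral>\<^sup>+\<omega>. g (cap_fun s f \<omega>) \<partial>sphere_measure)" (is "?L \<le> ?M")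
    and "(\<integral>\<^sup>+\<omega>. g (cap_fun s f \<omega>) \<partial>sphere_measure)
      \<le> ennreal (cap_distortion TYPE('n) (s * R)) * (ennreal (s ^ CARD('n)) * (\<integral>\<^sup>+\<xi>. g (f \<xi>) \<partial>lborel))"
proof -
  let ?N = "density lborel (indicator (ball 0 (s * R))) :: (real^'n) measure"
  have sR: "0 \<le> s * R" using R s by simp
  have M: "?M = (\<integral>\<^sup>+\<xi>. g (f ((1 / s) *\<^sub>R \<xi>)) \<partial>cap_measure (s * R))"
  proof (subst nn_integral_cap_measure)
    show "?M = (\<integral>\<^sup>+\<omega>. indicator (upper_cap (s * R)) \<omega> * g (f ((1 / s) *\<^sub>R snd \<omega>)) \<partial>sphere_measure)"
      by (intro nn_integral_cong) (auto simp: cap_fun_eq_indicator[OF supp s(1)] indicator_def g0)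
  qed measurable
  have "(\<integral>\<^sup>+\<xi>. g (f ((1 / s) *\<^sub>R \<xi>)) \<partial>?N) = (\<integral>\<^sup>+\<xi>. indicator (ball 0 (s * R)) \<xi> * g (f ((1 / s) *\<^sub>R \<xi>)) \<partial>lborel)"
    by (subst nn_integral_density) (auto intro!: borel_measurable_indicator)
  also have "\<dots> = (\<integral>\<^sup>+\<xi>. g (f ((1 / s) *\<^sub>R \<xi>)) \<partial>lborel)"
  proof (intro nn_integral_cong)
    fix \<xi> :: "real^'n"
    show "indicator (ball 0 (s * R)) \<xi> * g (f ((1 / s) *\<^sub>R \<xi>)) = g (f ((1 / s) *\<^sub>R \<xi>))"
    proof (cases "f ((1 / s) *\<^sub>R \<xi>) = 0")
      case False
      from supp[OF this] have "norm \<xi> < s * R" using s(1) by (simp add: field_simps)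
      then show ?thesis by simp
    qed (simp add: g0)
  qed
  also have "\<dots> = ?L"
    using s(1) by (subst nn_integral_lborel_scaleR[of _ s]) auto
  finally have N: "(\<integral>\<^sup>+\<xi>. g (f ((1 / s) *\<^sub>R \<xi>)) \<partial>?N) = ?L" .
  show "?L \<le> ?M"
    unfolding M N[symmetric] by (rule nn_integral_le_if_emeasure_le) (simp_all add: emeasure_cap_measure(1) sR s)
  show "?M \<le> ennreal (cap_distortion TYPE('n) (s * R)) * ?L"
    unfolding M N[symmetric]
    by (rule nn_integral_le_if_emeasure_le_mult) (simp_all add: emeasure_cap_measure(2) sR s)
qed

lemma integrable_cap_fun:
  fixes f :: "real^'n::finite \<Rightarrow> complex"
  assumes f: "integrable lborel f" "f \<in> borel_measurable borel" and supp: "\<And>\<xi>. f \<xi> \<noteq> 0 \<Longrightarrow> norm \<xi> < R"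
    and R: "0 \<le> R" and s: "0 < s" "s * R < 1"
  shows "integrable sphere_measure (cap_fun s f)"
proof (rule integrableI_bounded)
  have [measurable]: "f \<in> borel_measurable borel" by (rule f)
  have "(\<lambda>\<omega>. indicator (upper_cap (s * R)) \<omega> *\<^sub>R f ((1 / s) *\<^sub>R snd \<omega>))
      \<in> borel_measurable (sphere_measure :: (real \<times> (real^'n)) measure)"
    by (intro borel_measurable_scaleR indicator_cap_measurable) measurable
  also have "(\<lambda>\<omega>. indicator (upper_cap (s * R)) \<omega> *\<^sub>R f ((1 / s) *\<^sub>R snd \<omega>)) = cap_fun s f"
    by (rule ext, rule cap_fun_eq_indicator[OF supp s(1), symmetric])
  finally show "cap_fun s f \<in> borel_measurable (sphere_measure :: (real \<times> (real^'n)) measure)" .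
  have "(\<integral>\<^sup>+\<omega>. ennreal (norm (cap_fun s f \<omega>)) \<partial>sphere_measure)
      \<le> ennreal (cap_distortion TYPE('n) (s * R)) * (ennreal (s ^ CARD('n)) * (\<integral>\<^sup>+\<xi>. ennreal (norm (f \<xi>)) \<partial>lborel))"
    by (rule nn_integral_cap_fun(2)[where g="\<lambda>z. ennreal (norm z)"]) (use f supp R s in auto)
  also have "\<dots> < \<infinity>"
    using f by (simp add: integrable_iff_bounded ennreal_mult_less_top)
  finally show "(\<integral>\<^sup>+\<omega>. ennreal (norm (cap_fun s f \<omega>)) \<partial>sphere_measure) < \<infinity>" .
qed

text \<open>
The phase of the spherical extension operator in rescaled variables, with the contribution of the pole
removed; for small \<open>s\<close> it approaches the phase of the parabolic operator.
\<close>

definition cap_phase :: "real \<Rightarrow> real \<times> (real^'n::finite) \<Rightarrow> real^'n \<Rightarrow> real" where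
  "cap_phase s y \<eta> = fst y * ((1 - sqrt (1 - s\<^sup>2 * (norm \<eta>)\<^sup>2)) / s\<^sup>2) + snd y \<bullet> \<eta>"

abbreviation parabolic_point :: "real \<Rightarrow> real \<times> 'a::real_vector \<Rightarrow> real \<times> 'a" where
  "parabolic_point s y \<equiv> (- fst y / s\<^sup>2, (1 / s) *\<^sub>R snd y)"

text \<open>
In the parabolic scaling \<open>x = (- y\<^sub>0 / s\<^sup>2, y' / s)\<close>, \<open>\<xi> = s * \<eta>\<close>, and since \<open>\<omega>\<^sub>0 = sqrt (1 - |\<xi>|\<^sup>2)\<close> on the
hemisphere, the phase \<open>x \<bullet> \<omega>\<close> is \<open>- y\<^sub>0 / s\<^sup>2 + cap_phase s y \<eta>\<close>. The first term is constant and disappears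
in the modulus, and replacing surface measure by Lebesgue measure costs only the distortion of the cap.
\<close>

lemma sphere_extension_cap_fun_bound:
  fixes f :: "real^'n::finite \<Rightarrow> complex" and y :: "real \<times> (real^'n)"
  assumes f: "integrable lborel f" "f \<in> borel_measurable borel" and supp: "\<And>\<xi>. f \<xi> \<noteq> 0 \<Longrightarrow> norm \<xi> < R"
    and R: "0 \<le> R" and s: "0 < s" "s * R < 1"
  shows "\<bar>norm (sphere_extension (cap_fun s f) (parabolic_point s y)) / s ^ CARD('n)
      - norm (\<integral>\<eta>. exp (\<i> * of_real (cap_phase s y \<eta>)) * f \<eta> \<partial>lborel)\<bar>
    \<le> 2 * (cap_distortion TYPE('n) (s * R) - 1) * (\<integral>\<eta>. norm (f \<eta>) \<partial>lborel)"
proof -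
  have [measurable]: "f \<in> borel_measurable borel" by (rule f)
  have sR: "0 \<le> s * R" using R s by simp
  let ?N = "density lborel (\<lambda>\<xi>. ennreal (indicator (ball 0 (s * R)) \<xi>)) :: (real^'n) measure"
  have Neq: "density lborel (indicator (ball 0 (s * R))) = ?N"
    by (intro density_cong) (auto simp: indicator_def intro!: borel_measurable_indicator)
  \<comment> \<open>The value of the exponential at the pole.\<close>
  define c where "c = exp (\<i> * of_real (- fst y / s\<^sup>2))"
  define h where "h \<xi> = exp (\<i> * of_real (cap_phase s y ((1 / s) *\<^sub>R \<xi>))) * f ((1 / s) *\<^sub>R \<xi>)" for \<xi> :: "real^'n"
  have [measurable]: "h \<in> borel_measurable borel"
    unfolding h_def cap_phase_def by measurable
  have h0: "h \<xi> = 0" if "\<not> norm \<xi> < s * R" for \<xi>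
    using supp[of "(1 / s) *\<^sub>R \<xi>"] that s(1) by (auto simp: h_def field_simps)
  have norm_h: "norm (h \<xi>) = norm (f ((1 / s) *\<^sub>R \<xi>))" for \<xi> by (simp add: h_def norm_mult)
  have f_scaled: "integrable lborel (\<lambda>\<xi>. f ((1 / s) *\<^sub>R \<xi>))"
  proof (rule integrableI_bounded)
    have "(\<integral>\<^sup>+\<xi>. ennreal (norm (f ((1 / s) *\<^sub>R \<xi>))) \<partial>lborel) = ennreal (s ^ CARD('n)) * (\<integral>\<^sup>+\<xi>. ennreal (norm (f \<xi>)) \<partial>lborel)"
      using s(1) by (subst nn_integral_lborel_scaleR[of _ s]) auto
    also have "\<dots> < \<infinity>" using f by (simp add: integrable_iff_bounded ennreal_mult_less_top)
    finally show "(\<integral>\<^sup>+\<xi>. ennreal (norm (f ((1 / s) *\<^sub>R \<xi>))) \<partial>lborel) < \<infinity>" .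
  qed measurable
  have h_int: "integrable lborel h"
    by (rule Bochner_Integration.integrable_bound[OF f_scaled]) (auto simp: norm_h)
  have h_N: "integrable ?N h" "(\<integral>\<xi>. h \<xi> \<partial>?N) = (\<integral>\<xi>. h \<xi> \<partial>lborel)"
    "(\<integral>\<xi>. norm (h \<xi>) \<partial>?N) = (\<integral>\<xi>. norm (h \<xi>) \<partial>lborel)"
  proof -
    have i: "indicator (ball 0 (s * R)) \<in> borel_measurable (lborel :: (real^'n) measure)"
      by (intro borel_measurable_indicator) simp
    have e1: "(\<lambda>\<xi>. indicator (ball 0 (s * R)) \<xi> *\<^sub>R h \<xi>) = h"
      using h0 by (auto simp: fun_eq_iff indicator_def)
    have e2: "(\<lambda>\<xi>. indicator (ball 0 (s * R)) \<xi> * norm (h \<xi>)) = (\<lambda>\<xi>. norm (h \<xi>))"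
      using h0 by (auto simp: fun_eq_iff indicator_def)
    show "integrable ?N h" using h_int i by (subst integrable_density) (auto simp: e1)
    show "(\<integral>\<xi>. h \<xi> \<partial>?N) = (\<integral>\<xi>. h \<xi> \<partial>lborel)" using i by (subst integral_density) (auto simp: e1)
    show "(\<integral>\<xi>. norm (h \<xi>) \<partial>?N) = (\<integral>\<xi>. norm (h \<xi>) \<partial>lborel)" using i by (subst integral_density) (auto simp: e2)
  qed
  have "sphere_extension (cap_fun s f) (parabolic_point s y)
      = (\<integral>\<omega>. indicator (upper_cap (s * R)) \<omega> *\<^sub>R (c * h (snd \<omega>)) \<partial>sphere_measure)"
    unfolding sphere_extension_def
  proof (rule Bochner_Integration.integral_cong[OF refl])
    fix \<omega> :: "real \<times> (real^'n)" assume w: "\<omega> \<in> space sphere_measure"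
    show "exp (\<i> * of_real ((parabolic_point s y) \<bullet> \<omega>)) * cap_fun s f \<omega>
        = indicator (upper_cap (s * R)) \<omega> *\<^sub>R (c * h (snd \<omega>))"
    proof (cases "\<omega> \<in> upper_cap (s * R)")
      case True
      have "(fst \<omega>)\<^sup>2 + (norm (snd \<omega>))\<^sup>2 = 1" using w by (simp add: norm_prod_def)
      then have fw: "fst \<omega> = sqrt (1 - (norm (snd \<omega>))\<^sup>2)"
        using True by (intro real_sqrt_unique[symmetric]) auto
      have "s\<^sup>2 * (norm ((1 / s) *\<^sub>R snd \<omega>))\<^sup>2 = (norm (snd \<omega>))\<^sup>2"
        using s(1) by (simp add: power_divide)
      then have "cap_phase s y ((1 / s) *\<^sub>R snd \<omega>) = fst y * ((1 - fst \<omega>) / s\<^sup>2) + snd y \<bullet> ((1 / s) *\<^sub>R snd \<omega>)"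
        unfolding cap_phase_def fw by simp
      then have "(parabolic_point s y) \<bullet> \<omega> = - fst y / s\<^sup>2 + cap_phase s y ((1 / s) *\<^sub>R snd \<omega>)"
        by (simp add: inner_prod_def diff_divide_distrib right_diff_distrib)
      then have "exp (\<i> * of_real ((parabolic_point s y) \<bullet> \<omega>)) = c * exp (\<i> * of_real (cap_phase s y ((1 / s) *\<^sub>R snd \<omega>)))"
        unfolding c_def exp_add[symmetric] by (simp only: of_real_add distrib_left)
      then show ?thesis using True by (simp add: cap_fun_eq_indicator[OF supp s(1)] h_def)
    next
      case False
      then show ?thesis by (simp add: cap_fun_eq_indicator[OF supp s(1)])
    qed
  qed
  also have "\<dots> = (\<integral>\<xi>. c * h \<xi> \<partial>cap_measure (s * R))"
    by (subst integral_cap_measure) measurable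
  also have "\<dots> = c * (\<integral>\<xi>. h \<xi> \<partial>cap_measure (s * R))" by simp
  finally have E: "norm (sphere_extension (cap_fun s f) (parabolic_point s y)) = norm (\<integral>\<xi>. h \<xi> \<partial>cap_measure (s * R))"
    by (simp add: norm_mult c_def)
  have "norm ((\<integral>\<xi>. h \<xi> \<partial>cap_measure (s * R)) - (\<integral>\<xi>. h \<xi> \<partial>?N))
      \<le> 2 * (cap_distortion TYPE('n) (s * R) - 1) * (\<integral>\<xi>. norm (h \<xi>) \<partial>?N)"
  proof (rule integral_diff_le)
    fix A assume "A \<in> sets ?N"
    then have A: "A \<in> sets borel" by simp
    show "emeasure ?N A \<le> emeasure (cap_measure (s * R)) A"
      using emeasure_cap_measure(1)[OF A sR s(2)] unfolding Neq .
    show "emeasure (cap_measure (s * R)) A \<le> ennreal (cap_distortion TYPE('n) (s * R)) * emeasure ?N A"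
      using emeasure_cap_measure(2)[OF A sR s(2)] unfolding Neq .
  qed (simp_all add: cap_distortion_ge_1[OF sR s(2)] h_N(1))
  then have "norm ((\<integral>\<xi>. h \<xi> \<partial>cap_measure (s * R)) - (\<integral>\<xi>. h \<xi> \<partial>lborel))
      \<le> 2 * (cap_distortion TYPE('n) (s * R) - 1) * (\<integral>\<xi>. norm (h \<xi>) \<partial>lborel)"
    unfolding h_N(2,3) .
  moreover have "(\<integral>\<xi>. h \<xi> \<partial>lborel) = (s ^ CARD('n)) *\<^sub>R (\<integral>\<eta>. exp (\<i> * of_real (cap_phase s y \<eta>)) * f \<eta> \<partial>lborel)"
    using s(1) by (subst integral_lborel_scaleR[of _ s]) (auto simp: h_def)
  moreover have "(\<integral>\<xi>. norm (h \<xi>) \<partial>lborel) = s ^ CARD('n) * (\<integral>\<eta>. norm (f \<eta>) \<partial>lborel)"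
    using s(1) by (subst integral_lborel_scaleR[of _ s]) (auto simp: norm_h)
  ultimately have "norm ((\<integral>\<xi>. h \<xi> \<partial>cap_measure (s * R)) - (s ^ CARD('n)) *\<^sub>R (\<integral>\<eta>. exp (\<i> * of_real (cap_phase s y \<eta>)) * f \<eta> \<partial>lborel))
      \<le> 2 * (cap_distortion TYPE('n) (s * R) - 1) * (s ^ CARD('n) * (\<integral>\<eta>. norm (f \<eta>) \<partial>lborel))"
    by simp
  from order_trans[OF norm_triangle_ineq3 this]
  have "\<bar>norm (\<integral>\<xi>. h \<xi> \<partial>cap_measure (s * R)) - s ^ CARD('n) * norm (\<integral>\<eta>. exp (\<i> * of_real (cap_phase s y \<eta>)) * f \<eta> \<partial>lborel)\<bar>
      \<le> s ^ CARD('n) * (2 * (cap_distortion TYPE('n) (s * R) - 1) * (\<integral>\<eta>. norm (f \<eta>) \<partial>lborel))"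
    using s(1) by (simp add: ac_simps)
  moreover have "\<bar>A / a - B\<bar> \<le> C" if "\<bar>A - a * B\<bar> \<le> a * C" "0 < a" for a A B C :: real
  proof -
    have "A / a - B = (A - a * B) / a" using that by (simp add: field_simps)
    then show ?thesis using that by (simp add: divide_le_eq mult.commute)
  qed
  ultimately show ?thesis unfolding E using s(1) by simp
qed

lemma tendsto_cap_phase:
  fixes y :: "real \<times> (real^'n::finite)"
  assumes s: "s \<longlonglongrightarrow> 0" "\<And>n. 0 < s n"
  shows "(\<lambda>n. cap_phase (s n) y \<eta>) \<longlonglongrightarrow> y \<bullet> ((norm \<eta>)\<^sup>2 / 2, \<eta>)"
proof -
  define a where "a = (norm \<eta>)\<^sup>2"
  have lim: "(\<lambda>n. (s n)\<^sup>2 * a) \<longlonglongrightarrow> 0" using tendsto_mult_right[OF tendsto_power[OF s(1), of 2], of a] by simp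
  then have ev: "\<forall>\<^sub>F n in sequentially. (s n)\<^sup>2 * a < 1" by (rule order_tendstoD) simp
  have eq: "\<forall>\<^sub>F n in sequentially. a / (1 + sqrt (1 - (s n)\<^sup>2 * a)) = (1 - sqrt (1 - (s n)\<^sup>2 * a)) / (s n)\<^sup>2"
    using ev
  proof eventually_elim
    case (elim n)
    define w where "w = sqrt (1 - (s n)\<^sup>2 * a)"
    have w: "w\<^sup>2 = 1 - (s n)\<^sup>2 * a" "0 \<le> w" using elim by (auto simp: w_def)
    have "(1 - w) * (1 + w) = (s n)\<^sup>2 * a" using w(1) by (simp add: power2_eq_square algebra_simps)
    then show ?case
      using w(2) s(2)[of n] unfolding w_def[symmetric] by (simp add: divide_eq_eq eq_divide_eq mult_ac)
  qed
  have "(\<lambda>n. a / (1 + sqrt (1 - (s n)\<^sup>2 * a))) \<longlonglongrightarrow> a / (1 + sqrt (1 - 0))"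
    by (intro tendsto_intros lim) simp
  then have "(\<lambda>n. (1 - sqrt (1 - (s n)\<^sup>2 * a)) / (s n)\<^sup>2) \<longlonglongrightarrow> a / 2"
    using eq by (simp cong: filterlim_cong add: Lim_transform_eventually)
  then have "(\<lambda>n. fst y * ((1 - sqrt (1 - (s n)\<^sup>2 * a)) / (s n)\<^sup>2) + snd y \<bullet> \<eta>) \<longlonglongrightarrow> fst y * (a / 2) + snd y \<bullet> \<eta>"
    by (rule tendsto_add[OF tendsto_mult_left tendsto_const])
  then show ?thesis by (simp add: cap_phase_def a_def inner_prod_def)
qed

text \<open>
The sphere looks like a paraboloid at its pole: after rescaling, the phases converge pointwise to that of
the parabolic extension, and dominated convergence applies.
\<close>

theorem sphere_extension_cap_fun_tendsto:
  fixes f :: "real^'n::finite \<Rightarrow> complex" and y :: "real \<times> (real^'n)"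
  assumes f: "integrable lborel f" "f \<in> borel_measurable borel" and supp: "\<And>\<xi>. f \<xi> \<noteq> 0 \<Longrightarrow> norm \<xi> < R"
    and R: "0 \<le> R" and s: "s \<longlonglongrightarrow> 0" "\<And>n. 0 < s n" "\<And>n. s n * R < 1"
  shows "(\<lambda>n. norm (sphere_extension (cap_fun (s n) f) (parabolic_point (s n) y)) / s n ^ CARD('n))
    \<longlonglongrightarrow> norm (parabola_extension f y)"
proof -
  have [measurable]: "f \<in> borel_measurable borel" by (rule f)
  have 1: "(\<lambda>n. \<integral>\<eta>. exp (\<i> * of_real (cap_phase (s n) y \<eta>)) * f \<eta> \<partial>lborel)
      \<longlonglongrightarrow> (\<integral>\<eta>. exp (\<i> * of_real (y \<bullet> ((norm \<eta>)\<^sup>2 / 2, \<eta>))) * f \<eta> \<partial>lborel)"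
  proof (rule integral_dominated_convergence[where w="\<lambda>\<eta>. norm (f \<eta>)"])
    show "(\<lambda>\<eta>. exp (\<i> * of_real (y \<bullet> ((norm \<eta>)\<^sup>2 / 2, \<eta>))) * f \<eta>) \<in> borel_measurable lborel"
      unfolding inner_prod_def by measurable
    show "(\<lambda>\<eta>. exp (\<i> * of_real (cap_phase (s n) y \<eta>)) * f \<eta>) \<in> borel_measurable lborel" for n
      unfolding cap_phase_def by measurable
    show "AE \<eta> in lborel. (\<lambda>n. exp (\<i> * of_real (cap_phase (s n) y \<eta>)) * f \<eta>)
        \<longlonglongrightarrow> exp (\<i> * of_real (y \<bullet> ((norm \<eta>)\<^sup>2 / 2, \<eta>))) * f \<eta>"
      by (intro AE_I2 tendsto_intros tendsto_cap_phase s)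
  qed (use f in \<open>auto simp: norm_mult\<close>)
  have "(\<lambda>n. cap_distortion TYPE('n) (s n * R)) \<longlonglongrightarrow> (1 / sqrt (1 - (0 * R)\<^sup>2)) ^ CARD('n)"
    unfolding cap_distortion_def by (intro tendsto_intros s) simp
  then have "(\<lambda>n. 2 * (cap_distortion TYPE('n) (s n * R) - 1) * (\<integral>\<eta>. norm (f \<eta>) \<partial>lborel))
      \<longlonglongrightarrow> 2 * (1 - 1) * (\<integral>\<eta>. norm (f \<eta>) \<partial>lborel)"
    by (intro tendsto_intros) simp
  then have 2: "(\<lambda>n. 2 * (cap_distortion TYPE('n) (s n * R) - 1) * (\<integral>\<eta>. norm (f \<eta>) \<partial>lborel)) \<longlonglongrightarrow> 0" by simp
  have "(\<lambda>n. norm (sphere_extension (cap_fun (s n) f) (parabolic_point (s n) y)) / s n ^ CARD('n)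
      - norm (\<integral>\<eta>. exp (\<i> * of_real (cap_phase (s n) y \<eta>)) * f \<eta> \<partial>lborel)) \<longlonglongrightarrow> 0"
    by (rule Lim_null_comparison[OF _ 2], intro always_eventually allI)
       (simp only: real_norm_def, rule sphere_extension_cap_fun_bound[OF f supp R s(2,3)])
  from tendsto_add[OF this tendsto_norm[OF 1]] show ?thesis
    by (simp add: parabola_extension_def)
qed

section \<open>Antipodal pairs\<close>

lemma borel_measurable_cnj [measurable (raw)]:
  "f \<in> borel_measurable M \<Longrightarrow> (\<lambda>x. cnj (f x)) \<in> borel_measurable M"
  using measurable_compose[of f M borel cnj borel] borel_measurable_continuous_onI[OF continuous_on_cnj[OF continuous_on_id]]
  by simp

lemma nn_integral_shift:
  fixes f :: "real \<Rightarrow> ennreal"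
  assumes [measurable]: "f \<in> borel_measurable borel"
  shows "(\<integral>\<^sup>+x. f (x + a) \<partial>lborel) = (\<integral>\<^sup>+x. f x \<partial>lborel)"
  using nn_integral_real_affine[of f 1 a] by (simp add: add.commute)

lemma nn_integral_periodic_shift:
  fixes G :: "real \<Rightarrow> ennreal"
  assumes [measurable]: "G \<in> borel_measurable borel" and per: "\<And>\<theta>. G (\<theta> + T) = G \<theta>" and a: "0 \<le> a" "a \<le> T"
  shows "(\<integral>\<^sup>+\<theta>. G (\<theta> + a) * indicator {0..<T} \<theta> \<partial>lborel) = (\<integral>\<^sup>+\<theta>. G \<theta> * indicator {0..<T} \<theta> \<partial>lborel)"
proof -
  have "(\<integral>\<^sup>+\<theta>. G (\<theta> + a) * indicator {0..<T} \<theta> \<partial>lborel) = (\<integral>\<^sup>+\<theta>. (\<lambda>x. G x * indicator {a..<a + T} x) (\<theta> + a) \<partial>lborel)"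
    by (intro nn_integral_cong) (auto simp: indicator_def)
  also have "\<dots> = (\<integral>\<^sup>+\<theta>. G \<theta> * indicator {a..<a + T} \<theta> \<partial>lborel)"
    by (rule nn_integral_shift) measurable
  also have "\<dots> = (\<integral>\<^sup>+\<theta>. G \<theta> * indicator {a..<T} \<theta> + G \<theta> * indicator {T..<a + T} \<theta> \<partial>lborel)"
    using a by (intro nn_integral_cong) (auto simp: indicator_def)
  also have "\<dots> = (\<integral>\<^sup>+\<theta>. G \<theta> * indicator {a..<T} \<theta> \<partial>lborel) + (\<integral>\<^sup>+\<theta>. G \<theta> * indicator {T..<a + T} \<theta> \<partial>lborel)"
    by (rule nn_integral_add) measurable
  also have "(\<integral>\<^sup>+\<theta>. G \<theta> * indicator {T..<a + T} \<theta> \<partial>lborel) = (\<integral>\<^sup>+\<theta>. (\<lambda>x. G x * indicator {T..<a + T} x) (\<theta> + T) \<partial>lborel)"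
    by (rule nn_integral_shift[symmetric]) measurable
  also have "\<dots> = (\<integral>\<^sup>+\<theta>. G \<theta> * indicator {0..<a} \<theta> \<partial>lborel)"
    by (intro nn_integral_cong) (auto simp: indicator_def per)
  also have "(\<integral>\<^sup>+\<theta>. G \<theta> * indicator {a..<T} \<theta> \<partial>lborel) + (\<integral>\<^sup>+\<theta>. G \<theta> * indicator {0..<a} \<theta> \<partial>lborel)
      = (\<integral>\<^sup>+\<theta>. G \<theta> * indicator {a..<T} \<theta> + G \<theta> * indicator {0..<a} \<theta> \<partial>lborel)"
    by (rule nn_integral_add[symmetric]) measurable
  also have "\<dots> = (\<integral>\<^sup>+\<theta>. G \<theta> * indicator {0..<T} \<theta> \<partial>lborel)"
    using a by (intro nn_integral_cong) (auto simp: indicator_def)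
  finally show ?thesis .
qed

lemma nn_integral_circle_rotate:
  fixes g :: "complex \<Rightarrow> ennreal"
  assumes [measurable]: "g \<in> borel_measurable borel" and u: "norm u = 1"
  shows "(\<integral>\<^sup>+\<theta>. g (exp (\<i> * of_real \<theta>) * u) * indicator {0..2 * pi} \<theta> \<partial>lborel)
    = (\<integral>\<^sup>+\<theta>. g (exp (\<i> * of_real \<theta>)) * indicator {0..2 * pi} \<theta> \<partial>lborel)"
proof -
  define a where "a = Arg2pi u"
  have a: "0 \<le> a" "a \<le> 2 * pi" "u = exp (\<i> * of_real a)"
    using Arg2pi[of u] u by (auto simp: a_def is_Arg_def)
  have half: "(\<integral>\<^sup>+\<theta>. k \<theta> * indicator {0..2 * pi} \<theta> \<partial>lborel) = (\<integral>\<^sup>+\<theta>. k \<theta> * indicator {0..<2 * pi} \<theta> \<partial>lborel)"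
    for k :: "real \<Rightarrow> ennreal"
    using AE_lborel_singleton[of "2 * pi :: real"]
    by (intro nn_integral_cong_AE) (auto simp: indicator_def elim!: eventually_mono)
  have period: "exp (\<i> * (2 * complex_of_real pi)) = 1" using exp_two_pi_i by (simp add: mult_ac)
  have "(\<integral>\<^sup>+\<theta>. g (exp (\<i> * of_real (\<theta> + a))) * indicator {0..<2 * pi} \<theta> \<partial>lborel)
      = (\<integral>\<^sup>+\<theta>. g (exp (\<i> * of_real \<theta>)) * indicator {0..<2 * pi} \<theta> \<partial>lborel)"
    by (rule nn_integral_periodic_shift) (use a in \<open>auto simp: distrib_left exp_add period\<close>)
  then show ?thesis unfolding half by (simp add: a(3) exp_add[symmetric] distrib_left)
qed

text \<open>
This is \<open>2 * pi\<close> times the \<open>q\<close>-th power of the norm in the numerator of \<open>alpha\<close>.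
\<close>

definition circle_mean :: "real \<Rightarrow> real \<Rightarrow> ennreal" where
  "circle_mean q t = (\<integral>\<^sup>+\<theta>. ennreal (norm (1 + of_real t * exp (\<i> * of_real \<theta>)) powr q) * indicator {0..2 * pi} \<theta> \<partial>lborel)"

lemma circle_mean_finite:
  assumes "0 < q" "0 \<le> t"
  shows "circle_mean q t < top"
proof -
  have "circle_mean q t \<le> (\<integral>\<^sup>+\<theta>. ennreal ((1 + t) powr q) * indicator {0..2 * pi} \<theta> \<partial>lborel)"
    unfolding circle_mean_def
  proof (intro nn_integral_mono mult_right_mono ennreal_leI powr_mono2)
    show "norm (1 + of_real t * exp (\<i> * of_real \<theta>)) \<le> 1 + t" for \<theta>
      using norm_triangle_ineq[of 1 "of_real t * exp (\<i> * of_real \<theta>)"] assms by (simp add: norm_mult)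
  qed (use assms in auto)
  also have "\<dots> < top" by (simp add: nn_integral_cmult_indicator ennreal_mult_less_top)
  finally show ?thesis .
qed

text \<open>
The factor \<open>cnj z / z\<close> has modulus 1, so it only rotates the circle of integration.
\<close>

lemma nn_integral_circle_conjugate:
  fixes z :: complex
  assumes "0 < q"
  shows "(\<integral>\<^sup>+\<theta>. ennreal (norm (z + of_real t * exp (\<i> * of_real \<theta>) * cnj z) powr q) * indicator {0..2 * pi} \<theta> \<partial>lborel)
    = ennreal (norm z powr q) * circle_mean q t"
proof (cases "z = 0")
  case False
  define u where "u = cnj z / z"
  have u: "norm u = 1" "z * u = cnj z" using False by (auto simp: u_def norm_divide)
  have "(\<integral>\<^sup>+\<theta>. ennreal (norm (z + of_real t * exp (\<i> * of_real \<theta>) * cnj z) powr q) * indicator {0..2 * pi} \<theta> \<partial>lborel)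
      = (\<integral>\<^sup>+\<theta>. ennreal (norm z powr q) * (ennreal (norm (1 + of_real t * (exp (\<i> * of_real \<theta>) * u)) powr q) * indicator {0..2 * pi} \<theta>) \<partial>lborel)"
  proof (intro nn_integral_cong)
    fix \<theta> :: real
    have "z + of_real t * exp (\<i> * of_real \<theta>) * cnj z = z * (1 + of_real t * (exp (\<i> * of_real \<theta>) * u))"
      unfolding u(2)[symmetric] by (simp add: algebra_simps)
    then show "ennreal (norm (z + of_real t * exp (\<i> * of_real \<theta>) * cnj z) powr q) * indicator {0..2 * pi} \<theta>
        = ennreal (norm z powr q) * (ennreal (norm (1 + of_real t * (exp (\<i> * of_real \<theta>) * u)) powr q) * indicator {0..2 * pi} \<theta>)"
      by (simp add: norm_mult powr_mult ennreal_mult mult.assoc)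
  qed
  also have "\<dots> = ennreal (norm z powr q) * (\<integral>\<^sup>+\<theta>. ennreal (norm (1 + of_real t * (exp (\<i> * of_real \<theta>) * u)) powr q) * indicator {0..2 * pi} \<theta> \<partial>lborel)"
    by (rule nn_integral_cmult) measurable
  also have "(\<integral>\<^sup>+\<theta>. ennreal (norm (1 + of_real t * (exp (\<i> * of_real \<theta>) * u)) powr q) * indicator {0..2 * pi} \<theta> \<partial>lborel)
      = circle_mean q t"
    unfolding circle_mean_def
    by (rule nn_integral_circle_rotate[where g="\<lambda>w. ennreal (norm (1 + of_real t * w) powr q)", OF _ u(1)]) measurable
  finally show ?thesis .
qed (use assms in simp)

lemma continuous_on_integral_exp:
  fixes \<Phi> :: "'b \<Rightarrow> 'a::euclidean_space" and f :: "'b \<Rightarrow> complex"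
  assumes f: "integrable M f" and \<Phi>: "\<Phi> \<in> borel_measurable M"
  shows "continuous_on UNIV (\<lambda>x. \<integral>\<omega>. exp (\<i> * of_real (x \<bullet> \<Phi> \<omega>)) * f \<omega> \<partial>M)"
  unfolding continuous_on_eq_continuous_at[OF open_UNIV]
proof
  fix x :: 'a
  have [measurable]: "f \<in> borel_measurable M" "\<Phi> \<in> borel_measurable M" using f \<Phi> by auto
  show "isCont (\<lambda>x. \<integral>\<omega>. exp (\<i> * of_real (x \<bullet> \<Phi> \<omega>)) * f \<omega> \<partial>M) x"
    unfolding continuous_at_sequentially comp_def
  proof (intro allI impI)
    fix X :: "nat \<Rightarrow> 'a" assume X: "X \<longlonglongrightarrow> x"
    show "(\<lambda>n. \<integral>\<omega>. exp (\<i> * of_real (X n \<bullet> \<Phi> \<omega>)) * f \<omega> \<partial>M) \<longlonglongrightarrow> (\<integral>\<omega>. exp (\<i> * of_real (x \<bullet> \<Phi> \<omega>)) * f \<omega> \<partial>M)"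
    proof (rule integral_dominated_convergence[where w="\<lambda>\<omega>. norm (f \<omega>)"])
      show "AE \<omega> in M. (\<lambda>n. exp (\<i> * of_real (X n \<bullet> \<Phi> \<omega>)) * f \<omega>) \<longlonglongrightarrow> exp (\<i> * of_real (x \<bullet> \<Phi> \<omega>)) * f \<omega>"
        by (intro AE_I2 tendsto_intros X)
    qed (use f in \<open>auto simp: norm_mult\<close>)
  qed
qed

lemma integrable_exp_mult:
  fixes \<Phi> :: "'b \<Rightarrow> 'a::euclidean_space" and f :: "'b \<Rightarrow> complex"
  assumes f: "integrable M f" and \<Phi>[measurable]: "\<Phi> \<in> borel_measurable M"
  shows "integrable M (\<lambda>\<omega>. exp (\<i> * of_real (x \<bullet> \<Phi> \<omega>)) * f \<omega>)"
proof -
  have [measurable]: "f \<in> borel_measurable M" using f by auto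
  show ?thesis by (rule Bochner_Integration.integrable_bound[OF f]) (auto simp: norm_mult)
qed

lemma id_measurable_sphere_measure:
  "(\<lambda>\<omega>. \<omega>) \<in> measurable (sphere_measure :: (real \<times> (real^'n::finite)) measure) borel"
  by (rule borel_measurable_sphere_measure) simp

lemma continuous_on_sphere_extension:
  fixes f :: "real \<times> (real^'n::finite) \<Rightarrow> complex"
  assumes "integrable sphere_measure f"
  shows "continuous_on UNIV (sphere_extension f)"
  using continuous_on_integral_exp[OF assms id_measurable_sphere_measure]
  by (simp add: sphere_extension_def[abs_def])

lemma nn_integral_sphere_measure_uminus:
  fixes g :: "real \<times> (real^'n::finite) \<Rightarrow> ennreal"
  assumes "g \<in> borel_measurable sphere_measure"
  shows "(\<integral>\<^sup>+\<omega>. g (- \<omega>) \<partial>sphere_measure) = (\<integral>\<^sup>+\<omega>. g \<omega> \<partial>sphere_measure)"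
  using nn_integral_distr[OF uminus_measurable_sphere_measure, of g] assms
  by (simp add: distr_uminus_sphere_measure)

text \<open>
Reflection at the origin preserves surface measure and conjugates the exponential.
\<close>

lemma sphere_extension_antipodal_cnj:
  fixes F :: "real \<times> (real^'n::finite) \<Rightarrow> complex"
  assumes F: "integrable sphere_measure F"
  shows "integrable sphere_measure (\<lambda>\<omega>. cnj (F (- \<omega>)))"
    and "sphere_extension (\<lambda>\<omega>. cnj (F (- \<omega>))) x = cnj (sphere_extension F x)"
proof -
  have [measurable]: "F \<in> borel_measurable sphere_measure" using F by auto
  have "integrable (distr sphere_measure sphere_measure uminus) F" using F by (simp add: distr_uminus_sphere_measure)
  then have "integrable sphere_measure (\<lambda>\<omega>. F (- \<omega>))"
    using uminus_measurable_sphere_measure by (subst (asm) integrable_distr_eq) auto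
  then show "integrable sphere_measure (\<lambda>\<omega>. cnj (F (- \<omega>)))" by simp
  define G where "G \<omega> = cnj (exp (\<i> * of_real (x \<bullet> \<omega>)) * F \<omega>)" for \<omega>
  have "integrable sphere_measure (\<lambda>\<omega>. exp (\<i> * of_real (x \<bullet> \<omega>)) * F \<omega>)"
    by (rule integrable_exp_mult[OF F id_measurable_sphere_measure])
  then have [measurable]: "G \<in> borel_measurable sphere_measure"
    unfolding G_def by (intro borel_measurable_cnj borel_measurable_integrable)
  have "sphere_extension (\<lambda>\<omega>. cnj (F (- \<omega>))) x = (\<integral>\<omega>. G (- \<omega>) \<partial>sphere_measure)"
    unfolding sphere_extension_def G_def by (intro Bochner_Integration.integral_cong) (auto simp: exp_cnj)
  also have "\<dots> = (\<integral>\<omega>. G \<omega> \<partial>distr sphere_measure sphere_measure uminus)"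
    by (rule integral_distr[symmetric, OF uminus_measurable_sphere_measure]) measurable
  also have "\<dots> = cnj (sphere_extension F x)"
    unfolding sphere_extension_def G_def by (simp add: distr_uminus_sphere_measure del: complex_cnj_mult)
  finally show "sphere_extension (\<lambda>\<omega>. cnj (F (- \<omega>))) x = cnj (sphere_extension F x)" .
qed

lemma Lp_norm_sphere_extension_le:
  fixes f :: "real \<times> (real^'n::finite) \<Rightarrow> complex"
  assumes f: "smooth_on (sphere 0 1) f" "integrable sphere_measure f"
    and p: "0 < p" and N: "Lp_norm (ennreal p) sphere_measure f = ennreal N" "0 < N"
    and q: "q = \<infinity> \<or> (\<exists>q'>0. q = ennreal q')"
  shows "Lp_norm q lborel (sphere_extension f) \<le> ennreal N * sphere_opnorm TYPE('n) (ennreal p) q"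
proof -
  define g where "g \<omega> = of_real (1 / N) * f \<omega>" for \<omega>
  have "smooth_on (sphere 0 1) g"
    unfolding g_def
    by (rule smooth_on_compose_linear[OF f(1) bounded_linear_ident _ bounded_linear_mult_right]) simp
  moreover have "Lp_norm (ennreal p) sphere_measure g = 1"
    unfolding g_def using f(2) N p
    by (subst Lp_norm_cmult) (auto simp: ennreal_mult[symmetric])
  ultimately have "Lp_norm q lborel (sphere_extension g) \<le> sphere_opnorm TYPE('n) (ennreal p) q"
    unfolding sphere_opnorm_def by (intro SUP_upper) auto
  moreover have "sphere_extension g = (\<lambda>x. of_real (1 / N) * sphere_extension f x)"
    by (simp add: fun_eq_iff sphere_extension_def g_def mult.left_commute)
  moreover have "sphere_extension f \<in> borel_measurable lborel"
    using borel_measurable_continuous_onI[OF continuous_on_sphere_extension[OF f(2)]] by simp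
  ultimately have "ennreal (1 / N) * Lp_norm q lborel (sphere_extension f) \<le> sphere_opnorm TYPE('n) (ennreal p) q"
    using Lp_norm_cmult[of "sphere_extension f" lborel "1 / N" q] N q by simp
  then have "ennreal N * (ennreal (1 / N) * Lp_norm q lborel (sphere_extension f)) \<le> ennreal N * sphere_opnorm TYPE('n) (ennreal p) q"
    by (rule mult_left_mono) simp
  then show ?thesis using N by (simp add: mult.assoc[symmetric] ennreal_mult[symmetric])
qed

text \<open>
The central idea. Add to \<open>F\<close>, which lives on the upper hemisphere, the antipodal copy
\<open>t * exp (\<i> * \<theta>) * cnj (F (- \<omega>))\<close>. The supports are disjoint, so the \<open>p\<close>-th power of the norm is multiplied by
\<open>1 + t powr p\<close>, whatever \<open>\<theta>\<close> is. The extension becomes \<open>z + t * exp (\<i> * \<theta>) * cnj z\<close>, where \<open>z\<close> is the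
extension of \<open>F\<close>. The bound given by the operator norm holds for each \<open>\<theta>\<close>, hence on average over \<open>\<theta>\<close>, and
by Tonelli's theorem that average may be taken at each point \<open>x\<close>, where it is an exact multiple of
\<open>|z| powr q\<close>.
\<close>

lemma antipodal_pair_bound:
  fixes F :: "real \<times> (real^'n::finite) \<Rightarrow> complex"
  assumes F: "smooth_on (sphere 0 1) F" "integrable sphere_measure F" and hemi: "\<And>\<omega>. fst \<omega> \<le> 0 \<Longrightarrow> F \<omega> = 0"
    and p: "0 < p" and q: "0 < q" and t: "0 \<le> t"
    and I: "(\<integral>\<^sup>+\<omega>. ennreal (norm (F \<omega>) powr p) \<partial>sphere_measure) = ennreal I" "0 < I"
    and S: "sphere_opnorm TYPE('n) (ennreal p) (ennreal q) = ennreal S" "0 \<le> S"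
  shows "circle_mean q t
      * (\<integral>\<^sup>+x. ennreal (norm (sphere_extension F x) powr q) \<partial>lborel)
    \<le> ennreal (2 * pi * (((1 + t powr p) * I) powr (1 / p) * S) powr q)"
proof -
  have [measurable]: "F \<in> borel_measurable sphere_measure" using F(2) by auto
  note anti = sphere_extension_antipodal_cnj[OF F(2)]
  have [measurable]: "sphere_extension F \<in> borel_measurable borel"
    using borel_measurable_continuous_onI[OF continuous_on_sphere_extension[OF F(2)]] .
  define G where "G \<theta> \<omega> = F \<omega> + of_real t * exp (\<i> * of_real \<theta>) * cnj (F (- \<omega>))" for \<theta> \<omega>
  define N where "N = ((1 + t powr p) * I) powr (1 / p)"
  have "0 < (1 + t powr p) * I" using I(2) by (intro mult_pos_pos add_pos_nonneg) auto
  then have N: "0 < N" unfolding N_def powr_gt_zero by (metis less_irrefl)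
  have G_smooth: "smooth_on (sphere 0 1) (G \<theta>)" for \<theta>
    unfolding G_def
  proof (rule smooth_on_add[OF F(1)])
    have "bounded_linear (\<lambda>z. of_real t * exp (\<i> * of_real \<theta>) * cnj z)"
      by (rule bounded_linear_compose[OF bounded_linear_mult_right bounded_linear_cnj])
    from smooth_on_compose_linear[OF F(1) _ _ this, of uminus "sphere 0 1"]
    show "smooth_on (sphere 0 1) (\<lambda>\<omega>. of_real t * exp (\<i> * of_real \<theta>) * cnj (F (- \<omega>)))"
      by (simp only: bounded_linear_minus[OF bounded_linear_ident] image_subset_iff mem_sphere_0 norm_minus_cancel) simp
  qed
  have G_int: "integrable sphere_measure (G \<theta>)" for \<theta> unfolding G_def using F(2) anti(1) by auto
  have G_ext: "sphere_extension (G \<theta>) x = sphere_extension F x + of_real t * exp (\<i> * of_real \<theta>) * cnj (sphere_extension F x)" for \<theta> x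
  proof -
    have i: "integrable sphere_measure (\<lambda>\<omega>. exp (\<i> * of_real (x \<bullet> \<omega>)) * F \<omega>)"
      "integrable sphere_measure (\<lambda>\<omega>. exp (\<i> * of_real (x \<bullet> \<omega>)) * cnj (F (- \<omega>)))"
      by (rule integrable_exp_mult[OF F(2) id_measurable_sphere_measure], rule integrable_exp_mult[OF anti(1) id_measurable_sphere_measure])
    have "sphere_extension (G \<theta>) x = (\<integral>\<omega>. exp (\<i> * of_real (x \<bullet> \<omega>)) * F \<omega>
        + of_real t * exp (\<i> * of_real \<theta>) * (exp (\<i> * of_real (x \<bullet> \<omega>)) * cnj (F (- \<omega>))) \<partial>sphere_measure)"
      unfolding sphere_extension_def G_def by (simp add: algebra_simps)
    also have "\<dots> = sphere_extension F x + of_real t * exp (\<i> * of_real \<theta>) * sphere_extension (\<lambda>\<omega>. cnj (F (- \<omega>))) x"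
      using i unfolding sphere_extension_def by (subst Bochner_Integration.integral_add) auto
    finally show ?thesis using anti(2)[of x] by simp
  qed
  have G_norm: "Lp_norm (ennreal p) sphere_measure (G \<theta>) = ennreal N" for \<theta>
  proof -
    have "norm (G \<theta> \<omega>) powr p = norm (F \<omega>) powr p + t powr p * norm (F (- \<omega>)) powr p" for \<omega>
    proof (cases "fst \<omega> \<le> 0")
      case True
      then show ?thesis using p t by (simp add: G_def hemi norm_mult powr_mult)
    next
      case False
      then have "F (- \<omega>) = 0" by (intro hemi) simp
      then show ?thesis using p by (simp add: G_def)
    qed
    then have "(\<integral>\<^sup>+\<omega>. ennreal (norm (G \<theta> \<omega>) powr p) \<partial>sphere_measure)
        = (\<integral>\<^sup>+\<omega>. ennreal (norm (F \<omega>) powr p) + ennreal (t powr p) * ennreal (norm (F (- \<omega>)) powr p) \<partial>sphere_measure)"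
      by (simp add: ennreal_mult)
    also have "\<dots> = ennreal I + ennreal (t powr p) * ennreal I"
    proof -
      have m: "(\<lambda>\<omega>. ennreal (norm (F (- \<omega>)) powr p)) \<in> borel_measurable sphere_measure"
        using measurable_compose[OF uminus_measurable_sphere_measure, of "\<lambda>\<omega>. ennreal (norm (F \<omega>) powr p)" borel] by simp
      show ?thesis
        using m nn_integral_sphere_measure_uminus[of "\<lambda>\<omega>. ennreal (norm (F \<omega>) powr p)"] I(1)
        by (simp add: nn_integral_add nn_integral_cmult)
    qed
    also have "\<dots> = ennreal ((1 + t powr p) * I)"
      using I(2) by (simp add: ennreal_mult[symmetric] ennreal_plus[symmetric] algebra_simps del: ennreal_plus)
    finally show ?thesis using p I(2) by (simp add: Lp_norm_ennreal Let_def N_def)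
  qed
  have slice: "(\<integral>\<^sup>+x. ennreal (norm (sphere_extension (G \<theta>) x) powr q) \<partial>lborel) \<le> ennreal ((N * S) powr q)" for \<theta>
  proof -
    have "Lp_norm (ennreal q) lborel (sphere_extension (G \<theta>)) \<le> ennreal N * ennreal S"
      unfolding S(1)[symmetric] using q by (intro Lp_norm_sphere_extension_le G_smooth G_int p G_norm N) auto
    then have "Lp_norm (ennreal q) lborel (sphere_extension (G \<theta>)) \<le> ennreal (N * S)"
      using N S(2) by (simp add: ennreal_mult)
    then show ?thesis using N S(2) q by (subst (asm) Lp_norm_le_iff) auto
  qed
  have "circle_mean q t
      * (\<integral>\<^sup>+x. ennreal (norm (sphere_extension F x) powr q) \<partial>lborel)
    = (\<integral>\<^sup>+x. ennreal (norm (sphere_extension F x) powr q) *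
        circle_mean q t \<partial>lborel)"
    by (subst nn_integral_multc) (auto simp: mult.commute)
  also have "\<dots> = (\<integral>\<^sup>+x. \<integral>\<^sup>+\<theta>. ennreal (norm (sphere_extension F x + of_real t * exp (\<i> * of_real \<theta>) * cnj (sphere_extension F x)) powr q)
        * indicator {0..2 * pi} \<theta> \<partial>lborel \<partial>lborel)"
    by (intro nn_integral_cong nn_integral_circle_conjugate[symmetric] q)
  \<comment> \<open>Tonelli: from the average at each point to the average of the norms.\<close>
  also have "\<dots> = (\<integral>\<^sup>+\<theta>. \<integral>\<^sup>+x. ennreal (norm (sphere_extension F x + of_real t * exp (\<i> * of_real \<theta>) * cnj (sphere_extension F x)) powr q)
        * indicator {0..2 * pi} \<theta> \<partial>lborel \<partial>lborel)"
    by (rule lborel_pair.Fubini') measurable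
  also have "\<dots> = (\<integral>\<^sup>+\<theta>. (\<integral>\<^sup>+x. ennreal (norm (sphere_extension (G \<theta>) x) powr q) \<partial>lborel) * indicator {0..2 * pi} \<theta> \<partial>lborel)"
    unfolding G_ext by (intro nn_integral_cong nn_integral_multc) measurable
  also have "\<dots> \<le> (\<integral>\<^sup>+\<theta>. ennreal ((N * S) powr q) * indicator {0..2 * pi} \<theta> \<partial>lborel)"
    by (intro nn_integral_mono mult_right_mono slice) simp
  also have "\<dots> = ennreal (2 * pi * (N * S) powr q)"
    by (simp add: nn_integral_cmult_indicator ennreal_mult[symmetric] mult.commute)
  finally show ?thesis by (simp only: N_def)
qed

section \<open>Passage to the paraboloid\<close>

text \<open>
The axis of the pole contributes \<open>1 / s\<^sup>2\<close> to the Jacobian, and each of the other directions \<open>1 / s\<close>.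
\<close>

lemma nn_integral_anisotropic_scaling:
  fixes G :: "real \<times> (real^'n::finite) \<Rightarrow> ennreal"
  assumes [measurable]: "G \<in> borel_measurable borel" and s: "0 < s"
  shows "(\<integral>\<^sup>+x. G x \<partial>lborel)
    = ennreal ((1 / s) ^ (CARD('n) + 2)) * (\<integral>\<^sup>+y. G (parabolic_point s y) \<partial>lborel)"
proof -
  have "G \<in> borel_measurable (lborel \<Otimes>\<^sub>M lborel)" unfolding lborel_prod by simp
  from lborel.nn_integral_fst[OF this]
  have "(\<integral>\<^sup>+x. G x \<partial>lborel) = (\<integral>\<^sup>+x0. \<integral>\<^sup>+x'. G (x0, x') \<partial>lborel \<partial>lborel)"
    unfolding lborel_prod by simp
  also have "\<dots> = (\<integral>\<^sup>+x0. ennreal ((1 / s) ^ CARD('n)) * (\<integral>\<^sup>+y'. G (x0, (1 / s) *\<^sub>R y') \<partial>lborel) \<partial>lborel)"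
    using s by (intro nn_integral_cong) (subst nn_integral_lborel_scaleR[of _ "1 / s"], auto)
  also have "\<dots> = ennreal ((1 / s) ^ CARD('n)) * (\<integral>\<^sup>+x0. \<integral>\<^sup>+y'. G (x0, (1 / s) *\<^sub>R y') \<partial>lborel \<partial>lborel)"
    by (rule nn_integral_cmult) measurable
  also have "(\<integral>\<^sup>+x0. \<integral>\<^sup>+y'. G (x0, (1 / s) *\<^sub>R y') \<partial>lborel \<partial>lborel)
      = ennreal \<bar>- 1 / s\<^sup>2\<bar> * (\<integral>\<^sup>+y0. \<integral>\<^sup>+y'. G (0 + (- 1 / s\<^sup>2) * y0, (1 / s) *\<^sub>R y') \<partial>lborel \<partial>lborel)"
    using s by (intro nn_integral_real_affine) auto
  also have "(\<integral>\<^sup>+y0. \<integral>\<^sup>+y'. G (0 + (- 1 / s\<^sup>2) * y0, (1 / s) *\<^sub>R y') \<partial>lborel \<partial>lborel)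
      = (\<integral>\<^sup>+y. G (parabolic_point s y) \<partial>lborel)"
    unfolding lborel_prod[symmetric] by (subst lborel.nn_integral_fst[symmetric]) auto
  finally have "(\<integral>\<^sup>+x. G x \<partial>lborel) = ennreal ((1 / s) ^ CARD('n)) * ennreal \<bar>- 1 / s\<^sup>2\<bar>
      * (\<integral>\<^sup>+y. G (parabolic_point s y) \<partial>lborel)"
    by (simp only: mult.assoc)
  also have "ennreal ((1 / s) ^ CARD('n)) * ennreal \<bar>- 1 / s\<^sup>2\<bar> = ennreal ((1 / s) ^ (CARD('n) + 2))"
    using s by (simp add: ennreal_mult[symmetric] power_add power_divide power2_eq_square)
  finally show ?thesis .
qed

lemma continuous_on_parabola_extension:
  fixes f :: "real^'n::finite \<Rightarrow> complex"
  assumes "integrable lborel f"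
  shows "continuous_on UNIV (parabola_extension f)"
  using continuous_on_integral_exp[OF assms, of "\<lambda>\<xi>. ((norm \<xi>)\<^sup>2 / 2, \<xi>)"]
  by (simp add: parabola_extension_def[abs_def])

lemma smooth_compact_supportE:
  fixes f :: "real^'n::finite \<Rightarrow> complex"
  assumes f: "smooth_on UNIV f" "compact (closure {\<xi>. f \<xi> \<noteq> 0})"
  obtains R where "0 < R" "\<And>\<xi>. f \<xi> \<noteq> 0 \<Longrightarrow> norm \<xi> < R" "integrable lborel f" "f \<in> borel_measurable borel"
proof -
  have cont: "continuous_on UNIV f" by (rule smooth_on_imp_continuous_on[OF f(1)])
  obtain R where R: "0 < R" "closure {\<xi>. f \<xi> \<noteq> 0} \<subseteq> ball 0 R"
    using bounded_subset_ballD[OF compact_imp_bounded[OF f(2)], of 0] by blast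
  have "integrable lborel (\<lambda>\<xi>. indicator (closure {\<xi>. f \<xi> \<noteq> 0}) \<xi> *\<^sub>R f \<xi>)"
    by (rule borel_integrable_compact[OF f(2) continuous_on_subset[OF cont]]) simp
  moreover have "(\<lambda>\<xi>. indicator (closure {\<xi>. f \<xi> \<noteq> 0}) \<xi> *\<^sub>R f \<xi>) = f"
    using closure_subset[of "{\<xi>. f \<xi> \<noteq> 0}"] by (auto simp: fun_eq_iff indicator_def)
  moreover have "norm \<xi> < R" if "f \<xi> \<noteq> 0" for \<xi>
    using R(2) closure_subset[of "{\<xi>. f \<xi> \<noteq> 0}"] that by auto
  ultimately show thesis
    using that R(1) borel_measurable_continuous_onI[OF cont] by metis
qed

lemma nn_integral_eq_1_if_Lp_norm_eq_1:
  assumes p: "0 < p" and "Lp_norm (ennreal p) M f = 1"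
  shows "(\<integral>\<^sup>+x. ennreal (norm (f x) powr p) \<partial>M) = 1"
proof -
  define I where "I = (\<integral>\<^sup>+x. ennreal (norm (f x) powr p) \<partial>M)"
  have fin: "I \<noteq> top" and I1: "ennreal (enn2real I powr (1 / p)) = 1"
    using assms by (auto simp: Lp_norm_ennreal Let_def I_def split: if_splits)
  then have 1: "enn2real I powr (1 / p) = 1" by (metis ennreal_eq_1)
  then have "(enn2real I powr (1 / p)) powr p = 1" by simp
  moreover have "(enn2real I powr (1 / p)) powr p = enn2real I" using p by (simp add: powr_powr)
  ultimately have "enn2real I = 1" by simp
  then show ?thesis using fin unfolding I_def[symmetric] by (metis ennreal_1 ennreal_enn2real_if)
qed

lemma tendsto_cap_distortion:
  assumes "r \<longlonglongrightarrow> 0"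
  shows "(\<lambda>n. cap_distortion TYPE('n::finite) (r n)) \<longlonglongrightarrow> 1"
proof -
  have "(\<lambda>n. cap_distortion TYPE('n) (r n)) \<longlonglongrightarrow> (1 / sqrt (1 - 0\<^sup>2)) ^ CARD('n)"
    unfolding cap_distortion_def by (intro tendsto_intros assms) simp
  then show ?thesis by simp
qed

lemma cap_scalesE:
  assumes R: "0 < R"
  obtains s :: "nat \<Rightarrow> real" where "s \<longlonglongrightarrow> 0" "\<And>n. 0 < s n" "\<And>n. s n * R < 1"
proof
  define s where "s n = (1 / R) * (1 / real (n + 2))" for n :: nat
  have "s \<longlonglongrightarrow> (1 / R) * 0"
    unfolding s_def by (intro tendsto_mult_left LIMSEQ_ignore_initial_segment lim_1_over_n)
  then show "s \<longlonglongrightarrow> 0" by simp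
  show "0 < s n" for n using R by (simp add: s_def)
  show "s n * R < 1" for n using R by (simp add: s_def)
qed

lemma cap_fun_powr_integralE:
  fixes f :: "real^'n::finite \<Rightarrow> complex"
  assumes f: "f \<in> borel_measurable borel" and supp: "\<And>\<xi>. f \<xi> \<noteq> 0 \<Longrightarrow> norm \<xi> < R"
    and R: "0 \<le> R" and s: "0 < s" "s * R < 1" and p: "0 < p"
    and I: "(\<integral>\<^sup>+\<xi>. ennreal (norm (f \<xi>) powr p) \<partial>lborel) = 1"
  obtains j where "(\<integral>\<^sup>+\<omega>. ennreal (norm (cap_fun s f \<omega>) powr p) \<partial>sphere_measure) = ennreal j"
    "0 < j" "j \<le> cap_distortion TYPE('n) (s * R) * s ^ CARD('n)"
proof -
  define J where "J = (\<integral>\<^sup>+\<omega>. ennreal (norm (cap_fun s f \<omega>) powr p) \<partial>sphere_measure)"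
  have b1: "1 \<le> cap_distortion TYPE('n) (s * R)" using s R by (intro cap_distortion_ge_1) auto
  have g: "(\<lambda>z::complex. ennreal (norm z powr p)) \<in> borel_measurable borel" by measurable
  have g0: "ennreal (norm (0::complex) powr p) = 0" using p by simp
  have lo: "ennreal (s ^ CARD('n)) \<le> J"
    using nn_integral_cap_fun(1)[OF f supp R s g g0] unfolding J_def I by simp
  have hi: "J \<le> ennreal (cap_distortion TYPE('n) (s * R) * s ^ CARD('n))"
    using nn_integral_cap_fun(2)[OF f supp R s g g0] b1 s(1) unfolding J_def I by (simp add: ennreal_mult)
  obtain j where j: "J = ennreal j" "0 \<le> j"
    using hi by (metis ennreal_cases ennreal_less_top le_less_trans less_irrefl)
  have "s ^ CARD('n) \<le> j" using lo j by simp
  then have "0 < j" using s(1) by (meson less_le_trans zero_less_power)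
  moreover have "0 \<le> cap_distortion TYPE('n) (s * R) * s ^ CARD('n)" using b1 s(1) by simp
  then have "j \<le> cap_distortion TYPE('n) (s * R) * s ^ CARD('n)"
    using hi unfolding j(1) by (rule ennreal_le_iff[THEN iffD1])
  ultimately show thesis using that j(1) unfolding J_def by blast
qed

text \<open>
Apply the bound for antipodal pairs to caps that shrink to the pole. The hypothesis \<open>scale\<close> is the relation
\<open>q = (d + 2) / d * p'\<close>: it says that all powers of the scale \<open>s\<close> cancel. In the limit, Fatou's lemma replaces
the rescaled spherical extension by the parabolic one.
\<close>

lemma circle_mean_parabola_extension_le:
  fixes f :: "real^'n::finite \<Rightarrow> complex"
  assumes f: "smooth_on UNIV f" "compact (closure {\<xi>. f \<xi> \<noteq> 0})"
    and I: "(\<integral>\<^sup>+\<xi>. ennreal (norm (f \<xi>) powr p) \<partial>lborel) = 1"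
    and p: "1 \<le> p" and q: "0 < q" and scale: "real CARD('n) * q / p = real CARD('n) * q - (real CARD('n) + 2)"
    and t: "0 \<le> t"
    and S: "sphere_opnorm TYPE('n) (ennreal p) (ennreal q) = ennreal S" "0 \<le> S"
  shows "circle_mean q t * (\<integral>\<^sup>+y. ennreal (norm (parabola_extension f y) powr q) \<partial>lborel)
    \<le> ennreal (2 * pi * ((1 + t powr p) powr (1 / p) * S) powr q)"
proof -
  obtain R where R: "0 < R" and supp: "\<And>\<xi>. f \<xi> \<noteq> 0 \<Longrightarrow> norm \<xi> < R"
    and f_int: "integrable lborel f" and f_meas [measurable]: "f \<in> borel_measurable borel"
    by (rule smooth_compact_supportE[OF f]) blast
  obtain s where s: "s \<longlonglongrightarrow> 0" "\<And>n. 0 < s n" "\<And>n. s n * R < 1" by (rule cap_scalesE[OF R]) blast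
  define d where "d = CARD('n)"
  define b where "b n = cap_distortion TYPE('n) (s n * R)" for n
  have b1: "1 \<le> b n" for n unfolding b_def using s(2,3)[of n] R by (intro cap_distortion_ge_1) auto
  have b_lim: "b \<longlonglongrightarrow> 1"
    unfolding b_def using tendsto_mult_left_zero[OF s(1), of R] by (intro tendsto_cap_distortion)
  define w where "w n y = norm (sphere_extension (cap_fun (s n) f) (parabolic_point (s n) y)) / s n ^ d" for n y
  have cap_int: "integrable sphere_measure (cap_fun (s n) f)" for n
    using R by (intro integrable_cap_fun[OF f_int f_meas supp _ s(2,3)]) auto
  have E_meas [measurable]: "sphere_extension (cap_fun (s n) f) \<in> borel_measurable borel" for n
    using borel_measurable_continuous_onI[OF continuous_on_sphere_extension[OF cap_int]] .
  have w_meas [measurable]: "w n \<in> borel_measurable borel" for n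
  proof -
    have "(\<lambda>y :: real \<times> (real^'n). parabolic_point (s n) y) \<in> borel_measurable borel"
      using s(2)[of n] by (intro borel_measurable_continuous_onI continuous_intros) auto
    from measurable_compose[OF this E_meas[of n]] show ?thesis unfolding w_def by measurable
  qed
  obtain B where B: "circle_mean q t = ennreal B" "0 \<le> B"
    using circle_mean_finite[OF q t] by (metis ennreal_cases less_irrefl)
  have key: "(\<integral>\<^sup>+y. ennreal (B * w n y powr q) \<partial>lborel) \<le> ennreal (2 * pi * (((1 + t powr p) * b n) powr (1 / p) * S) powr q)" for n
  proof -
    obtain j where j: "(\<integral>\<^sup>+\<omega>. ennreal (norm (cap_fun (s n) f \<omega>) powr p) \<partial>sphere_measure) = ennreal j"
      "0 < j" "j \<le> b n * s n ^ d"
      unfolding b_def d_def by (rule cap_fun_powr_integralE[OF f_meas supp less_imp_le[OF R] s(2,3) _ I]) (use p in auto)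
    have "circle_mean q t * (\<integral>\<^sup>+x. ennreal (norm (sphere_extension (cap_fun (s n) f) x) powr q) \<partial>lborel)
        \<le> ennreal (2 * pi * (((1 + t powr p) * j) powr (1 / p) * S) powr q)"
    proof (rule antipodal_pair_bound[OF _ cap_int])
      show "smooth_on (sphere 0 1) (cap_fun (s n) f)" by (rule smooth_on_cap_fun[OF f(1) supp s(2,3)])
      show "(\<integral>\<^sup>+\<omega>. ennreal (norm (cap_fun (s n) f \<omega>) powr p) \<partial>sphere_measure) = ennreal j"
        by (rule j(1))
    qed (use p q t j(2) S in \<open>auto simp: cap_fun_def\<close>)
    also have "(\<integral>\<^sup>+x. ennreal (norm (sphere_extension (cap_fun (s n) f) x) powr q) \<partial>lborel)
        = ennreal ((1 / s n) ^ (d + 2)) * (\<integral>\<^sup>+y. ennreal ((s n ^ d) powr q) * ennreal (w n y powr q) \<partial>lborel)"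
    proof (subst nn_integral_anisotropic_scaling[OF _ s(2)[of n]])
      have "norm (sphere_extension (cap_fun (s n) f) (parabolic_point (s n) y)) powr q = (s n ^ d) powr q * w n y powr q" for y
        using s(2)[of n] by (subst powr_mult[symmetric]) (auto simp: w_def)
      then show "ennreal ((1 / s n) ^ (CARD('n) + 2)) * (\<integral>\<^sup>+y. ennreal (norm (sphere_extension (cap_fun (s n) f) (parabolic_point (s n) y)) powr q) \<partial>lborel)
          = ennreal ((1 / s n) ^ (d + 2)) * (\<integral>\<^sup>+y. ennreal ((s n ^ d) powr q) * ennreal (w n y powr q) \<partial>lborel)"
        by (simp add: d_def ennreal_mult)
    qed measurable
    also have "(\<integral>\<^sup>+y. ennreal ((s n ^ d) powr q) * ennreal (w n y powr q) \<partial>lborel)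
        = ennreal ((s n ^ d) powr q) * (\<integral>\<^sup>+y. ennreal (w n y powr q) \<partial>lborel)"
      by (rule nn_integral_cmult) measurable
    also have "circle_mean q t * (ennreal ((1 / s n) ^ (d + 2)) * (ennreal ((s n ^ d) powr q) * (\<integral>\<^sup>+y. ennreal (w n y powr q) \<partial>lborel)))
        = ennreal ((1 / s n) ^ (d + 2) * (s n ^ d) powr q) * (\<integral>\<^sup>+y. ennreal (B * w n y powr q) \<partial>lborel)"
    proof -
      have "(\<integral>\<^sup>+y. ennreal (B * w n y powr q) \<partial>lborel) = ennreal B * (\<integral>\<^sup>+y. ennreal (w n y powr q) \<partial>lborel)"
        using B(2) by (subst nn_integral_cmult[symmetric]) (auto simp: ennreal_mult)
      moreover have "ennreal ((1 / s n) ^ (d + 2) * (s n ^ d) powr q) = ennreal ((1 / s n) ^ (d + 2)) * ennreal ((s n ^ d) powr q)"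
        using s(2)[of n] by (intro ennreal_mult) auto
      ultimately show ?thesis unfolding B(1) by (simp only: mult_ac)
    qed
    also have "(1 / s n) ^ (d + 2) * (s n ^ d) powr q = s n powr (real d * q / p)"
    proof -
      have "(1 / s n) ^ (d + 2) = 1 / s n powr real (d + 2)"
        using s(2)[of n] by (simp only: power_one_over powr_realpow)
      also have "\<dots> = s n powr (- (real d + 2))" by (simp only: powr_minus_divide of_nat_add of_nat_numeral)
      finally have "(1 / s n) ^ (d + 2) = s n powr (- (real d + 2))" .
      moreover have "(s n ^ d) powr q = s n powr (real d * q)"
        using s(2)[of n] by (simp add: powr_realpow[symmetric] powr_powr)
      moreover have "- (real d + 2) + real d * q = real d * q / p" using scale by (simp add: d_def)
      ultimately show ?thesis by (simp only: powr_add[symmetric])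
    qed
    finally have le: "ennreal (s n powr (real d * q / p)) * (\<integral>\<^sup>+y. ennreal (B * w n y powr q) \<partial>lborel)
        \<le> ennreal (2 * pi * (((1 + t powr p) * j) powr (1 / p) * S) powr q)" .
    have "2 * pi * (((1 + t powr p) * j) powr (1 / p) * S) powr q
        \<le> 2 * pi * (((1 + t powr p) * (b n * s n ^ d)) powr (1 / p) * S) powr q"
      using j(2,3) p q S(2) by (intro mult_left_mono powr_mono2 mult_right_mono) auto
    also have "\<dots> = s n powr (real d * q / p) * (2 * pi * (((1 + t powr p) * b n) powr (1 / p) * S) powr q)"
    proof -
      have "((1 + t powr p) * (b n * s n ^ d)) powr (1 / p) = ((1 + t powr p) * b n) powr (1 / p) * s n powr (real d / p)"
        using s(2)[of n] b1[of n] by (simp add: mult.assoc[symmetric] powr_mult powr_realpow[symmetric] powr_powr add_nonneg_nonneg)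
      then have "(((1 + t powr p) * (b n * s n ^ d)) powr (1 / p) * S) powr q
          = (s n powr (real d / p)) powr q * (((1 + t powr p) * b n) powr (1 / p) * S) powr q"
        by (subst powr_mult[symmetric]) (auto simp: mult_ac S(2))
      then show ?thesis by (simp add: powr_powr mult_ac)
    qed
    finally have "ennreal (s n powr (real d * q / p)) * (\<integral>\<^sup>+y. ennreal (B * w n y powr q) \<partial>lborel)
        \<le> ennreal (s n powr (real d * q / p)) * ennreal (2 * pi * (((1 + t powr p) * b n) powr (1 / p) * S) powr q)"
      using le by (subst ennreal_mult[symmetric]) (auto intro: order_trans ennreal_leI)
    then show ?thesis
      using s(2)[of n] by (subst (asm) ennreal_mult_le_mult_iff) auto
  qed
  have w_lim: "(\<lambda>n. w n y) \<longlonglongrightarrow> norm (parabola_extension f y)" for y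
    unfolding w_def d_def
    using R by (intro sphere_extension_cap_fun_tendsto[OF f_int f_meas supp _ s]) auto
  have E_P: "parabola_extension f \<in> borel_measurable borel"
    using borel_measurable_continuous_onI[OF continuous_on_parabola_extension[OF f_int]] .
  have "circle_mean q t * (\<integral>\<^sup>+y. ennreal (norm (parabola_extension f y) powr q) \<partial>lborel)
      = (\<integral>\<^sup>+y. ennreal (B * norm (parabola_extension f y) powr q) \<partial>lborel)"
    using E_P B by (subst nn_integral_cmult[symmetric]) (auto simp: ennreal_mult)
  also have "\<dots> = (\<integral>\<^sup>+y. liminf (\<lambda>n. ennreal (B * w n y powr q)) \<partial>lborel)"
  proof (intro nn_integral_cong)
    fix y
    have "(\<lambda>n. w n y powr q) \<longlonglongrightarrow> norm (parabola_extension f y) powr q"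
      by (rule tendsto_powr2[OF w_lim tendsto_const]) (use q s(2) in \<open>auto simp: w_def less_imp_le\<close>)
    then have "(\<lambda>n. ennreal (B * w n y powr q)) \<longlonglongrightarrow> ennreal (B * norm (parabola_extension f y) powr q)"
      by (intro tendsto_ennrealI tendsto_mult_left)
    then show "ennreal (B * norm (parabola_extension f y) powr q) = liminf (\<lambda>n. ennreal (B * w n y powr q))"
      by (simp add: lim_imp_Liminf)
  qed
  also have "\<dots> \<le> liminf (\<lambda>n. \<integral>\<^sup>+y. ennreal (B * w n y powr q) \<partial>lborel)"
    by (rule nn_integral_liminf) measurable
  also have "\<dots> \<le> liminf (\<lambda>n. ennreal (2 * pi * (((1 + t powr p) * b n) powr (1 / p) * S) powr q))"
    by (intro Liminf_mono always_eventually allI key)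
  also have "\<dots> = ennreal (2 * pi * (((1 + t powr p) * 1) powr (1 / p) * S) powr q)"
  proof (rule lim_imp_Liminf)
    have nn: "0 \<le> (1 + t powr p) * b n" for n using b1[of n] by (intro mult_nonneg_nonneg add_nonneg_nonneg) auto
    have "(\<lambda>n. ((1 + t powr p) * b n) powr (1 / p)) \<longlonglongrightarrow> ((1 + t powr p) * 1) powr (1 / p)"
      by (rule tendsto_powr2[OF tendsto_mult_left[OF b_lim] tendsto_const]) (use p nn in auto)
    then have "(\<lambda>n. ((1 + t powr p) * b n) powr (1 / p) * S) \<longlonglongrightarrow> ((1 + t powr p) * 1) powr (1 / p) * S"
      by (rule tendsto_mult_right)
    then have "(\<lambda>n. (((1 + t powr p) * b n) powr (1 / p) * S) powr q) \<longlonglongrightarrow> (((1 + t powr p) * 1) powr (1 / p) * S) powr q"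
      by (rule tendsto_powr2[OF _ tendsto_const]) (use q S(2) in auto)
    then show "(\<lambda>n. ennreal (2 * pi * (((1 + t powr p) * b n) powr (1 / p) * S) powr q)) \<longlonglongrightarrow> ennreal (2 * pi * (((1 + t powr p) * 1) powr (1 / p) * S) powr q)"
      by (intro tendsto_ennrealI tendsto_mult_left)
  qed simp
  finally show ?thesis by simp
qed

lemma bounded_if_AE_bounded:
  fixes F :: "'a::euclidean_space \<Rightarrow> complex"
  assumes "continuous_on UNIV F" "AE x in lborel. norm (F x) \<le> c"
  shows "norm (F x) \<le> c"
proof -
  have op: "open {x. c < norm (F x)}"
    using assms(1) by (intro open_Collect_less continuous_intros)
  have "{x. c < norm (F x)} \<in> null_sets lborel"
    using assms(2) op by (subst AE_iff_null_sets) (auto elim!: eventually_mono)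
  then have "negligible {x. c < norm (F x)}"
    using op by (simp add: negligible_iff_null_sets null_sets_completionI)
  then show ?thesis using open_not_negligible[OF op] by (auto simp: not_less[symmetric])
qed

text \<open>
For \<open>p = 1\<close> the rescaled extensions of shrinking caps are bounded by \<open>b n * S\<close> almost everywhere, hence
everywhere by continuity, and the bound passes to the pointwise limit.
\<close>

lemma norm_parabola_extension_le_sphere_opnorm:
  fixes f :: "real^'n::finite \<Rightarrow> complex"
  assumes f: "smooth_on UNIV f" "compact (closure {\<xi>. f \<xi> \<noteq> 0})"
    and I: "(\<integral>\<^sup>+\<xi>. ennreal (norm (f \<xi>) powr 1) \<partial>lborel) = 1"
    and S: "sphere_opnorm TYPE('n) (ennreal 1) \<infinity> = ennreal S" "0 \<le> S"
  shows "norm (parabola_extension f y) \<le> S"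
proof -
  obtain R where R: "0 < R" and supp: "\<And>\<xi>. f \<xi> \<noteq> 0 \<Longrightarrow> norm \<xi> < R"
    and f_int: "integrable lborel f" and f_meas [measurable]: "f \<in> borel_measurable borel"
    by (rule smooth_compact_supportE[OF f]) blast
  obtain s where s: "s \<longlonglongrightarrow> 0" "\<And>n. 0 < s n" "\<And>n. s n * R < 1" by (rule cap_scalesE[OF R]) blast
  define d where "d = CARD('n)"
  define b where "b n = cap_distortion TYPE('n) (s n * R)" for n
  have b1: "1 \<le> b n" for n unfolding b_def using s(2,3)[of n] R by (intro cap_distortion_ge_1) auto
  have b_lim: "b \<longlonglongrightarrow> 1"
    unfolding b_def using tendsto_mult_left_zero[OF s(1), of R] by (intro tendsto_cap_distortion)
  have cap_int: "integrable sphere_measure (cap_fun (s n) f)" for n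
    using R by (intro integrable_cap_fun[OF f_int f_meas supp _ s(2,3)]) auto
  have bound: "norm (sphere_extension (cap_fun (s n) f) x) / s n ^ d \<le> b n * S" for n x
  proof -
    obtain j where j: "(\<integral>\<^sup>+\<omega>. ennreal (norm (cap_fun (s n) f \<omega>) powr 1) \<partial>sphere_measure) = ennreal j"
      "0 < j" "j \<le> b n * s n ^ d"
      unfolding b_def d_def by (rule cap_fun_powr_integralE[OF f_meas supp less_imp_le[OF R] s(2,3) _ I]) (use zero_less_one in auto)
    have N: "Lp_norm (ennreal 1) sphere_measure (cap_fun (s n) f) = ennreal j"
      using j(1,2) by (simp add: Lp_norm_ennreal Let_def del: ennreal_1)
    have "Lp_norm \<infinity> lborel (sphere_extension (cap_fun (s n) f)) \<le> ennreal j * ennreal S"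
      unfolding S(1)[symmetric]
      by (intro Lp_norm_sphere_extension_le smooth_on_cap_fun[OF f(1) supp s(2,3)] cap_int N j(2)) auto
    then have le: "esssup lborel (\<lambda>x. ennreal (norm (sphere_extension (cap_fun (s n) f) x))) \<le> ennreal (j * S)"
      using j(2) S(2) by (simp add: Lp_norm_def ennreal_mult)
    have "AE x in lborel. norm (sphere_extension (cap_fun (s n) f) x) \<le> j * S"
      using esssup_AE[of "\<lambda>x. ennreal (norm (sphere_extension (cap_fun (s n) f) x))" lborel]
    proof eventually_elim
      case (elim x)
      have "ennreal (norm (sphere_extension (cap_fun (s n) f) x)) \<le> ennreal (j * S)" using elim le by (rule order_trans)
      then show ?case using j(2) S(2) by (simp add: ennreal_le_iff)
    qed
    then have "norm (sphere_extension (cap_fun (s n) f) x) \<le> j * S"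
      by (rule bounded_if_AE_bounded[OF continuous_on_sphere_extension[OF cap_int]])
    also have "\<dots> \<le> b n * s n ^ d * S" using j(3) S(2) by (intro mult_right_mono) auto
    finally show ?thesis using s(2)[of n] by (simp add: divide_le_eq mult_ac)
  qed
  have "norm (parabola_extension f y) \<le> 1 * S"
  proof (rule LIMSEQ_le)
    show "(\<lambda>n. norm (sphere_extension (cap_fun (s n) f) (parabolic_point (s n) y)) / s n ^ d) \<longlonglongrightarrow> norm (parabola_extension f y)"
      unfolding d_def using R by (intro sphere_extension_cap_fun_tendsto[OF f_int f_meas supp _ s]) auto
    show "(\<lambda>n. b n * S) \<longlonglongrightarrow> 1 * S" by (intro tendsto_mult b_lim tendsto_const)
  qed (use bound in blast)
  then show ?thesis by simp
qed

text \<open>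
Numerator and denominator both equal \<open>1 + t\<close>, so for \<open>p = 1\<close> the antipodal pair brings no gain.
\<close>

lemma alpha_infinity_le_1: "alpha 1 \<infinity> \<le> 1"
  unfolding alpha_def
proof (rule SUP_least)
  fix t :: real assume "t \<in> {0..1}"
  then have t: "0 \<le> t" by simp
  have "esssup (uniform_measure lborel {0..2 * pi}) (\<lambda>\<theta>. ennreal (norm (1 + of_real t * exp (\<i> * of_real \<theta>)))) \<le> ennreal (1 + t)"
  proof (rule esssup_I)
    show "AE \<theta> in uniform_measure lborel {0..2 * pi}. ennreal (norm (1 + of_real t * exp (\<i> * of_real \<theta>))) \<le> ennreal (1 + t)"
    proof (intro AE_I2 ennreal_leI)
      show "norm (1 + of_real t * exp (\<i> * of_real \<theta>)) \<le> 1 + t" for \<theta>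
        using norm_triangle_ineq[of 1 "of_real t * exp (\<i> * of_real \<theta>)"] t by (simp add: norm_mult)
    qed
  qed simp
  then have "esssup (uniform_measure lborel {0..2 * pi}) (\<lambda>\<theta>. ennreal (norm (1 + of_real t * exp (\<i> * of_real \<theta>)))) / ennreal (1 + t) \<le> 1"
    using t by (intro divide_le_posI_ennreal) (simp_all del: ennreal_plus)
  then show "Lp_norm \<infinity> (uniform_measure lborel {0..2 * pi}) (\<lambda>\<theta>. 1 + of_real t * exp (\<i> * of_real \<theta>))
      / ennreal ((1 + t powr 1) powr (1 / 1)) \<le> 1"
    using t by (simp add: Lp_norm_def del: ennreal_plus)
qed

section \<open>The lower bound for the spherical extension operator\<close>

theorem proposition1p3:
  fixes d :: nat and p :: real and q :: ennreal
  assumes "d = CARD('n::finite)"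
    and "1 \<le> p" and "p < 2 * (real d + 1) / real d"
    and "q = ennreal ((real d + 2) / real d) * conj_exponent p"
  shows "sphere_opnorm TYPE('n) (ennreal p) q \<ge> alpha p q * parabola_opnorm TYPE('n) (ennreal p) q"
proof (cases "sphere_opnorm TYPE('n) (ennreal p) q")
  case (real S)
  have d: "0 < real d" using assms(1) by simp
  show ?thesis
  proof (cases "p = 1")
    case True
    then have q: "q = \<infinity>" using assms(4) d by (simp add: conj_exponent_def ennreal_mult_top)
    have "parabola_opnorm TYPE('n) (ennreal p) q \<le> ennreal S"
      unfolding parabola_opnorm_def
    proof (rule SUP_least)
      fix f :: "real^'n \<Rightarrow> complex"
      assume "f \<in> {f. smooth_on UNIV f \<and> compact (closure {\<xi>. f \<xi> \<noteq> 0}) \<and> Lp_norm (ennreal p) lborel f = 1}"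
      then have f: "smooth_on UNIV f" "compact (closure {\<xi>. f \<xi> \<noteq> 0})" "Lp_norm (ennreal 1) lborel f = 1"
        using True by auto
      have "norm (parabola_extension f y) \<le> S" for y
        by (rule norm_parabola_extension_le_sphere_opnorm[OF f(1,2) nn_integral_eq_1_if_Lp_norm_eq_1[OF _ f(3)]])
          (use real True q in auto)
      moreover have "parabola_extension f \<in> borel_measurable lborel"
        using borel_measurable_continuous_onI[OF continuous_on_parabola_extension] smooth_compact_supportE[OF f(1,2)]
        by (metis measurable_lborel2)
      ultimately show "Lp_norm q lborel (parabola_extension f) \<le> ennreal S"
        using q by (auto simp: Lp_norm_def intro!: esssup_I AE_I2 ennreal_leI)
    qed
    then have "alpha p q * parabola_opnorm TYPE('n) (ennreal p) q \<le> 1 * ennreal S"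
      using alpha_infinity_le_1 True q by (intro mult_mono) auto
    then show ?thesis using real by simp
  next
    case False
    then have p: "1 < p" using assms(2) by simp
    define q' where "q' = (real d + 2) / real d * (p / (p - 1))"
    have q': "0 < q'" unfolding q'_def using p d by (intro mult_pos_pos divide_pos_pos) auto
    have q: "q = ennreal q'"
      using assms(4) False p d by (simp add: conj_exponent_def q'_def ennreal_mult[symmetric])
    have scale: "real CARD('n) * q' / p = real CARD('n) * q' - (real CARD('n) + 2)"
      using p d unfolding assms(1)[symmetric] q'_def by (simp add: field_simps)
    have single: "Lp_norm q (uniform_measure lborel {0..2 * pi}) (\<lambda>\<theta>. 1 + of_real t * exp (\<i> * of_real \<theta>))
        / ennreal ((1 + t powr p) powr (1 / p)) * Lp_norm q lborel (parabola_extension f) \<le> ennreal S"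
      if t: "t \<in> {0..1}" and f: "smooth_on UNIV f" "compact (closure {\<xi>. f \<xi> \<noteq> 0})" "Lp_norm (ennreal p) lborel f = 1"
      for t and f :: "real^'n \<Rightarrow> complex"
    proof -
      define c where "c = (1 + t powr p) powr (1 / p)"
      have c: "0 < c" unfolding c_def powr_gt_zero using powr_ge_zero[of t p] by linarith
      have t0: "0 \<le> t" using t by simp
      obtain B where B: "circle_mean q' t = ennreal B" "0 \<le> B"
        using circle_mean_finite[OF q' t0] by (metis ennreal_cases less_irrefl)
      define \<beta> where "\<beta> = B / (2 * pi)"
      have \<beta>: "0 \<le> \<beta>" using B by (simp add: \<beta>_def)
      have mean: "Lp_norm q (uniform_measure lborel {0..2 * pi}) (\<lambda>\<theta>. 1 + of_real t * exp (\<i> * of_real \<theta>)) = ennreal (\<beta> powr (1 / q'))"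
      proof -
        have "(\<integral>\<^sup>+\<theta>. ennreal (norm (1 + of_real t * exp (\<i> * of_real \<theta>)) powr q') \<partial>uniform_measure lborel {0..2 * pi})
            = circle_mean q' t / emeasure lborel {0..2 * pi}"
          unfolding circle_mean_def by (rule nn_integral_uniform_measure) measurable
        also have "\<dots> = ennreal \<beta>" unfolding B(1) \<beta>_def using B(2) by (simp add: divide_ennreal)
        finally show ?thesis using q q' \<beta> by (simp add: Lp_norm_ennreal Let_def)
      qed
      define J where "J = (\<integral>\<^sup>+y. ennreal (norm (parabola_extension f y) powr q') \<partial>lborel)"
      have "ennreal B * J \<le> ennreal (2 * pi * (c * S) powr q')"
        unfolding B(1)[symmetric] J_def c_def
        using real(2) q by (intro circle_mean_parabola_extension_le[OF f(1,2) nn_integral_eq_1_if_Lp_norm_eq_1[OF _ f(3)] _ q' scale t0 _ real(1)])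
          (use p in auto)
      show ?thesis
      proof (cases "\<beta> = 0")
        \<comment> \<open>Here the norm of the parabolic extension might be infinite, but \<open>0 * \<infinity> = 0\<close>.\<close>
        case True
        then show ?thesis unfolding mean by simp
      next
        case False
        then have B0: "0 < B" using B(2) by (simp add: \<beta>_def)
        have "J \<noteq> top"
        proof
          assume "J = top"
          then show False using \<open>ennreal B * J \<le> _\<close> B0 by (simp add: ennreal_mult_top top_unique)
        qed
        then obtain j where j: "J = ennreal j" "0 \<le> j" by (metis ennreal_cases)
        have "B * j \<le> 2 * pi * (c * S) powr q'"
          using \<open>ennreal B * J \<le> _\<close> j B by (simp add: ennreal_mult[symmetric])
        then have "\<beta> * j \<le> (c * S) powr q'" by (simp add: \<beta>_def field_simps)
        then have "(\<beta> * j) powr (1 / q') \<le> ((c * S) powr q') powr (1 / q')"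
          using q' \<beta> j by (intro powr_mono2) auto
        then have "\<beta> powr (1 / q') * j powr (1 / q') \<le> c * S"
          using q' \<beta> j c real by (simp add: powr_mult powr_powr)
        then have "\<beta> powr (1 / q') / c * j powr (1 / q') \<le> S" using c by (simp add: field_simps)
        moreover have "Lp_norm q lborel (parabola_extension f) = ennreal (j powr (1 / q'))"
          using q q' j by (simp add: Lp_norm_ennreal Let_def J_def)
        ultimately show ?thesis
          unfolding mean c_def[symmetric] using c
          by (simp add: divide_ennreal ennreal_mult[symmetric] ennreal_leI)
      qed
    qed
    show ?thesis
      unfolding real(2) alpha_def parabola_opnorm_def SUP_mult_right_ennreal SUP_mult_left_ennreal
      by (intro SUP_least) (use single in auto)
  qed
qed simp

end
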